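(* Let $K$ be an algebraically closed field of characteristic $p>0$, let $e \ge 1$ be an integer, let $l \geq 1$ be an integer not divisible by $p$, and let $C \subset \mathbb{P}^2$ be a smooth plane curve over $K$ of degree $d=p^el \ge 4$. If it is not the case that both $p=2$ and $l=1$ (i.e. $(p^e,l)\neq(2^e,1)$), then $\delta'(C)\le 1$.
   Context: For a smooth plane curve $C \subset \mathbb{P}^2$ over an algebraically closed field $K$ and a point $P \in \mathbb{P}^2 \setminus C$, let $\pi_P: C \to \mathbb{P}^1$, $R \mapsto \overline{PR}$, be the projection from $P$. The point $P$ is called an outer Galois point for $C$ if the function field extension $K(C)/\pi_P^*K(\mathbb{P}^1)$ is Galois. $\delta'(C)$ denotes the number of outer Galois points for $C$, i.e. Galois points contained in $\mathbb{P}^2 \setminus C$. *)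

theory Defs
  imports
    "HOL-Algebra.Algebra"
    "HOL-Algebra.Algebraic_Closure_Type"
    "HOL-Analysis.Analysis"
    "HOL-Computational_Algebra.Computational_Algebra"
    "HOL-Library.Extended_Nat"
begin

no_notation fps_nth (infixl \<open>$\<close> 75)

text \<open>
  Ternary polynomials are iterated univariate ones: \<open>K[X][Y][Z]\<close> is the type
  \<^typ>\<open>'a poly poly poly\<close>, the outermost variable being \<open>Z\<close>. The coefficient of
  \<open>X\<^sup>i Y\<^sup>j Z\<^sup>k\<close> in \<open>F\<close> is thus \<open>coeff (coeff (coeff F k) j) i\<close>.
\<close>

type_synonym 'a poly3 = "'a poly poly poly"

definition const3 :: "'a::comm_ring_1 \<Rightarrow> 'a poly3" where
  "const3 c = [:[:[:c:]:]:]"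

definition VarX :: "'a::comm_ring_1 poly3" where "VarX = [:[:[:0, 1:]:]:]"
definition VarY :: "'a::comm_ring_1 poly3" where "VarY = [:[:0, 1:]:]"
definition VarZ :: "'a::comm_ring_1 poly3" where "VarZ = [:0, 1:]"

definition eval3 :: "'a::comm_ring_1 poly3 \<Rightarrow> 'a ^ 3 \<Rightarrow> 'a" where
  "eval3 F v = poly (poly (poly F [:[:v $ 3:]:]) [:v $ 2:]) (v $ 1)"

definition dX :: "'a::field poly3 \<Rightarrow> 'a poly3" where "dX F = map_poly (map_poly pderiv) F"
definition dY :: "'a::field poly3 \<Rightarrow> 'a poly3" where "dY F = map_poly pderiv F"
definition dZ :: "'a::field poly3 \<Rightarrow> 'a poly3" where "dZ F = pderiv F"

text \<open>The zero polynomial is a form of every degree.\<close>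

definition form :: "nat \<Rightarrow> 'a::comm_ring_1 poly3 \<Rightarrow> bool" where
  "form n F \<longleftrightarrow> (\<forall>i j k. Polynomial.coeff (Polynomial.coeff (Polynomial.coeff F k) j) i \<noteq> 0 \<longrightarrow> i + j + k = n)"

definition proj_plane :: "('a::field ^ 3) set set" where
  "proj_plane = {P. vec.subspace P \<and> vec.dim P = 1}"

definition curve :: "'a::field poly3 \<Rightarrow> ('a ^ 3) set set" where
  "curve F = {P \<in> proj_plane. \<forall>v\<in>P. eval3 F v = 0}"

text \<open>
  Irreducibility of \<open>F\<close> is not required separately: over an algebraically closed field
  it follows from smoothness, two curves in the plane always having a common point.
\<close>

definition smooth_plane_curve :: "nat \<Rightarrow> 'a::field poly3 \<Rightarrow> bool" where
  "smooth_plane_curve d F \<longleftrightarrow> F \<noteq> 0 \<and> form d F \<and>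
     (\<forall>v. v \<noteq> 0 \<and> eval3 F v = 0 \<longrightarrow> eval3 (dX F) v \<noteq> 0 \<or> eval3 (dY F) v \<noteq> 0 \<or> eval3 (dZ F) v \<noteq> 0)"

text \<open>
  The function field of the curve \<open>F = 0\<close> consists of the fractions \<open>G / H\<close> of forms of
  equal degree with \<open>H\<close> not in the ideal \<open>(F)\<close>, two fractions being identified when their
  difference has numerator in \<open>(F)\<close>. It is the residue field of the local ring below.
\<close>

definition local_ring :: "'a::field poly3 \<Rightarrow> 'a poly3 fract ring" where
  "local_ring F = (ring_of_type_algebra :: 'a poly3 fract ring)
     \<lparr>carrier := {Fract G H | G H n. form n G \<and> form n H \<and> \<not> F dvd H}\<rparr>"

definition vanishing_ideal :: "'a::field poly3 \<Rightarrow> 'a poly3 fract set" where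
  "vanishing_ideal F = {Fract G H | G H n. form n G \<and> form n H \<and> \<not> F dvd H \<and> F dvd G}"

definition function_field :: "'a::field poly3 \<Rightarrow> 'a poly3 fract set ring" where
  "function_field F = local_ring F Quot vanishing_ideal F"

definition rational_function :: "'a::field poly3 \<Rightarrow> 'a poly3 \<Rightarrow> 'a poly3 \<Rightarrow> 'a poly3 fract set" where
  "rational_function F G H = vanishing_ideal F +>\<^bsub>local_ring F\<^esub> Fract G H"

definition linear_form :: "'a::comm_ring_1 ^ 3 \<Rightarrow> 'a poly3" where
  "linear_form a = const3 (a $ 1) * VarX + const3 (a $ 2) * VarY + const3 (a $ 3) * VarZ"

text \<open>
  The lines through \<open>P\<close> are the lines \<open>s A + t B = 0\<close> for a basis \<open>A, B\<close> of the linear forms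
  vanishing at \<open>P\<close>. The line through \<open>P\<close> and \<open>R\<close> is the one with \<open>(s : t) = (B(R) : - A(R))\<close>.
  So \<open>(A : B)\<close> is the projection from \<open>P\<close>, up to a choice of coordinates on the pencil of lines.
\<close>

definition pencil_basis :: "('a::field ^ 3) set \<Rightarrow> 'a ^ 3 \<Rightarrow> 'a ^ 3 \<Rightarrow> bool" where
  "pencil_basis P a b \<longleftrightarrow> a \<noteq> b \<and> vec.independent {a, b} \<and>
     (\<forall>v\<in>P. eval3 (linear_form a) v = 0 \<and> eval3 (linear_form b) v = 0)"

definition binary_form :: "nat \<Rightarrow> (nat \<Rightarrow> 'a::comm_ring_1) \<Rightarrow> 'a poly3 \<Rightarrow> 'a poly3 \<Rightarrow> 'a poly3" where
  "binary_form n c A B = (\<Sum>i\<le>n. const3 (c i) * A ^ i * B ^ (n - i))"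

text \<open>
  The pullback of \<open>K(\<P>\<^sup>1)\<close> along the projection \<open>(A : B)\<close>: all
  \<open>g(A, B) / h(A, B)\<close> with binary forms \<open>g\<close>, \<open>h\<close> of equal degree and \<open>h \<noteq> 0\<close>. If the centre \<open>P\<close>
  is not on the curve, then \<open>F\<close> does not divide \<open>h(A, B)\<close>, which is a product
  of linear forms vanishing at \<open>P\<close>.
\<close>

definition pullback_field :: "'a::field poly3 \<Rightarrow> 'a ^ 3 \<Rightarrow> 'a ^ 3 \<Rightarrow> 'a poly3 fract set set" where
  "pullback_field F a b =
     {rational_function F (binary_form n g (linear_form a) (linear_form b))
        (binary_form n h (linear_form a) (linear_form b)) | n g h. \<exists>i\<le>n. h i \<noteq> 0}"

definition field_automorphisms :: "('b, 'm) ring_scheme \<Rightarrow> 'b set \<Rightarrow> ('b \<Rightarrow> 'b) set" where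
  "field_automorphisms L k = {\<sigma> \<in> ring_iso L L. \<forall>x\<in>k. \<sigma> x = x}"

text \<open>An algebraic extension is Galois if its automorphisms fix nothing but the base field.\<close>

definition galois_extension :: "('b, 'm) ring_scheme \<Rightarrow> 'b set \<Rightarrow> bool" where
  "galois_extension L k \<longleftrightarrow> field L \<and> subfield k L \<and>
     (\<forall>x\<in>carrier L. (ring.algebraic L over k) x) \<and>
     {x \<in> carrier L. \<forall>\<sigma>\<in>field_automorphisms L k. \<sigma> x = x} = k"

text \<open>The pullback field does not depend on the choice of the basis \<open>a, b\<close>.\<close>

definition outer_galois_point :: "'a::field poly3 \<Rightarrow> ('a ^ 3) set \<Rightarrow> bool" where
  "outer_galois_point F P \<longleftrightarrow> P \<in> proj_plane - curve F \<and>
     (\<exists>a b. pencil_basis P a b \<and> galois_extension (function_field F) (pullback_field F a b))"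

definition outer_galois_number :: "'a::field poly3 \<Rightarrow> enat" where
  "outer_galois_number F =
     (if finite {P. outer_galois_point F P} then enat (card {P. outer_galois_point F P}) else \<infinity>)"

end

theory Submission
  imports Defs
begin

text \<open>
  Let \<open>C\<close> be the smooth curve \<open>F = 0\<close>, let \<open>P\<close> be an outer Galois point spanned by the vector \<open>p\<close>,
  and write \<open>D\<^sub>w F\<close> for the derivative of \<open>F\<close> in direction \<open>w\<close>.

  The Galois group of the projection from \<open>P\<close> consists of linear maps. In a chart \<open>C\<close> has
  the coordinate ring \<open>K[x, z] / (f)\<close>, where \<open>x\<close> generates the function field of the line and \<open>f\<close> is monic
  in \<open>z\<close> up to a constant. By smoothness this ring is integrally closed (lemma \<open>normal\<close>), so an automorphism
  over \<open>K(x)\<close> sends \<open>z\<close> to a polynomial. The same holds in the second chart, around \<open>x = \<infinity>\<close>, and the two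
  statements together leave only \<open>z \<mapsto> \<alpha> x + \<beta> + \<gamma> z\<close> (lemma \<open>aut_linear\<close>). The automorphisms are thus
  perspectivities \<open>v \<mapsto> v + f(v) p\<close> with a covector \<open>f\<close>, and there are exactly \<open>d\<close>
  perspectivities with centre \<open>P\<close> that preserve \<open>C\<close> (lemma \<open>card_perspectivities\<close>).

  Such a perspectivity has the factor \<open>1 + f(p)\<close>. The factors form a finite subgroup of \<open>K\<^sup>\<times>\<close>, whose
  order is prime to the characteristic. As the characteristic divides \<open>d\<close>, it divides the number of
  elations, the perspectivities with \<open>f(p) = 0\<close>. Moreover each axis \<open>f = 0\<close> of a nontrivial elation
  belongs to a second one \<open>\<zeta> f\<close>: take \<open>\<zeta> = 2\<close> in odd characteristic, and for \<open>\<zeta>\<close> a factor different from \<open>1\<close>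
  in characteristic two, where such a factor exists because \<open>d\<close> is not a power of two (lemma \<open>second_multiple\<close>).

  The polynomial \<open>F(v + t p) - F(v)\<close> in \<open>t\<close> has the \<open>d\<close> roots \<open>f(v)\<close>, hence \<open>D\<^sub>p F\<close> is, up to a constant,
  the product of the covectors of all nontrivial perspectivities with centre \<open>P\<close> (lemma \<open>polar_product\<close>).
  In particular it vanishes twice along the axis of every elation.

  Now let \<open>P\<close> and \<open>Q\<close> be two outer Galois points, spanned by \<open>p\<close> and \<open>q\<close>. Since the characteristic divides \<open>d\<close>,
  Euler's identity reads \<open>D\<^sub>v F(v) = 0\<close>. If the line \<open>P Q\<close> were the axis of an elation at \<open>P\<close>, then
  \<open>D\<^sub>p F\<close> and \<open>D\<^sub>q F\<close> would both vanish twice along it, by Euler's identity the whole gradient would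
  vanish there, and \<open>C\<close> would be singular (lemmas \<open>no_common_double_axis\<close>, \<open>elation_moves_other_centre\<close>).
  Otherwise Euler's identity on \<open>P Q\<close> compares the orders of \<open>D\<^sub>p F\<close> and \<open>D\<^sub>q F\<close> at \<open>P\<close> and gives that the number \<open>n\<close>
  of elations at \<open>P\<close>, the identity included, exceeds by two the number of nontrivial perspectivities at \<open>Q\<close> whose axis passes
  through \<open>P\<close> (lemma \<open>card_homologies_through_other_centre\<close>). On the axis of an elation at \<open>P\<close> the
  gradient of \<open>F\<close> reduces to \<open>D\<^sub>q F\<close>, which is therefore not zero there; restricted to the affine part of
  this line it has the degree \<open>d - 1 - (n - 2)\<close>, which is \<open>1\<close> modulo the characteristic, but its derivative
  is \<open>D\<^sub>q D\<^sub>p F = 0\<close>. This contradiction is lemma \<open>no_two_galois_centres\<close>.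
\<close>

hide_const (open) Polynomials.degree Polynomials.lead_coeff Divisibility.prime Divisibility.irreducible

section \<open>Polynomials in three variables\<close>

lemma infinite_UNIV_alg_closed: "infinite (UNIV :: 'a::alg_closed_field set)"
proof
  assume fin: "finite (UNIV :: 'a set)"
  define P :: "'a poly" where "P = (\<Prod>a\<in>UNIV. [:-a, 1:]) + 1"
  have deg: "degree (\<Prod>a\<in>(UNIV :: 'a set). [:-a, 1:]) = card (UNIV :: 'a set)"
    by (subst degree_prod_eq_sum_degree) auto
  have "card (UNIV :: 'a set) > 0" using fin by (simp add: card_gt_0_iff)
  then have "degree P > 0" unfolding P_def using deg by (subst degree_add_eq_left) auto
  then obtain x where "poly P x = 0" using alg_closed_imp_poly_has_root by blast
  moreover have "poly P x = 1"
    unfolding P_def using fin by (auto simp: poly_prod)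
  ultimately show False by simp
qed

lemma poly_eqI_cofinite:
  fixes P Q :: "'a::alg_closed_field poly"
  assumes "finite B" and "\<And>t. t \<notin> B \<Longrightarrow> poly P t = poly Q t"
  shows "P = Q"
proof (rule ccontr)
  assume "P \<noteq> Q"
  then have "finite {t. poly (P - Q) t = 0}" by (intro poly_roots_finite) simp
  then have "finite (B \<union> {t. poly (P - Q) t = 0})" using assms(1) by simp
  moreover have "B \<union> {t. poly (P - Q) t = 0} = UNIV" using assms(2) by auto
  ultimately show False using infinite_UNIV_alg_closed by metis
qed

lemma poly_eqI_all:
  fixes P Q :: "'a::alg_closed_field poly"
  assumes "\<And>t. poly P t = poly Q t"
  shows "P = Q"
  using poly_eqI_cofinite[of "{}" P Q] assms by simp

text \<open>
  Substitutions, evaluations and derivatives of ternary polynomials are compared by this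
  induction: it suffices to look at constants and variables.
\<close>

lemma poly3_induct [case_names const X Y Z add mult]:
  fixes E :: "'a::comm_ring_1 poly3"
  assumes "\<And>c. P (const3 c)" "P VarX" "P VarY" "P VarZ"
    and add: "\<And>u v. P u \<Longrightarrow> P v \<Longrightarrow> P (u + v)"
    and mult: "\<And>u v. P u \<Longrightarrow> P v \<Longrightarrow> P (u * v)"
  shows "P E"
proof -
  have 1: "P [:[:g:]:]" for g :: "'a poly"
  proof (induction g)
    case 0
    have "P (const3 0)" by (rule assms)
    then show ?case by (simp add: const3_def)
  next
    case (pCons a g)
    have "[:[:pCons a g:]:] = const3 a + VarX * [:[:g:]:]" by (simp add: const3_def VarX_def)
    then show ?case using assms pCons by metis
  qed
  have 2: "P [:g:]" for g :: "'a poly poly"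
  proof (induction g)
    case 0
    have "P (const3 0)" by (rule assms)
    then show ?case by (simp add: const3_def)
  next
    case (pCons a g)
    have "[:pCons a g:] = [:[:a:]:] + VarY * [:g:]" by (simp add: VarY_def)
    then show ?case using assms 1 pCons by metis
  qed
  show ?thesis
  proof (induction E)
    case 0
    have "P (const3 0)" by (rule assms)
    then show ?case by (simp add: const3_def)
  next
    case (pCons a g)
    have "pCons a g = [:a:] + VarZ * g" by (simp add: VarZ_def)
    then show ?case using assms 2 pCons by metis
  qed
qed

lemma const3_0 [simp]: "const3 0 = 0" and const3_1 [simp]: "const3 1 = 1"
  by (simp_all add: const3_def one_pCons)

lemma const3_add: "const3 (a + b) = const3 a + const3 b"
  and const3_mult: "const3 (a * b) = const3 a * const3 b"
  by (simp_all add: const3_def)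

definition coeff3 :: "'a::comm_ring_1 poly3 \<Rightarrow> nat \<Rightarrow> nat \<Rightarrow> nat \<Rightarrow> 'a" where
  "coeff3 E i j k = coeff (coeff (coeff E k) j) i"

lemma form_altdef: "form n E \<longleftrightarrow> (\<forall>i j k. coeff3 E i j k \<noteq> 0 \<longrightarrow> i + j + k = n)"
  by (simp add: form_def coeff3_def)

lemma sum_const_poly: "(\<Sum>x\<in>A. [:f x:]) = [:sum f A:]"
  by (induction A rule: infinite_finite_induct) auto

lemma poly3_expansion:
  fixes E :: "'a::comm_ring_1 poly3"
  shows "E = (\<Sum>k\<le>degree E. \<Sum>j\<le>degree (coeff E k). \<Sum>i\<le>degree (coeff (coeff E k) j).
           const3 (coeff3 E i j k) * VarX ^ i * VarY ^ j * VarZ ^ k)"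
proof -
  have VX: "VarX ^ i = [:[:monom 1 i:]:]" for i
    by (induction i) (simp_all add: VarX_def monom_Suc monom_0 flip: one_pCons)
  have VY: "VarY ^ i = [:monom 1 i:]" for i
    by (induction i) (simp_all add: VarY_def monom_Suc monom_0 flip: one_pCons)
  have VZ: "VarZ ^ i = monom 1 i" for i
    by (induction i) (simp_all add: VarZ_def monom_Suc monom_0 flip: one_pCons)
  have p1: "[:[:g:]:] = (\<Sum>i\<le>degree g. const3 (coeff g i) * VarX ^ i)" for g :: "'a poly"
  proof -
    have "(\<Sum>i\<le>degree g. const3 (coeff g i) * VarX ^ i) = (\<Sum>i\<le>degree g. [:[:monom (coeff g i) i:]:])"
      by (simp add: VX const3_def smult_monom)
    also have "\<dots> = [:[:\<Sum>i\<le>degree g. monom (coeff g i) i:]:]"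
      by (simp only: sum_const_poly)
    finally show ?thesis by (simp add: poly_as_sum_of_monoms)
  qed
  have p2: "[:g:] = (\<Sum>j\<le>degree g. [:[:coeff g j:]:] * VarY ^ j)" for g :: "'a poly poly"
  proof -
    have "(\<Sum>j\<le>degree g. [:[:coeff g j:]:] * VarY ^ j) = (\<Sum>j\<le>degree g. [:monom (coeff g j) j:])"
      by (simp add: VY smult_monom)
    also have "\<dots> = [:\<Sum>j\<le>degree g. monom (coeff g j) j:]"
      by (simp only: sum_const_poly)
    finally show ?thesis by (simp add: poly_as_sum_of_monoms)
  qed
  have "E = (\<Sum>k\<le>degree E. [:coeff E k:] * VarZ ^ k)"
    by (simp add: VZ smult_monom poly_as_sum_of_monoms)
  also have "\<dots> = (\<Sum>k\<le>degree E. (\<Sum>j\<le>degree (coeff E k). (\<Sum>i\<le>degree (coeff (coeff E k) j).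
           const3 (coeff3 E i j k) * VarX ^ i) * VarY ^ j) * VarZ ^ k)"
    by (subst p2, subst p1) (simp add: coeff3_def)
  finally show ?thesis by (simp add: sum_distrib_right)
qed

lemma form_induct [consumes 1, case_names zero add monomial]:
  fixes E :: "'a::comm_ring_1 poly3"
  assumes "form n E" and "P 0" and add: "\<And>u v. P u \<Longrightarrow> P v \<Longrightarrow> P (u + v)"
    and mono: "\<And>c i j k. i + j + k = n \<Longrightarrow> P (const3 c * VarX ^ i * VarY ^ j * VarZ ^ k)"
  shows "P E"
proof -
  have sum: "(\<And>x. x \<in> A \<Longrightarrow> P (f x)) \<Longrightarrow> P (sum f A)" for f :: "nat \<Rightarrow> 'a poly3" and A
    by (induction A rule: infinite_finite_induct) (auto intro: assms)
  have m: "P (const3 (coeff3 E i j k) * VarX ^ i * VarY ^ j * VarZ ^ k)" for i j k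
  proof (cases "coeff3 E i j k = 0")
    case True
    then show ?thesis using assms by simp
  next
    case False
    then show ?thesis using assms(1) mono by (simp add: form_altdef)
  qed
  show ?thesis by (subst poly3_expansion) (intro sum m)
qed

lemma form_add: "form n u \<Longrightarrow> form n v \<Longrightarrow> form n (u + v)"
  unfolding form_def coeff_add by (metis add.right_neutral)

lemma form_uminus: "form n u \<Longrightarrow> form n (- u)"
  by (fastforce simp: form_def)

lemma form_diff: "form n u \<Longrightarrow> form n v \<Longrightarrow> form n (u - v)"
  using form_add[OF _ form_uminus, of n u v] by simp

lemma form_0 [simp]: "form n 0"
  by (simp add: form_def)

lemma form_sum: "(\<And>x. x \<in> A \<Longrightarrow> form n (f x)) \<Longrightarrow> form n (sum f A)"
  by (induction A rule: infinite_finite_induct) (auto intro: form_add)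

lemma form_mult:
  fixes u v :: "'a::comm_ring_1 poly3"
  assumes "form m u" and "form n v"
  shows "form (m + n) (u * v)"
  unfolding form_def
proof (intro allI impI)
  fix i j k
  assume "coeff (coeff (coeff (u * v) k) j) i \<noteq> 0"
  then have "(\<Sum>k'\<le>k. \<Sum>j'\<le>j. \<Sum>i'\<le>i. coeff3 u i' j' k' * coeff3 v (i - i') (j - j') (k - k')) \<noteq> 0"
    by (simp add: coeff_mult coeff_sum coeff3_def)
  then obtain k' where k: "k' \<le> k"
    and "(\<Sum>j'\<le>j. \<Sum>i'\<le>i. coeff3 u i' j' k' * coeff3 v (i - i') (j - j') (k - k')) \<noteq> 0"
    by (metis (no_types, lifting) sum.neutral atMost_iff)
  then obtain j' where j: "j' \<le> j"
    and "(\<Sum>i'\<le>i. coeff3 u i' j' k' * coeff3 v (i - i') (j - j') (k - k')) \<noteq> 0"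
    by (metis (no_types, lifting) sum.neutral atMost_iff)
  then obtain i' where i: "i' \<le> i"
    and "coeff3 u i' j' k' * coeff3 v (i - i') (j - j') (k - k') \<noteq> 0"
    by (metis (no_types, lifting) sum.neutral atMost_iff)
  then have "i' + j' + k' = m" and "(i - i') + (j - j') + (k - k') = n"
    using assms unfolding form_altdef by (metis mult_zero_left, metis mult_zero_right)
  then show "i + j + k = m + n" using i j k by linarith
qed

lemma form_const3: "form 0 (const3 c)"
  by (auto simp: form_def const3_def coeff_pCons split: nat.splits)

lemma form_Vars: "form (Suc 0) VarX" "form (Suc 0) VarY" "form (Suc 0) VarZ"
  by (auto simp: form_def VarX_def VarY_def VarZ_def coeff_pCons one_pCons split: nat.splits)

lemma form_1: "form 0 1"
  using form_const3[of 1] by simp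

lemma form_power: "form n u \<Longrightarrow> form (k * n) (u ^ k)"
  by (induction k) (auto intro: form_mult simp: form_1)

lemma form_power1: "form (Suc 0) u \<Longrightarrow> form k (u ^ k)"
  using form_power[of "Suc 0" u k] by simp

lemma form_const_mult: "form n u \<Longrightarrow> form n (const3 c * u)"
  using form_mult[OF form_const3] by simp

lemma form_linear_form: "form (Suc 0) (linear_form a)"
  unfolding linear_form_def by (intro form_add form_const_mult form_Vars)

section \<open>Substitutions and derivations\<close>

definition ring_map :: "('b::comm_ring_1 \<Rightarrow> 'c::comm_ring_1) \<Rightarrow> bool" where
  "ring_map h \<longleftrightarrow> h 1 = 1 \<and> (\<forall>x y. h (x + y) = h x + h y) \<and> (\<forall>x y. h (x * y) = h x * h y)"

lemma ring_mapD:
  assumes "ring_map h"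
  shows "h 1 = 1" "h (x + y) = h x + h y" "h (x * y) = h x * h y" "h 0 = 0"
    "h (- x) = - h x" "h (x - y) = h x - h y"
proof -
  show "h 1 = 1" and a: "\<And>x y. h (x + y) = h x + h y" and "h (x * y) = h x * h y"
    using assms by (auto simp: ring_map_def)
  show z: "h 0 = 0" using a[of 0 0] by simp
  have m: "h (- x) = - h x" for x using a[of x "-x"] z by (simp add: eq_neg_iff_add_eq_0 add.commute)
  show "h (- x) = - h x" by (rule m)
  show "h (x - y) = h x - h y" using a[of x "-y"] m[of y] by simp
qed

lemma ring_map_sum: "ring_map h \<Longrightarrow> h (sum f A) = (\<Sum>x\<in>A. h (f x))"
  by (induction A rule: infinite_finite_induct) (auto simp: ring_mapD)

lemma ring_map_prod: "ring_map h \<Longrightarrow> h (prod f A) = (\<Prod>x\<in>A. h (f x))"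
  by (induction A rule: infinite_finite_induct) (auto simp: ring_mapD)

lemma ring_map_power: "ring_map h \<Longrightarrow> h (x ^ n) = h x ^ n"
  by (induction n) (auto simp: ring_mapD)

lemma ring_map_dvd: "ring_map h \<Longrightarrow> x dvd y \<Longrightarrow> h x dvd h y"
  by (auto simp: dvd_def ring_mapD)

lemma ring_map_map_poly:
  assumes "ring_map h"
  shows "ring_map (map_poly h)"
proof -
  note [simp] = ring_mapD[OF assms]
  have "map_poly h (p * q) = map_poly h p * map_poly h q" for p q
    by (rule poly_eqI) (simp add: coeff_map_poly coeff_mult ring_map_sum[OF assms])
  moreover have "map_poly h (p + q) = map_poly h p + map_poly h q" for p q
    by (rule poly_eqI) (simp add: coeff_map_poly)
  ultimately show ?thesis by (auto simp: ring_map_def map_poly_1)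
qed

lemma ring_map_poly: "ring_map (\<lambda>p. poly p x)"
  by (simp add: ring_map_def)

lemma ring_map_comp: "ring_map g \<Longrightarrow> ring_map h \<Longrightarrow> ring_map (\<lambda>x. g (h x))"
  by (simp add: ring_map_def)

lemma eval3_simps [simp]:
  fixes v :: "'a::comm_ring_1 ^ 3"
  shows "eval3 (u + w) v = eval3 u v + eval3 w v"
    and "eval3 (u * w) v = eval3 u v * eval3 w v"
    and "eval3 (u - w) v = eval3 u v - eval3 w v"
    and "eval3 (- u) v = - eval3 u v"
    and "eval3 0 v = 0" and "eval3 1 v = 1" and "eval3 (u ^ n) v = eval3 u v ^ n"
    and "eval3 (const3 c) v = c" and "eval3 VarX v = v $ 1" and "eval3 VarY v = v $ 2"
    and "eval3 VarZ v = v $ 3"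
  by (simp_all add: eval3_def const3_def VarX_def VarY_def VarZ_def)

text \<open>
  The value of a ternary polynomial at a point with coordinates in a ring that receives \<open>K\<close> through \<open>h\<close>. With
  coordinates in \<open>K[t]\<close> it restricts a form to a line, with coordinates in \<open>K[x][z]\<close> to an affine chart.
\<close>

definition subst3 :: "('a::comm_ring_1 \<Rightarrow> 'b::comm_ring_1) \<Rightarrow> 'b \<Rightarrow> 'b \<Rightarrow> 'b \<Rightarrow> 'a poly3 \<Rightarrow> 'b" where
  "subst3 h x y z E =
     poly (map_poly (\<lambda>G. poly (map_poly (\<lambda>g. poly (map_poly h g) x) G) y) E) z"

lemma ring_map_subst3: "ring_map h \<Longrightarrow> ring_map (subst3 h x y z)"
  unfolding subst3_def by (intro ring_map_comp[OF ring_map_poly] ring_map_map_poly)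

lemma subst3_generators:
  assumes "ring_map h"
  shows "subst3 h x y z (const3 c) = h c" and "subst3 h x y z VarX = x"
    and "subst3 h x y z VarY = y" and "subst3 h x y z VarZ = z"
  by (simp_all add: subst3_def const3_def VarX_def VarY_def VarZ_def map_poly_pCons
      ring_mapD[OF assms] map_poly_1)

definition derivation :: "('b::comm_ring_1 \<Rightarrow> 'b) \<Rightarrow> bool" where
  "derivation D \<longleftrightarrow> (\<forall>x y. D (x + y) = D x + D y) \<and> (\<forall>x y. D (x * y) = x * D y + y * D x)"

lemma derivation_0: "derivation D \<Longrightarrow> D 0 = 0"
  by (metis derivation_def mult_zero_left add_0)

lemma derivation_pderiv: "derivation (pderiv :: 'b::idom poly \<Rightarrow> 'b poly)"
  by (simp add: derivation_def pderiv_add pderiv_mult)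

lemma derivation_map_poly:
  assumes "derivation D"
  shows "derivation (map_poly D)"
proof -
  have D: "D 0 = 0" "\<And>x y. D (x + y) = D x + D y" "\<And>x y. D (x * y) = x * D y + y * D x"
    using assms derivation_0[OF assms] by (auto simp: derivation_def)
  have Ds: "D (sum f A) = (\<Sum>x\<in>A. D (f x))" for f :: "nat \<Rightarrow> 'a" and A
    by (induction A rule: infinite_finite_induct) (auto simp: D)
  have "map_poly D (p * q) = p * map_poly D q + q * map_poly D p" for p q
  proof (rule poly_eqI)
    fix n
    have "coeff (map_poly D (p * q)) n = coeff (p * map_poly D q + map_poly D p * q) n"
      by (simp only: coeff_add coeff_mult coeff_map_poly[of D, OF D(1)])
        (simp add: D Ds sum.distrib mult.commute)
    then show "coeff (map_poly D (p * q)) n = coeff (p * map_poly D q + q * map_poly D p) n"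
      by (simp add: mult.commute)
  qed
  moreover have "map_poly D (p + q) = map_poly D p + map_poly D q" for p q
    by (rule poly_eqI) (simp add: coeff_map_poly D)
  ultimately show ?thesis by (simp add: derivation_def)
qed

lemma derivation_partials: "derivation dX" "derivation dY" "derivation dZ"
proof -
  show "derivation dX" unfolding dX_def[abs_def] by (intro derivation_map_poly derivation_pderiv)
  show "derivation dY" unfolding dY_def[abs_def] by (intro derivation_map_poly derivation_pderiv)
  show "derivation dZ" unfolding dZ_def[abs_def] by (rule derivation_pderiv)
qed

lemma partials_generators [simp]:
  "dX (const3 c) = 0" "dX VarX = 1" "dX VarY = 0" "dX VarZ = 0"
  "dY (const3 c) = 0" "dY VarX = 0" "dY VarY = 1" "dY VarZ = 0"
  "dZ (const3 c) = 0" "dZ VarX = 0" "dZ VarY = 0" "dZ VarZ = 1"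
  by (simp_all add: dX_def dY_def dZ_def const3_def VarX_def VarY_def VarZ_def
      map_poly_pCons pderiv_pCons one_pCons)

definition Dir :: "'a::field ^ 3 \<Rightarrow> 'a poly3 \<Rightarrow> 'a poly3" where
  "Dir w E = const3 (w $ 1) * dX E + const3 (w $ 2) * dY E + const3 (w $ 3) * dZ E"

lemma derivation_Dir: "derivation (Dir w)"
proof -
  note d = derivation_partials[unfolded derivation_def]
  show ?thesis unfolding derivation_def Dir_def
    by (simp only: d[THEN conjunct1, rule_format] d[THEN conjunct2, rule_format])
      (simp add: algebra_simps)
qed

lemma Dir_simps [simp]:
  "Dir w (const3 c) = 0" "Dir w VarX = const3 (w $ 1)" "Dir w VarY = const3 (w $ 2)"
  "Dir w VarZ = const3 (w $ 3)" "Dir w (u + v) = Dir w u + Dir w v"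
  "Dir w (u * v) = u * Dir w v + v * Dir w u"
  "Dir w 0 = 0"
  using derivation_Dir[of w] derivation_0[OF derivation_Dir[of w]]
  by (simp_all add: derivation_def) (simp_all add: Dir_def)

lemma Dir_commute: "Dir v (Dir w E) = Dir w (Dir v E)"
  by (induction E rule: poly3_induct) (auto simp: algebra_simps)

lemma eval3_Dir:
  "eval3 (Dir w E) v = w $ 1 * eval3 (dX E) v + w $ 2 * eval3 (dY E) v + w $ 3 * eval3 (dZ E) v"
  by (simp add: Dir_def)

lemma eval3_Dir_linear [simp]:
  "eval3 (Dir (u + w) E) v = eval3 (Dir u E) v + eval3 (Dir w E) v"
  "eval3 (Dir (c *s w) E) v = c * eval3 (Dir w E) v"
  by (simp_all add: eval3_Dir algebra_simps)

definition line :: "'a::field poly3 \<Rightarrow> 'a ^ 3 \<Rightarrow> 'a ^ 3 \<Rightarrow> 'a poly" where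
  "line E v w = subst3 (\<lambda>c. [:c:]) [:v $ 1, w $ 1:] [:v $ 2, w $ 2:] [:v $ 3, w $ 3:] E"

lemma ring_map_const_poly: "ring_map (\<lambda>c. [:c:])"
  by (simp add: ring_map_def one_pCons)

lemma line_simps [simp]:
  "line (const3 c) v w = [:c:]" "line VarX v w = [:v $ 1, w $ 1:]"
  "line VarY v w = [:v $ 2, w $ 2:]" "line VarZ v w = [:v $ 3, w $ 3:]"
  "line (E + G) v w = line E v w + line G v w" "line (E * G) v w = line E v w * line G v w" "line 0 v w = 0"
  using ring_mapD[OF ring_map_subst3[OF ring_map_const_poly]]
    subst3_generators[OF ring_map_const_poly]
  by (simp_all add: line_def)

lemma poly_line [simp]: "poly (line E v w) t = eval3 E (v + t *s w)"
  by (induction E rule: poly3_induct) auto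

lemma pderiv_line: "pderiv (line E v w) = line (Dir w E) v w"
  by (induction E rule: poly3_induct) (auto simp: pderiv_pCons pderiv_mult pderiv_add)

text \<open>
  Homogeneity enters only through this rule and through Euler's identity, which is its derivative at \<open>t = 1\<close>.
\<close>

lemma eval3_scale:
  assumes "form n E"
  shows "eval3 E (t *s v) = t ^ n * eval3 E v"
  using assms
  by (induction rule: form_induct) (auto simp: algebra_simps power_mult_distrib power_add)

lemma Euler_identity:
  fixes E :: "'a::alg_closed_field poly3"
  assumes "form n E"
  shows "eval3 (Dir v E) v = of_nat n * eval3 E v"
proof -
  \<comment> \<open>On the line through the origin a form of degree n is a multiple of the n-th power.\<close>
  have "line E 0 v = monom (eval3 E v) n"
    by (rule poly_eqI_all) (simp add: poly_monom eval3_scale[OF assms])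
  then have "poly (line (Dir v E) 0 v) 1 = poly (pderiv (monom (eval3 E v) n)) 1"
    by (simp only: pderiv_line[symmetric])
  then show ?thesis by (simp add: pderiv_monom poly_monom)
qed

lemma poly3_eq_0_if_eval3:
  fixes E :: "'a::alg_closed_field poly3"
  assumes "\<And>v. eval3 E v = 0"
  shows "E = 0"
proof (rule ccontr)
  assume E: "E \<noteq> 0"
  have inj1: "inj (\<lambda>c :: 'a. [:[:c:]:])" and inj2: "inj (\<lambda>c :: 'a. [:c:])" by (auto simp: inj_on_def)
  have "finite {g. poly E g = 0}" using E by (rule poly_roots_finite)
  then have "finite ((\<lambda>c :: 'a. [:[:c:]:]) -` {g. poly E g = 0})" by (rule finite_vimageI[OF _ inj1])
  then obtain c where "c \<notin> (\<lambda>c :: 'a. [:[:c:]:]) -` {g. poly E g = 0}"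
    using ex_new_if_finite infinite_UNIV_alg_closed by metis
  then have "poly E [:[:c:]:] \<noteq> 0" by simp
  then have "finite {g. poly (poly E [:[:c:]:]) g = 0}" by (rule poly_roots_finite)
  then have "finite ((\<lambda>c :: 'a. [:c:]) -` {g. poly (poly E [:[:c:]:]) g = 0})"
    by (rule finite_vimageI[OF _ inj2])
  then obtain b where "b \<notin> (\<lambda>c :: 'a. [:c:]) -` {g. poly (poly E [:[:c:]:]) g = 0}"
    using ex_new_if_finite infinite_UNIV_alg_closed by metis
  then have b: "poly (poly E [:[:c:]:]) [:b:] \<noteq> 0" by simp
  have "poly (poly (poly E [:[:c:]:]) [:b:]) x = 0" for x
    using assms[of "vector [x, b, c]"] by (simp add: eval3_def)
  then show False using b poly_eqI_all[of "poly (poly E [:[:c:]:]) [:b:]" 0] by simp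
qed

section \<open>Vectors and covectors in dimension three\<close>

definition dotp :: "'a::comm_ring_1 ^ 3 \<Rightarrow> 'a ^ 3 \<Rightarrow> 'a" where
  "dotp f v = f $ 1 * v $ 1 + f $ 2 * v $ 2 + f $ 3 * v $ 3"

lemma dotp_simps [simp]:
  "dotp f (v + w) = dotp f v + dotp f w" "dotp f (v - w) = dotp f v - dotp f w"
  "dotp f (c *s v) = c * dotp f v" "dotp (f + g) v = dotp f v + dotp g v"
  "dotp (f - g) v = dotp f v - dotp g v" "dotp (c *s f) v = c * dotp f v"
  "dotp f 0 = 0" "dotp 0 v = 0"
  "dotp (- f) v = - dotp f v" "dotp f (- v) = - dotp f v"
  by (simp_all add: dotp_def algebra_simps)

lemma eval3_linear_form [simp]: "eval3 (linear_form f) v = dotp f v"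
  by (simp add: linear_form_def dotp_def)

lemma dotp_eqI:
  assumes "\<And>v. dotp f v = dotp g v"
  shows "f = g"
  using assms[of "vector [1, 0, 0]"] assms[of "vector [0, 1, 0]"] assms[of "vector [0, 0, 1]"]
  by (simp add: dotp_def vec_eq_iff forall_3)

lemma dotp_nonzero: "f \<noteq> 0 \<Longrightarrow> \<exists>v. dotp f v \<noteq> 0"
  using dotp_eqI[of f 0] by auto

lemma exists_generic_vector:
  fixes S :: "('a::alg_closed_field ^ 3) set"
  assumes "finite S" and "0 \<notin> S"
  shows "\<exists>w. \<forall>f\<in>S. dotp f w \<noteq> 0"
proof -
  define P where "P = (\<Prod>f\<in>S. [:f $ 1, f $ 2, f $ 3:])"
  have "[:f $ 1, f $ 2, f $ 3:] \<noteq> 0" if "f \<in> S" for f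
  proof -
    have "f \<noteq> 0" using that assms(2) by blast
    then show ?thesis by (auto simp: vec_eq_iff forall_3)
  qed
  then have "P \<noteq> 0" using assms(1) by (simp add: P_def)
  then obtain t where t: "poly P t \<noteq> 0" using poly_eqI_all[of P 0] by auto
  \<comment> \<open>A nonzero covector vanishes on finitely many of the vectors (1, t, t^2) only.\<close>
  have "dotp f (vector [1, t, t\<^sup>2]) \<noteq> 0" if "f \<in> S" for f
  proof
    assume "dotp f (vector [1, t, t\<^sup>2]) = 0"
    then have "poly [:f $ 1, f $ 2, f $ 3:] t = 0"
      by (simp add: dotp_def power2_eq_square algebra_simps)
    then show False using t that assms(1) by (auto simp: P_def poly_prod)
  qed
  then show ?thesis by blast
qed

definition indep2 :: "'a::field ^ 3 \<Rightarrow> 'a ^ 3 \<Rightarrow> bool" where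
  "indep2 p q \<longleftrightarrow> (\<forall>\<alpha> \<beta>. \<alpha> *s p + \<beta> *s q = 0 \<longrightarrow> \<alpha> = 0 \<and> \<beta> = 0)"

lemma indep2_sym: "indep2 p q \<Longrightarrow> indep2 q p"
  unfolding indep2_def by (metis add.commute)

lemma indep2_nonzero: assumes "indep2 p q" shows "p \<noteq> 0"
proof
  assume "p = 0"
  then have "1 *s p + 0 *s q = 0" by simp
  then show False using assms unfolding indep2_def by (metis one_neq_zero)
qed

lemma indep2_shift:
  assumes "indep2 p q"
  shows "p + t *s q \<noteq> 0"
proof
  assume "p + t *s q = 0"
  then have "1 *s p + t *s q = 0" by simp
  then show False using assms unfolding indep2_def by (metis one_neq_zero)
qed

lemma independent_indep2:
  assumes "indep2 p q"
  shows "vec.independent {p, q}" and "p \<noteq> q"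
proof -
  show ne: "p \<noteq> q"
  proof
    assume "p = q"
    then have "1 *s p + (-1) *s q = 0" by simp
    then show False using assms unfolding indep2_def by (metis one_neq_zero)
  qed
  have "q \<noteq> 0" using indep2_nonzero indep2_sym assms by blast
  moreover have "p \<notin> vec.span {q}"
  proof
    assume "p \<in> vec.span {q}"
    then obtain k where "p = k *s q" by (auto simp: vec.span_singleton)
    then have "1 *s p + (-k) *s q = 0" by simp
    then show False using assms unfolding indep2_def by (metis one_neq_zero)
  qed
  ultimately show "vec.independent {p, q}" using ne by (simp add: vec.independent_insert)
qed

lemma span_pair: "w \<in> vec.span {p, q} \<longleftrightarrow> (\<exists>\<alpha> \<beta>. w = \<alpha> *s p + \<beta> *s q)"
proof
  assume "w \<in> vec.span {p, q}"
  then obtain \<alpha> where "w - \<alpha> *s p \<in> vec.span {q}" by (auto simp: vec.span_breakdown_eq)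
  then obtain \<beta> where "w - \<alpha> *s p = \<beta> *s q" by (auto simp: vec.span_singleton)
  then show "\<exists>\<alpha> \<beta>. w = \<alpha> *s p + \<beta> *s q" by (metis diff_add_cancel add.commute)
next
  assume "\<exists>\<alpha> \<beta>. w = \<alpha> *s p + \<beta> *s q"
  then show "w \<in> vec.span {p, q}"
    by (auto intro!: vec.span_add vec.span_scale intro: vec.span_base)
qed

text \<open>
  All bases needed below consist of two independent vectors in a plane and a third one outside it.
\<close>

lemma basis_from_covector:
  fixes f :: "'a::field ^ 3"
  assumes "indep2 p q" and "dotp f p = 0" and "dotp f q = 0" and "dotp f r \<noteq> 0"
  shows "\<exists>\<alpha> \<beta> \<gamma>. w = \<alpha> *s p + \<beta> *s q + \<gamma> *s r"
proof -
  have r: "r \<notin> vec.span {p, q}" using assms by (auto simp: span_pair)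
  then have ind: "vec.independent {r, p, q}"
    using independent_indep2[OF assms(1)] vec.independent_insertI by blast
  have "r \<noteq> p" "r \<noteq> q" using assms by auto
  then have "card {r, p, q} = 3" using independent_indep2[OF assms(1)] by simp
  moreover have "vec.dim (UNIV :: ('a ^ 3) set) = 3" by (simp only: vec_dim_card) simp
  ultimately have "UNIV \<subseteq> vec.span {r, p, q}" using ind by (intro vec.card_ge_dim_independent) auto
  then obtain \<gamma> where "w - \<gamma> *s r \<in> vec.span {p, q}" by (metis vec.span_breakdown_eq UNIV_I subsetD)
  then show ?thesis by (metis span_pair diff_add_cancel)
qed

lemma exists_third_vector:
  fixes p q :: "'a::field ^ 3"
  shows "\<exists>s. \<forall>\<alpha> \<beta>. s \<noteq> \<alpha> *s p + \<beta> *s q"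
proof (rule ccontr)
  assume "\<not> ?thesis"
  then have "UNIV \<subseteq> vec.span {p, q}" by (auto simp: span_pair)
  then have "vec.dim (UNIV :: ('a ^ 3) set) \<le> card {p, q}" by (intro vec.dim_le_card) auto
  also have "card {p, q} \<le> 2" by (simp add: card_insert_le_m1)
  finally show False by (simp only: vec_dim_card) simp
qed

section \<open>Functions that are polynomial on lines\<close>

text \<open>
  Identities between polynomial functions are extended from a dense set to the whole space along lines;
  so polynomiality on lines is all that has to be known of such a function. In this form the class is closed
  under composition with perspectivities.
\<close>

definition poly_on_lines :: "('a::field ^ 3 \<Rightarrow> 'a) \<Rightarrow> bool" where
  "poly_on_lines g \<longleftrightarrow> (\<forall>v w. \<exists>P. \<forall>t. g (v + t *s w) = poly P t)"

lemma poly_on_lines_eval3: "poly_on_lines (eval3 E)"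
  unfolding poly_on_lines_def by (metis poly_line)

lemma poly_on_lines_const: "poly_on_lines (\<lambda>_. c)"
  unfolding poly_on_lines_def by (intro allI exI[of _ "[:c:]"]) simp

lemma poly_on_lines_dotp: "poly_on_lines (dotp f)"
  unfolding poly_on_lines_def
proof (intro allI)
  fix v w show "\<exists>P. \<forall>t. dotp f (v + t *s w) = poly P t"
    by (intro exI[of _ "[:dotp f v, dotp f w:]"]) simp
qed

lemma poly_on_lines_add:
  assumes "poly_on_lines g" "poly_on_lines h"
  shows "poly_on_lines (\<lambda>v. g v + h v)"
  using assms unfolding poly_on_lines_def by (metis poly_add)

lemma poly_on_lines_diff:
  assumes "poly_on_lines g" "poly_on_lines h"
  shows "poly_on_lines (\<lambda>v. g v - h v)"
  using assms unfolding poly_on_lines_def by (metis poly_diff)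

lemma poly_on_lines_mult:
  assumes "poly_on_lines g" "poly_on_lines h"
  shows "poly_on_lines (\<lambda>v. g v * h v)"
  using assms unfolding poly_on_lines_def by (metis poly_mult)

lemma poly_on_lines_prod:
  "(\<And>x. x \<in> A \<Longrightarrow> poly_on_lines (g x)) \<Longrightarrow> poly_on_lines (\<lambda>v. \<Prod>x\<in>A. g x v)"
  by (induction A rule: infinite_finite_induct)
    (auto intro: poly_on_lines_const poly_on_lines_mult)

lemma poly_on_lines_perspectivity:
  assumes "poly_on_lines g"
  shows "poly_on_lines (\<lambda>v. g (v + dotp f v *s p))"
  unfolding poly_on_lines_def
proof (intro allI)
  fix v w
  have "v + t *s w + dotp f (v + t *s w) *s p = (v + dotp f v *s p) + t *s (w + dotp f w *s p)" for t
    by (simp add: vec_eq_iff algebra_simps)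
  then show "\<exists>P. \<forall>t. g (v + t *s w + dotp f (v + t *s w) *s p) = poly P t"
    using assms unfolding poly_on_lines_def by metis
qed

lemma poly_on_lines_limit:
  fixes g :: "'a::alg_closed_field ^ 3 \<Rightarrow> 'a"
  assumes "poly_on_lines g" and "\<And>t. t \<noteq> 0 \<Longrightarrow> g (v + t *s w) = 0"
  shows "g v = 0"
proof -
  obtain P where P: "\<And>t. g (v + t *s w) = poly P t" using assms(1) unfolding poly_on_lines_def by metis
  have "P = 0" using poly_eqI_cofinite[of "{0}" P 0] P assms(2) by auto
  then show ?thesis using P[of 0] by simp
qed

section \<open>The restriction of a form to a line\<close>

lemma coeff_mult_top:
  fixes u v :: "'a::comm_ring_1 poly"
  assumes "degree u \<le> a" "degree v \<le> b"
  shows "coeff (u * v) (a + b) = coeff u a * coeff v b"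
proof -
  have "coeff (u * v) (a + b) = (\<Sum>i\<le>a + b. coeff u i * coeff v (a + b - i))" by (simp add: coeff_mult)
  also have "\<dots> = (\<Sum>i\<in>{a}. coeff u i * coeff v (a + b - i))"
  proof (intro sum.mono_neutral_right ballI)
    fix i assume "i \<in> {..a + b} - {a}"
    then have "i < a \<or> i > a" by auto
    then show "coeff u i * coeff v (a + b - i) = 0"
      using assms by (auto simp: coeff_eq_0)
  qed auto
  finally show ?thesis by simp
qed

text \<open>
  The coefficient of \<open>t\<^sup>n\<close> in \<open>E(v + t w)\<close> is \<open>E(w)\<close>. In particular, a line through a point off the curve
  meets the curve in exactly \<open>n\<close> points with multiplicity, none of them lost at infinity.
\<close>

lemma degree_coeff_line:
  fixes E :: "'a::field poly3"
  assumes "form n E"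
  shows "degree (line E v w) \<le> n \<and> coeff (line E v w) n = eval3 E w"
  using assms
proof (induction rule: form_induct)
  case zero
  then show ?case by simp
next
  case (add x y)
  then show ?case by (auto intro: degree_add_le)
next
  case (monomial c i j k)
  have pow: "degree ([:a, b:] ^ m) \<le> m \<and> coeff ([:a, b:] ^ m) m = b ^ m" for a b :: 'a and m
  proof (induction m)
    case (Suc m)
    have "coeff ([:a, b:] * [:a, b:] ^ m) (1 + m) = b * b ^ m"
      using Suc by (subst coeff_mult_top) auto
    moreover have "degree ([:a, b:] * [:a, b:] ^ m) \<le> 1 + m"
      using Suc by (intro degree_mult_le[THEN order_trans] add_mono) auto
    ultimately show ?case by (simp only: power_Suc plus_1_eq_Suc)
  qed simp
  have lp: "line (VarX ^ m) v w = [:v $ 1, w $ 1:] ^ m" "line (VarY ^ m) v w = [:v $ 2, w $ 2:] ^ m"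
    "line (VarZ ^ m) v w = [:v $ 3, w $ 3:] ^ m" for m
    using line_simps(1)[of 1 v w] by (induction m) (simp_all add: one_pCons)
  have mul: "degree (a * b) \<le> m + n \<and> coeff (a * b) (m + n) = x * y"
    if "degree a \<le> m \<and> coeff a m = x" "degree b \<le> n \<and> coeff b n = y" for a b :: "'a poly" and m n x y
    using that degree_mult_le[of a b] coeff_mult_top[of a m b n] by auto
  have "degree ([:c:] * [:v $ 1, w $ 1:] ^ i * [:v $ 2, w $ 2:] ^ j * [:v $ 3, w $ 3:] ^ k) \<le> 0 + i + j + k
    \<and> coeff ([:c:] * [:v $ 1, w $ 1:] ^ i * [:v $ 2, w $ 2:] ^ j * [:v $ 3, w $ 3:] ^ k) (0 + i + j + k)
       = c * (w $ 1) ^ i * (w $ 2) ^ j * (w $ 3) ^ k"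
    by (intro mul pow) simp
  then show ?case using monomial by (simp add: lp)
qed

lemma form_has_zero_on_line:
  fixes E :: "'a::alg_closed_field poly3"
  assumes "form n E" and "n > 0" and "eval3 E w \<noteq> 0"
  shows "\<exists>t. eval3 E (v + t *s w) = 0"
proof -
  have "degree (line E v w) \<ge> n"
    using degree_coeff_line[OF assms(1), of v w] assms(3) by (intro le_degree) simp
  then obtain t where "poly (line E v w) t = 0"
    using alg_closed_imp_poly_has_root[of "line E v w"] assms(2) by auto
  then show ?thesis by auto
qed

section \<open>Perspectivities preserving a curve\<close>

text \<open>
  The covector \<open>f\<close> represents the map \<open>v \<mapsto> v + f(v) p\<close>, which fixes every line through the centre \<open>p\<close> and
  every point of the axis \<open>f = 0\<close>. Scaling the matrix suitably, one can write each projective transformation with the first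
  property in this form, for exactly one \<open>f\<close>. It is an elation if its centre lies on its axis.
\<close>

definition perspectivities :: "'a::field poly3 \<Rightarrow> 'a ^ 3 \<Rightarrow> ('a ^ 3) set" where
  "perspectivities F p = {f. \<exists>c. c \<noteq> 0 \<and> (\<forall>v. eval3 F (v + dotp f v *s p) = c * eval3 F v)}"

definition elations :: "'a::field poly3 \<Rightarrow> 'a ^ 3 \<Rightarrow> ('a ^ 3) set" where
  "elations F p = {f \<in> perspectivities F p. dotp f p = 0}"

lemma perspectivities_0: "0 \<in> perspectivities F p"
  unfolding perspectivities_def by (auto intro: exI[of _ 1])

text \<open>
  The composition of the two maps, \<open>g\<close> first, in terms of the representing covectors. It shows that \<open>1 + f(p)\<close> is
  multiplicative.
\<close>

lemma perspectivities_comp: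
  assumes "f \<in> perspectivities F p" and "g \<in> perspectivities F p"
  shows "f + (1 + dotp f p) *s g \<in> perspectivities F p"
proof -
  obtain c where c: "c \<noteq> 0" "\<And>v. eval3 F (v + dotp f v *s p) = c * eval3 F v"
    using assms(1) by (auto simp: perspectivities_def)
  obtain c' where c': "c' \<noteq> 0" "\<And>v. eval3 F (v + dotp g v *s p) = c' * eval3 F v"
    using assms(2) by (auto simp: perspectivities_def)
  have "v + dotp (f + (1 + dotp f p) *s g) v *s p
      = (v + dotp g v *s p) + dotp f (v + dotp g v *s p) *s p" for v
    by (simp add: vec_eq_iff algebra_simps)
  then have "eval3 F (v + dotp (f + (1 + dotp f p) *s g) v *s p) = (c * c') * eval3 F v" for v
    by (simp only: c(2) c'(2)) simp
  then show ?thesis using c(1) c'(1) unfolding perspectivities_def by (auto intro!: exI[of _ "c * c'"])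
qed

text \<open>
  A maximal subgroup among those of order a power of two is everything: otherwise it could be doubled
  by adding a coset.
\<close>

lemma card_power_of_2:
  fixes S :: "'b::ab_group_add set"
  assumes "finite S" and "0 \<in> S" and add: "\<And>x y. x \<in> S \<Longrightarrow> y \<in> S \<Longrightarrow> x + y \<in> S"
    and exp2: "\<And>x. x \<in> S \<Longrightarrow> x + x = 0"
  shows "\<exists>k. card S = 2 ^ k"
proof -
  define Q where "Q H \<longleftrightarrow> H \<subseteq> S \<and> 0 \<in> H \<and> (\<forall>x\<in>H. \<forall>y\<in>H. x + y \<in> H) \<and> (\<exists>k. card H = 2 ^ k)" for H
  have Q0: "Q {0}" using assms(2) by (auto simp: Q_def intro: exI[of _ 0])
  have "finite (Collect Q)" by (rule finite_subset[of _ "Pow S"]) (auto simp: Q_def assms(1))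
  then obtain H where H: "Q H" and max: "\<And>H'. Q H' \<Longrightarrow> H \<subseteq> H' \<Longrightarrow> H' = H"
    using Q0 finite_has_maximal2[of "Collect Q" "{0}"] by auto
  have "H = S"
  proof (rule ccontr)
    assume "H \<noteq> S"
    then obtain s where s: "s \<in> S" "s \<notin> H" using H by (auto simp: Q_def)
    let ?H = "H \<union> (+) s ` H"
    have finH: "finite H" using H assms(1) by (auto simp: Q_def intro: finite_subset)
    have ss: "s + s = 0" using s exp2 by blast
    then have ss': "s + (s + y) = y" for y by (metis add.assoc add_0)
    have disj: "H \<inter> (+) s ` H = {}"
    proof (rule ccontr)
      assume "\<not> ?thesis"
      then obtain x where x: "x \<in> H" "s + x \<in> H" by auto
      then have "(s + x) + x \<in> H" using H by (auto simp: Q_def)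
      moreover have "(s + x) + x = s" using x H exp2 by (auto simp: Q_def add.assoc)
      ultimately show False using s by simp
    qed
    have "card ?H = card H + card H"
      using finH disj by (subst card_Un_disjoint) (auto simp: card_image)
    moreover obtain k where "card H = 2 ^ k" using H by (auto simp: Q_def)
    ultimately have "card ?H = 2 ^ Suc k" by simp
    moreover have "x + y \<in> ?H" if "x \<in> ?H" "y \<in> ?H" for x y
    proof -
      have HH: "\<And>x y. x \<in> H \<Longrightarrow> y \<in> H \<Longrightarrow> x + y \<in> H" using H by (auto simp: Q_def)
      consider "x \<in> H" "y \<in> H" | x' where "x = s + x'" "x' \<in> H" "y \<in> H"
        | y' where "x \<in> H" "y = s + y'" "y' \<in> H"
        | x' y' where "x = s + x'" "x' \<in> H" "y = s + y'" "y' \<in> H"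
        using \<open>x \<in> ?H\<close> \<open>y \<in> ?H\<close> by blast
      then show ?thesis
      proof cases
        case 1 then show ?thesis using HH by blast
      next
        case 2 then have "x + y = s + (x' + y)" by (simp add: algebra_simps)
        then show ?thesis using HH 2 by auto
      next
        case 3 then have "x + y = s + (x + y')" by (simp add: algebra_simps)
        then show ?thesis using HH 3 by auto
      next
        case 4
        have "x + y = s + (s + (x' + y'))" by (simp add: 4 algebra_simps)
        also have "\<dots> = x' + y'" by (rule ss')
        finally show ?thesis using HH[OF 4(2,4)] by simp
      qed
    qed
    moreover have "?H \<subseteq> S" "0 \<in> ?H" using H s add by (auto simp: Q_def)
    ultimately have "Q ?H" unfolding Q_def by blast
    then have "?H = H" using max by blast
    then show False using s H by (auto simp: Q_def dest: equalityD1)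
  qed
  then show ?thesis using H by (auto simp: Q_def)
qed

text \<open>
  The elements are roots of unity of order dividing \<open>card U\<close>. If the characteristic \<open>p\<close> divided this
  number, then they would already be roots of \<open>X\<^sup>k - 1\<close> with \<open>k = card U / p\<close>, because the Frobenius map is injective;
  but that polynomial has too few roots.
\<close>

lemma not_CHAR_dvd_card_mult_closed:
  fixes U :: "'a::field set"
  assumes "finite U" and "0 \<notin> U" and "1 \<in> U" and mult: "\<And>x y. x \<in> U \<Longrightarrow> y \<in> U \<Longrightarrow> x * y \<in> U"
    and "CHAR('a) > 0"
  shows "\<And>u. u \<in> U \<Longrightarrow> u ^ card U = 1" and "\<not> CHAR('a) dvd card U"
proof -
  have pr: "prime CHAR('a)" using assms(5) by (rule prime_CHAR_semidom)
  show root: "u ^ card U = 1" if "u \<in> U" for u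
  proof -
    have inj: "inj_on ((*) u) U" using that assms(2) by (auto simp: inj_on_def)
    have "(*) u ` U = U"
      using that mult inj assms(1) by (intro card_subset_eq) (auto simp: card_image)
    then have "(\<Prod>x\<in>U. x) = (\<Prod>x\<in>U. u * x)" using prod.reindex[OF inj, of "\<lambda>x. x"] by simp
    also have "\<dots> = u ^ card U * (\<Prod>x\<in>U. x)" by (simp add: prod.distrib)
    finally have "(u ^ card U - 1) * (\<Prod>x\<in>U. x) = 0" by (simp add: algebra_simps)
    moreover have "(\<Prod>x\<in>U. x) \<noteq> 0" using assms by auto
    ultimately show ?thesis by simp
  qed
  show "\<not> CHAR('a) dvd card U"
  proof
    assume "CHAR('a) dvd card U"
    then obtain k where k: "card U = CHAR('a) * k" by (auto simp: dvd_def)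
    have "card U > 0" using assms(1,3) by (auto simp: card_gt_0_iff)
    then have k0: "k > 0" using k by (cases k) auto
    have uk: "u ^ k = 1" if "u \<in> U" for u
    proof -
      have "((u ^ k - 1) + 1) ^ CHAR('a) = (u ^ k - 1) ^ CHAR('a) + 1 ^ CHAR('a)"
        by (rule freshmans_dream[OF pr refl])
      moreover have "((u ^ k - 1) + 1) ^ CHAR('a) = 1"
        using root[OF that] k by (simp flip: power_mult add: mult.commute)
      ultimately have "(u ^ k - 1) ^ CHAR('a) = 0" by simp
      then show ?thesis by simp
    qed
    define P where "P = monom (1 :: 'a) k - 1"
    have "coeff P k = 1" using k0 by (simp add: P_def)
    then have P0: "P \<noteq> 0" by auto
    have "degree P \<le> k" unfolding P_def by (intro degree_diff_le) (auto simp: degree_monom_le)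
    moreover have "U \<subseteq> {x. poly P x = 0}" using uk by (auto simp: P_def poly_monom)
    then have "card U \<le> card {x. poly P x = 0}" by (intro card_mono poly_roots_finite P0)
    moreover have "card {x. poly P x = 0} \<le> degree P" by (rule card_poly_roots_bound[OF P0])
    ultimately have "card U \<le> k" by linarith
    moreover have "k < card U" using k k0 prime_gt_1_nat[OF pr] by simp
    ultimately show False by simp
  qed
qed

text \<open>
  A point off the curve which is the centre of as many perspectivities preserving the curve as the degree indicates. Outer
  Galois points will turn out to be of this kind.
\<close>

locale galois_centre =
  fixes F :: "'a::alg_closed_field poly3" and p :: "'a ^ 3" and d :: nat
  assumes form_F: "form d F" and d_pos: "d > 0" and p_notin: "eval3 F p \<noteq> 0"
    and card_G: "card (perspectivities F p) = d"
begin

abbreviation "G \<equiv> perspectivities F p"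
abbreviation "N \<equiv> elations F p"

lemma finite_G: "finite G"
  using card_G d_pos card_gt_0_iff by metis

lemma finite_N: "finite N" and N_subset: "N \<subseteq> G" and zero_N: "0 \<in> N"
  using finite_G perspectivities_0 by (auto simp: elations_def)

text \<open>
  The multiplier of \<open>F\<close> is read off at the centre, where the map is multiplication by \<open>1 + f(p)\<close>.
\<close>

lemma factor:
  assumes "f \<in> G"
  shows "1 + dotp f p \<noteq> 0" and "eval3 F (v + dotp f v *s p) = (1 + dotp f p) ^ d * eval3 F v"
proof -
  obtain c where c: "c \<noteq> 0" "\<And>v. eval3 F (v + dotp f v *s p) = c * eval3 F v"
    using assms by (auto simp: perspectivities_def)
  have "p + dotp f p *s p = (1 + dotp f p) *s p" by (simp add: vec_eq_iff algebra_simps)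
  then have "eval3 F ((1 + dotp f p) *s p) = c * eval3 F p"
    using c(2)[of p] by (simp only:)
  then have "(1 + dotp f p) ^ d * eval3 F p = c * eval3 F p"
    by (simp only: eval3_scale[OF form_F])
  then have "c = (1 + dotp f p) ^ d" using p_notin by simp
  then show "1 + dotp f p \<noteq> 0" "eval3 F (v + dotp f v *s p) = (1 + dotp f p) ^ d * eval3 F v"
    using c d_pos by (auto simp: power_0_left)
qed

lemma inverse_G:
  assumes "f \<in> G"
  shows "(- inverse (1 + dotp f p)) *s f \<in> G"
proof -
  let ?\<gamma> = "1 + dotp f p"
  let ?g = "(- inverse ?\<gamma>) *s f"
  have \<gamma>: "?\<gamma> \<noteq> 0" using factor[OF assms] by simp
  have "dotp f (v + dotp ?g v *s p) = inverse ?\<gamma> * dotp f v" for v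
  proof -
    have "dotp f (v + dotp ?g v *s p) = dotp f v * (1 - inverse ?\<gamma> * dotp f p)"
      by (simp add: algebra_simps)
    also have "1 - inverse ?\<gamma> * dotp f p = inverse ?\<gamma>" using \<gamma> by (simp add: field_simps)
    finally show ?thesis by simp
  qed
  then have "(v + dotp ?g v *s p) + dotp f (v + dotp ?g v *s p) *s p = v" for v
    by (simp add: vec_eq_iff)
  then have eq: "?\<gamma> ^ d * eval3 F (v + dotp ?g v *s p) = eval3 F v" for v
    using factor(2)[OF assms, of "v + dotp ?g v *s p"] by (simp only:)
  have "eval3 F (v + dotp ?g v *s p) = inverse (?\<gamma> ^ d) * eval3 F v" for v
    unfolding eq[of v, symmetric] using \<gamma> by simp
  then show ?thesis
    using \<gamma> unfolding perspectivities_def by (auto intro!: exI[of _ "inverse (?\<gamma> ^ d)"])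
qed

text \<open>
  The image of the group under \<open>f \<mapsto> 1 + f(p)\<close>, whose kernel is the group \<open>N\<close> of elations. All fibres have
  the size of the kernel.
\<close>

definition U where "U = (\<lambda>f. 1 + dotp f p) ` G"

lemma U_props: "finite U" "0 \<notin> U" "1 \<in> U" "x \<in> U \<Longrightarrow> y \<in> U \<Longrightarrow> x * y \<in> U"
proof -
  show "finite U" "0 \<notin> U" using finite_G factor by (auto simp: U_def)
  show "1 \<in> U" using perspectivities_0[of F p] unfolding U_def by (intro image_eqI[of _ _ 0]) auto
  assume "x \<in> U" "y \<in> U"
  then obtain f g where fg: "f \<in> G" "g \<in> G" "x = 1 + dotp f p" "y = 1 + dotp g p" by (auto simp: U_def)
  have "x * y = 1 + dotp (f + (1 + dotp f p) *s g) p" by (simp add: fg algebra_simps)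
  then show "x * y \<in> U"
    unfolding U_def by (rule image_eqI) (rule perspectivities_comp[OF fg(1,2)])
qed

lemma card_fibre:
  assumes "u \<in> U"
  shows "card {f \<in> G. 1 + dotp f p = u} = card N"
proof -
  obtain g where g: "g \<in> G" "u = 1 + dotp g p" using assms by (auto simp: U_def)
  have u: "u \<noteq> 0" using g factor by auto
  have "bij_betw (\<lambda>h. g + u *s h) N {f \<in> G. 1 + dotp f p = u}"
  proof (rule bij_betw_imageI)
    show "inj_on (\<lambda>h. g + u *s h) N" using u by (auto simp: inj_on_def vec_eq_iff)
    show "(\<lambda>h. g + u *s h) ` N = {f \<in> G. 1 + dotp f p = u}"
    proof (intro equalityI subsetI)
      fix f assume "f \<in> (\<lambda>h. g + u *s h) ` N"
      then show "f \<in> {f \<in> G. 1 + dotp f p = u}"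
        using g perspectivities_comp[OF g(1)] by (auto simp: elations_def)
    next
      fix f assume f: "f \<in> {f \<in> G. 1 + dotp f p = u}"
      let ?i = "(- inverse u) *s g"
      have "?i + (1 + dotp ?i p) *s f \<in> G"
        using inverse_G[OF g(1)] f g(2) by (intro perspectivities_comp) (simp_all only: mem_Collect_eq)
      moreover have i: "1 + dotp ?i p = inverse u"
        using u g by (simp add: field_simps)
      ultimately have "?i + inverse u *s f \<in> G" by (simp only:)
      moreover have "dotp (?i + inverse u *s f) p = 0" using f g(2) by (auto simp: algebra_simps)
      ultimately have "?i + inverse u *s f \<in> N" unfolding elations_def by blast
      moreover have "f = g + u *s (?i + inverse u *s f)" using u by (simp add: vec_eq_iff field_simps)
      ultimately show "f \<in> (\<lambda>h. g + u *s h) ` N" by blast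
    qed
  qed
  then show ?thesis by (simp add: bij_betw_same_card)
qed

lemma card_product: "d = card U * card N"
proof -
  have "d = (\<Sum>f\<in>G. 1)" using card_G by simp
  also have "\<dots> = (\<Sum>u\<in>U. \<Sum>f\<in>{f \<in> G. 1 + dotp f p = u}. 1)"
    using U_props finite_G by (intro sum.group[symmetric]) (auto simp: U_def)
  also have "\<dots> = (\<Sum>u\<in>U. card N)" by (intro sum.cong) (auto simp: card_fibre)
  finally show ?thesis by simp
qed

context
  assumes CHAR_pos: "CHAR('a) > 0"
begin

lemma invariant:
  assumes "f \<in> G"
  shows "eval3 F (v + dotp f v *s p) = eval3 F v"
proof -
  have "(1 + dotp f p) \<in> U" using assms by (auto simp: U_def)
  then have "(1 + dotp f p) ^ card U = 1"
    by (intro not_CHAR_dvd_card_mult_closed(1)) (simp_all add: U_props CHAR_pos)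
  then have "(1 + dotp f p) ^ d = 1" by (subst card_product) (simp only: power_mult power_one)
  then show ?thesis using factor(2)[OF assms] by simp
qed

lemma CHAR_dvd_card_N:
  assumes "CHAR('a) dvd d"
  shows "CHAR('a) dvd card N"
proof -
  have "\<not> CHAR('a) dvd card U"
    by (intro not_CHAR_dvd_card_mult_closed(2)) (simp_all add: U_props CHAR_pos)
  moreover have "CHAR('a) dvd card U * card N" using assms by (simp only: card_product[symmetric])
  ultimately show ?thesis
    using prime_dvd_mult_iff[OF prime_CHAR_semidom[OF CHAR_pos]] by blast
qed

lemma N_add: "f \<in> N \<Longrightarrow> g \<in> N \<Longrightarrow> f + g \<in> N"
  using perspectivities_comp[of f F p g] by (auto simp: elations_def)

text \<open>
  Conjugating the elation \<open>f\<close> with a perspectivity of factor \<open>u\<close> gives the elation \<open>u f\<close>, with the same axis.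
\<close>

lemma N_scale:
  assumes "f \<in> N" and "u \<in> U"
  shows "u *s f \<in> N"
proof -
  obtain g where g: "g \<in> G" "u = 1 + dotp g p" using assms by (auto simp: U_def)
  have u: "u \<noteq> 0" using g factor by auto
  have "f + (1 + dotp f p) *s ((- inverse u) *s g) \<in> G"
    using assms g inverse_G[OF g(1)] by (intro perspectivities_comp) (auto simp: elations_def)
  then have "f + (- inverse u) *s g \<in> G" using assms by (simp add: elations_def)
  from perspectivities_comp[OF g(1) this]
  have "g + u *s (f + (- inverse u) *s g) \<in> G" using g by simp
  moreover have "g + u *s (f + (- inverse u) *s g) = u *s f" using u by (simp add: vec_eq_iff field_simps)
  ultimately show ?thesis using assms by (simp add: elations_def)
qed

text \<open>
  In characteristic two a factor \<open>u \<noteq> 1\<close> exists: otherwise all \<open>d\<close> perspectivities are elations, a group of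
  exponent two, so that \<open>d\<close> is a power of two.
\<close>

lemma second_multiple:
  assumes "d = CHAR('a) ^ e * l" and "\<not> CHAR('a) dvd l" and "\<not> (CHAR('a) = 2 \<and> l = 1)"
  shows "\<exists>\<zeta>. \<zeta> \<noteq> 0 \<and> \<zeta> \<noteq> 1 \<and> (\<forall>f\<in>N. \<zeta> *s f \<in> N)"
proof (cases "CHAR('a) = 2")
  case False
  have "(2 :: 'a) = of_nat 2" by simp
  then have "(2 :: 'a) \<noteq> 0"
    using False CHAR_pos prime_CHAR_semidom[OF CHAR_pos] primes_dvd_imp_eq[OF _ two_is_prime_nat]
    by (metis of_nat_eq_0_iff_char_dvd)
  moreover have "(2 :: 'a) \<noteq> 1" by (metis one_add_one add_cancel_right_right one_neq_zero)
  moreover have "2 *s f \<in> N" if "f \<in> N" for f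
  proof -
    have "2 *s f = f + f" by (simp add: vec_eq_iff)
    then show ?thesis using N_add[OF that that] by simp
  qed
  ultimately show ?thesis by blast
next
  case True
  have "\<exists>u\<in>U. u \<noteq> 1"
  proof (rule ccontr)
    assume "\<not> ?thesis"
    then have "U = {1}" using U_props by blast
    then have cN: "card N = d" using card_product by simp
    have "(2 :: 'a) = 0" using True of_nat_CHAR[where ?'a = 'a] by simp
    then have "f + f = 0" for f :: "'a ^ 3" by (simp add: vec_eq_iff flip: mult_2)
    then obtain k where "card N = 2 ^ k" using card_power_of_2[of N] finite_N zero_N N_add by blast
    then have "l dvd 2 ^ k" using cN assms(1) by (metis dvd_triv_right)
    then obtain j where "l = 2 ^ j" using divides_primepow_nat[OF two_is_prime_nat] by blast
    then show False using assms(2,3) True by (cases j) auto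
  qed
  then show ?thesis using N_scale U_props by metis
qed

text \<open>
  The values \<open>f(v)\<close> are roots of \<open>F(v + t p) - F(v)\<close> by invariance. If they are distinct, then they are all the roots,
  and the linear coefficient in \<open>t\<close> is as claimed. Distinctness fails for \<open>v\<close> in a finite
  union of planes only, so every \<open>v\<close> is reached along a line in a generic direction \<open>w\<close>.
\<close>

lemma polar_product:
  "eval3 (Dir p F) v = eval3 F p * (\<Prod>f\<in>G - {0}. - dotp f v)"
proof -
  have generic: "eval3 (Dir p F) v = eval3 F p * (\<Prod>f\<in>G - {0}. - dotp f v)"
    if inj: "inj_on (\<lambda>f. dotp f v) G" for v
  proof -
    define Q where "Q = smult (eval3 F p) (\<Prod>f\<in>G. [:- dotp f v, 1:])"
    have deg: "degree (\<Prod>f\<in>G. [:- dotp f v, 1:]) = d"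
      by (subst degree_prod_eq_sum_degree) (auto simp: card_G)
    have "line F v p - [:eval3 F v:] = Q"
    proof (rule poly_eqI_degree_lead_coeff[of _ d _ "(\<lambda>f. dotp f v) ` G"])
      have "lead_coeff (\<Prod>f\<in>G. [:- dotp f v, 1:]) = 1" by (simp add: lead_coeff_prod)
      then show "coeff (line F v p - [:eval3 F v:]) d = coeff Q d"
        using degree_coeff_line[OF form_F, of v p] d_pos deg
        by (auto simp: Q_def coeff_pCons split: nat.splits)
      show "d \<le> card ((\<lambda>f. dotp f v) ` G)" using inj card_G by (simp add: card_image)
      show "degree (line F v p - [:eval3 F v:]) \<le> d"
        using degree_coeff_line[OF form_F, of v p] by (intro degree_diff_le) auto
      show "degree Q \<le> d" using deg by (simp add: Q_def)
      fix z assume "z \<in> (\<lambda>f. dotp f v) ` G"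
      then obtain f where f: "f \<in> G" "z = dotp f v" by auto
      have "poly Q z = 0" using f finite_G by (auto simp: Q_def poly_prod)
      then show "poly (line F v p - [:eval3 F v:]) z = poly Q z"
        using invariant[OF f(1)] f by simp
    qed
    then have "pderiv (line F v p - [:eval3 F v:]) = pderiv Q" by (simp only:)
    then have "line (Dir p F) v p = pderiv Q" by (simp add: pderiv_diff pderiv_line pderiv_pCons)
    then have "poly (line (Dir p F) v p) 0 = poly (pderiv Q) 0" by (simp only:)
    then have "eval3 (Dir p F) v = poly (pderiv Q) 0" by simp
    also have "Q = smult (eval3 F p) ([:0, 1:] * (\<Prod>f\<in>G - {0}. [:- dotp f v, 1:]))"
      unfolding Q_def using finite_G perspectivities_0[of F p] by (subst prod.remove[of G 0]) auto
    also have "poly (pderiv \<dots>) 0 = eval3 F p * (\<Prod>f\<in>G - {0}. - dotp f v)"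
      by (simp add: pderiv_smult pderiv_mult pderiv_pCons poly_prod)
    finally show ?thesis .
  qed
  define S where "S = (\<lambda>(f, g). f - g) ` (G \<times> G) - {0}"
  have "finite S" unfolding S_def by (intro finite_Diff finite_imageI finite_cartesian_product finite_G)
  moreover have "0 \<notin> S" by (simp add: S_def)
  ultimately obtain w where w: "\<And>f. f \<in> S \<Longrightarrow> dotp f w \<noteq> 0" using exists_generic_vector by metis
  define B where "B = (\<lambda>f. - dotp f v / dotp f w) ` S"
  define R where "R = smult (eval3 F p) (\<Prod>f\<in>G - {0}. [:- dotp f v, - dotp f w:])"
  have "line (Dir p F) v w = R"
  proof (rule poly_eqI_cofinite)
    show "finite B" using \<open>finite S\<close> by (simp add: B_def)
    fix t assume t: "t \<notin> B"
    have "inj_on (\<lambda>f. dotp f (v + t *s w)) G"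
    proof (rule inj_onI, rule ccontr)
      fix f g assume fg: "f \<in> G" "g \<in> G" "dotp f (v + t *s w) = dotp g (v + t *s w)" "f \<noteq> g"
      then have S: "f - g \<in> S" unfolding S_def by (intro DiffI image_eqI[of _ _ "(f, g)"]) auto
      have "dotp (f - g) v + t * dotp (f - g) w = 0" using fg(3) by (simp add: algebra_simps)
      then have "t * dotp (f - g) w = - dotp (f - g) v" by (simp only: eq_neg_iff_add_eq_0 add.commute)
      then have "t = - dotp (f - g) v / dotp (f - g) w"
        using w[OF S] by (simp only: nonzero_eq_divide_eq not_False_eq_True)
      then have "t \<in> B" unfolding B_def by (rule image_eqI) (rule S)
      then show False using t by blast
    qed
    from generic[OF this] show "poly (line (Dir p F) v w) t = poly R t"
      by (simp add: R_def poly_prod algebra_simps)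
  qed
  then have "poly (line (Dir p F) v w) 0 = poly R 0" by simp
  then show ?thesis by (simp add: R_def poly_prod)
qed

end

end

section \<open>Two centres on a smooth curve\<close>

lemma smooth_gradient:
  assumes "smooth_plane_curve d F" and "v \<noteq> 0" and "eval3 F v = 0"
  shows "\<exists>w. eval3 (Dir w F) v \<noteq> 0"
proof -
  have "eval3 (dX F) v \<noteq> 0 \<or> eval3 (dY F) v \<noteq> 0 \<or> eval3 (dZ F) v \<noteq> 0"
    using assms by (auto simp: smooth_plane_curve_def)
  then show ?thesis
    using eval3_Dir[of "vector [1, 0, 0]" F v] eval3_Dir[of "vector [0, 1, 0]" F v]
      eval3_Dir[of "vector [0, 0, 1]" F v] by (auto intro: exI[of _ "vector [1, 0, 0]"]
        exI[of _ "vector [0, 1, 0]"] exI[of _ "vector [0, 0, 1]"])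
qed

locale wild_centre = galois_centre F p d for F :: "'a::alg_closed_field poly3" and p d +
  fixes e l :: nat
  assumes CHAR_pos: "CHAR('a) > 0" and CHAR_dvd: "CHAR('a) dvd d"
    and d_eq: "d = CHAR('a) ^ e * l" and l: "\<not> CHAR('a) dvd l" "\<not> (CHAR('a) = 2 \<and> l = 1)"
    and smooth: "smooth_plane_curve d F"
begin

lemma Euler: "eval3 (Dir v F) v = 0"
proof -
  have "of_nat d = (0 :: 'a)" using CHAR_dvd by (simp add: of_nat_eq_0_iff_char_dvd)
  then show ?thesis by (simp add: Euler_identity[OF form_F])
qed

lemma exists_elation: "\<exists>f\<in>N. f \<noteq> 0"
proof (rule ccontr)
  assume "\<not> ?thesis"
  then have "N = {0}" using zero_N by blast
  then have "CHAR('a) dvd 1" using CHAR_dvd_card_N[OF CHAR_pos CHAR_dvd] by simp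
  then show False using prime_CHAR_semidom[OF CHAR_pos] by simp
qed

text \<open>
  Both \<open>f\<close> and its multiple \<open>\<zeta> f\<close> are factors of the polar.
\<close>

lemma polar_double_axis:
  assumes "f \<in> N" and "f \<noteq> 0"
  shows "\<exists>E. poly_on_lines E \<and> (\<forall>v. eval3 (Dir p F) v = (dotp f v)\<^sup>2 * E v)"
proof -
  obtain \<zeta> where \<zeta>: "\<zeta> \<noteq> 0" "\<zeta> \<noteq> 1" "\<zeta> *s f \<in> N"
    using second_multiple[OF CHAR_pos d_eq l] assms(1) by blast
  have fG: "f \<in> G - {0}" using assms N_subset by blast
  obtain i where i: "f $ i \<noteq> 0" using assms(2) by (auto simp: vec_eq_iff)
  have "\<zeta> *s f \<noteq> 0" using i \<zeta>(1) by (auto simp: vec_eq_iff)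
  moreover have ne: "\<zeta> *s f \<noteq> f"
  proof
    assume "\<zeta> *s f = f"
    then have "\<zeta> * f $ i = f $ i" by (metis vector_smult_component)
    then show False using i \<zeta>(2) by simp
  qed
  ultimately have zG: "\<zeta> *s f \<in> G - {0} - {f}" using \<zeta>(3) N_subset by blast
  define E where "E v = (eval3 F p * \<zeta>) * (\<Prod>g\<in>G - {0} - {f} - {\<zeta> *s f}. dotp (- g) v)" for v
  have "poly_on_lines E" unfolding E_def
    by (intro poly_on_lines_mult poly_on_lines_const poly_on_lines_prod poly_on_lines_dotp)
  moreover have "eval3 (Dir p F) v = (dotp f v)\<^sup>2 * E v" for v
  proof -
    have "(\<Prod>g\<in>G - {0}. - dotp g v)
        = (- dotp f v) * ((- dotp (\<zeta> *s f) v) * (\<Prod>g\<in>G - {0} - {f} - {\<zeta> *s f}. - dotp g v))"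
      using fG zG finite_G by (simp add: prod.remove[of "G - {0}" f] prod.remove[of "G - {0} - {f}" "\<zeta> *s f"])
    then show ?thesis
      by (simp add: polar_product[OF CHAR_pos] E_def power2_eq_square algebra_simps)
  qed
  ultimately show ?thesis by blast
qed

end

text \<open>
  Let \<open>r\<close> be a vector with \<open>f(r) = 1\<close>. Along the lines in direction \<open>r\<close> Euler's identity writes \<open>f D\<^sub>r F\<close>
  as a multiple of \<open>f\<^sup>2\<close>, hence \<open>D\<^sub>r F\<close> vanishes on the plane \<open>f = 0\<close> as the two other derivatives do. But this plane
  contains a point of the curve.
\<close>

lemma no_common_double_axis:
  fixes F :: "'a::alg_closed_field poly3"
  assumes smooth: "smooth_plane_curve d F" and d: "d > 0" and Euler: "\<And>v. eval3 (Dir v F) v = 0"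
    and p: "eval3 F p \<noteq> 0" and ind: "indep2 p q"
    and f: "f \<noteq> 0" "dotp f p = 0" "dotp f q = 0"
    and A: "poly_on_lines A" "\<And>v. eval3 (Dir p F) v = (dotp f v)\<^sup>2 * A v"
    and B: "poly_on_lines B" "\<And>v. eval3 (Dir q F) v = (dotp f v)\<^sup>2 * B v"
  shows False
proof -
  obtain r0 where r0: "dotp f r0 \<noteq> 0" using dotp_nonzero[OF f(1)] by blast
  define r where "r = inverse (dotp f r0) *s r0"
  have r: "dotp f r = 1" using r0 by (simp add: r_def)
  have "form d F" using smooth by (simp add: smooth_plane_curve_def)
  then obtain z where z: "eval3 F (q + z *s p) = 0" using form_has_zero_on_line d p by blast
  define v where "v = q + z *s p"
  have v0: "v \<noteq> 0" unfolding v_def by (rule indep2_shift[OF indep2_sym[OF ind]])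
  have fv: "dotp f v = 0" by (simp add: v_def f)
  define g where "g u = eval3 (Dir r F) u + dotp f u * (B u + z * A u)" for u
  have "poly_on_lines g" unfolding g_def
    by (intro poly_on_lines_add poly_on_lines_mult poly_on_lines_eval3 poly_on_lines_dotp
        poly_on_lines_const A(1) B(1))
  moreover have "g (v + t *s r) = 0" if "t \<noteq> 0" for t
  proof -
    let ?u = "v + t *s r"
    have fu: "dotp f ?u = t" by (simp add: fv r)
    have "0 = eval3 (Dir (q + z *s p + t *s r) F) ?u" using Euler[of ?u] by (simp only: v_def)
    also have "\<dots> = t * g ?u"
      unfolding g_def fu by (simp add: A(2) B(2) fu power2_eq_square algebra_simps fv r)
    finally show ?thesis using that by simp
  qed
  ultimately have "g v = 0" by (rule poly_on_lines_limit)
  then have Dr: "eval3 (Dir r F) v = 0" by (simp add: g_def fv)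
  have "eval3 (Dir w F) v = 0" for w
  proof -
    obtain \<alpha> \<beta> \<gamma> where "w = \<alpha> *s p + \<beta> *s q + \<gamma> *s r"
      using basis_from_covector[OF ind f(2,3), of r w] r by auto
    then show ?thesis by (simp add: Dr A(2) B(2) fv)
  qed
  then show False using smooth_gradient[OF smooth v0] z by (simp add: v_def)
qed

lemma order_prod_linear:
  fixes a b :: "'b \<Rightarrow> 'a::idom"
  assumes "finite S" and "\<And>x. x \<in> S \<Longrightarrow> a x = 0 \<Longrightarrow> b x \<noteq> 0"
  shows "(\<Prod>x\<in>S. [:a x, b x:]) \<noteq> 0 \<and> Polynomial.order 0 (\<Prod>x\<in>S. [:a x, b x:]) = card {x \<in> S. a x = 0}"
  using assms
proof (induction S rule: finite_induct)
  case empty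
  then show ?case by simp
next
  case (insert x S)
  have nz: "[:a x, b x:] \<noteq> 0" using insert.prems[of x] by auto
  have o: "Polynomial.order 0 [:a x, b x:] = (if a x = 0 then 1 else 0)"
  proof (cases "a x = 0")
    case True
    then have "b x \<noteq> 0" using insert.prems[of x] by simp
    have "[:a x, b x:] = smult (b x) [:- 0, 1:]" using True by simp
    then have "Polynomial.order 0 [:a x, b x:] = Polynomial.order 0 (smult (b x) [:- 0, 1:])"
      by (simp only:)
    also have "\<dots> = Polynomial.order 0 [:- 0, 1 :: 'a:]" by (rule order_smult[OF \<open>b x \<noteq> 0\<close>])
    also have "\<dots> = 1" using order_power_n_n[of "0 :: 'a" 1] by simp
    finally show ?thesis using True by simp
  next
    case False
    then show ?thesis by (simp add: order_0I)
  qed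
  have "{y \<in> insert x S. a y = 0} = (if a x = 0 then insert x {y \<in> S. a y = 0} else {y \<in> S. a y = 0})"
    by auto
  then have c: "card {y \<in> insert x S. a y = 0} = Polynomial.order 0 [:a x, b x:] + card {y \<in> S. a y = 0}"
    using insert.hyps o by simp
  have IH: "(\<Prod>x\<in>S. [:a x, b x:]) \<noteq> 0"
    "Polynomial.order 0 (\<Prod>x\<in>S. [:a x, b x:]) = card {x \<in> S. a x = 0}"
    using insert.IH insert.prems by auto
  have ne: "[:a x, b x:] * (\<Prod>x\<in>S. [:a x, b x:]) \<noteq> 0" using nz IH(1) by (simp only: mult_eq_0_iff) simp
  show ?case
    unfolding prod.insert[OF insert.hyps] order_mult[OF ne] c IH(2) using ne by blast
qed

lemma degree_prod_linear:
  fixes a b :: "'b \<Rightarrow> 'a::idom"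
  assumes "finite S" and "(\<Prod>x\<in>S. [:a x, b x:]) \<noteq> 0"
  shows "degree (\<Prod>x\<in>S. [:a x, b x:]) = card {x \<in> S. b x \<noteq> 0}"
proof -
  have "degree (\<Prod>x\<in>S. [:a x, b x:]) = (\<Sum>x\<in>S. degree [:a x, b x:])"
    using assms by (subst degree_prod_eq_sum_degree) auto
  also have "\<dots> = (\<Sum>x\<in>S. if b x \<noteq> 0 then 1 else 0)" by (intro sum.cong) auto
  also have "\<dots> = card {x \<in> S. b x \<noteq> 0}" using assms(1) by (simp flip: sum.inter_filter)
  finally show ?thesis .
qed

lemma degree_pderiv_0:
  fixes P :: "'a::field poly"
  assumes "pderiv P = 0" and "P \<noteq> 0"
  shows "of_nat (degree P) = (0 :: 'a)"
proof (cases "degree P")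
  case (Suc n)
  have "coeff (pderiv P) n = of_nat (degree P) * lead_coeff P" by (simp add: coeff_pderiv Suc)
  then show ?thesis using assms by simp
qed simp

text \<open>
  The situation to be refuted: two different points of this kind.
\<close>

locale two_centres = P: wild_centre F p d e l + Q: wild_centre F q d e l
  for F :: "'a::alg_closed_field poly3" and p q d e l +
  assumes indep: "indep2 p q"
begin

text \<open>
  Suppose the axis of \<open>f\<close> passes through \<open>q\<close>, and let \<open>g\<close> be an elation with centre \<open>q\<close>. If \<open>g\<close> fixes
  \<open>p\<close>, then it has the same axis as \<open>f\<close>, which is a double line of the polar of \<open>q\<close>. Otherwise \<open>g\<close> moves \<open>p\<close> to
  \<open>p + g(p) q\<close> and preserves the axis of \<open>f\<close>; so the polar of the new point, too, has this axis as a double line, and with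
  it the polar of \<open>q\<close>, a linear combination of the two.
\<close>

lemma elation_moves_other_centre:
  assumes f: "f \<in> P.N" "f \<noteq> 0"
  shows "dotp f q \<noteq> 0"
proof
  assume fq: "dotp f q = 0"
  have fp: "dotp f p = 0" using f by (simp add: elations_def)
  obtain A where A: "poly_on_lines A" "\<And>v. eval3 (Dir p F) v = (dotp f v)\<^sup>2 * A v"
    using P.polar_double_axis[OF f] by blast
  obtain g where g: "g \<in> Q.N" "g \<noteq> 0" using Q.exists_elation by blast
  have gq: "dotp g q = 0" and gG: "g \<in> Q.G" using g by (auto simp: elations_def)
  have "\<exists>B. poly_on_lines B \<and> (\<forall>v. eval3 (Dir q F) v = (dotp f v)\<^sup>2 * B v)"
  proof (cases "dotp g p = 0")
    case True
    obtain r where r: "dotp f r \<noteq> 0" using dotp_nonzero[OF f(2)] by blast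
    define c where "c = dotp g r / dotp f r"
    have "g = c *s f"
    proof (rule dotp_eqI)
      fix w
      obtain \<alpha> \<beta> \<gamma> where w: "w = \<alpha> *s p + \<beta> *s q + \<gamma> *s r"
        using basis_from_covector[OF indep fp fq r] by blast
      show "dotp g w = dotp (c *s f) w" using r by (simp add: w True gq fp fq c_def)
    qed
    moreover obtain E where "poly_on_lines E" "\<And>v. eval3 (Dir q F) v = (dotp g v)\<^sup>2 * E v"
      using Q.polar_double_axis[OF g] by blast
    ultimately show ?thesis
      by (intro exI[of _ "\<lambda>v. c\<^sup>2 * E v"])
        (auto intro!: poly_on_lines_mult poly_on_lines_const simp: power_mult_distrib)
  next
    case False
    define B where "B v = inverse (dotp g p) * (A (v + dotp (- g) v *s q) - A v)" for v
    have "poly_on_lines B" unfolding B_def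
      by (intro poly_on_lines_mult poly_on_lines_const poly_on_lines_diff A(1)
          poly_on_lines_perspectivity)
    moreover have "eval3 (Dir q F) v = (dotp f v)\<^sup>2 * B v" for v
    proof -
      define u where "u = v + dotp (- g) v *s q"
      have gu: "dotp g u = dotp g v" and fu: "dotp f u = dotp f v" by (simp_all add: u_def gq fq)
      have vu: "v = u + dotp g u *s q" unfolding gu by (simp add: u_def vec_eq_iff)
      have "line F v (p + dotp g p *s q) = line F u p"
      proof (rule poly_eqI_all)
        fix t
        have "v + t *s (p + dotp g p *s q) = (u + t *s p) + dotp g (u + t *s p) *s q"
          by (subst vu) (simp add: vec_eq_iff algebra_simps)
        then show "poly (line F v (p + dotp g p *s q)) t = poly (line F u p) t"
          using Q.invariant[OF Q.CHAR_pos gG, of "u + t *s p"] by (simp only: poly_line)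
      qed
      then have "poly (pderiv (line F v (p + dotp g p *s q))) 0 = poly (pderiv (line F u p)) 0"
        by simp
      then have "eval3 (Dir p F) v + dotp g p * eval3 (Dir q F) v = eval3 (Dir p F) u"
        by (simp add: pderiv_line)
      then have "dotp g p * eval3 (Dir q F) v = (dotp f v)\<^sup>2 * (A u - A v)"
        unfolding A(2) fu by (simp add: algebra_simps)
      then show ?thesis using False unfolding B_def u_def[symmetric] by (simp add: field_simps)
    qed
    ultimately show ?thesis by blast
  qed
  then obtain B where B: "poly_on_lines B" "\<And>v. eval3 (Dir q F) v = (dotp f v)\<^sup>2 * B v" by blast
  show False
    by (rule no_common_double_axis[OF P.smooth P.d_pos P.Euler P.p_notin indep f(2) fp fq A B])
qed

end

sublocale two_centres \<subseteq> swap: two_centres F q p d e l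
  by unfold_locales (rule indep2_sym[OF indep])

context two_centres
begin

text \<open>
  On the points \<open>p + y q\<close> Euler's identity is \<open>y D\<^sub>q F = - D\<^sub>p F\<close>. Both sides are products of linear factors
  in \<open>y\<close>; the order of vanishing at \<open>y = 0\<close> counts on the right the nontrivial elations with centre \<open>p\<close>, and on the left
  one plus the perspectivities with centre \<open>q\<close> whose axis contains \<open>p\<close>.
\<close>

lemma card_homologies_through_other_centre:
  "card P.N = card {g \<in> Q.G - {0}. dotp g p = 0} + 2"
proof -
  let ?A = "\<Prod>f\<in>P.G - {0}. [:- dotp f p, - dotp f q:]"
  let ?B = "\<Prod>g\<in>Q.G - {0}. [:- dotp g p, - dotp g q:]"
  have "[:0, 1:] * smult (eval3 F q) ?B = - smult (eval3 F p) ?A"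
  proof (rule poly_eqI_all)
    fix y
    have "eval3 (Dir p F) (p + y *s q) = poly (smult (eval3 F p) ?A) y"
      by (simp add: P.polar_product[OF P.CHAR_pos] poly_prod)
    moreover have "eval3 (Dir q F) (p + y *s q) = poly (smult (eval3 F q) ?B) y"
      by (simp add: Q.polar_product[OF P.CHAR_pos] poly_prod)
    moreover have "eval3 (Dir p F) (p + y *s q) + y * eval3 (Dir q F) (p + y *s q) = 0"
      using P.Euler[of "p + y *s q"] by simp
    ultimately show "poly ([:0, 1:] * smult (eval3 F q) ?B) y = poly (- smult (eval3 F p) ?A) y"
      by (simp add: eq_neg_iff_add_eq_0 add.commute)
  qed
  then have eq: "smult (eval3 F q) ([:- 0, 1:] * ?B) = smult (- eval3 F p) ?A" by simp
  have A: "?A \<noteq> 0 \<and> Polynomial.order 0 ?A = card {f \<in> P.G - {0}. - dotp f p = 0}"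
  proof (rule order_prod_linear)
    show "finite (P.G - {0})" using P.finite_G by simp
    fix f assume "f \<in> P.G - {0}" "- dotp f p = 0"
    then show "- dotp f q \<noteq> 0" using elation_moves_other_centre[of f] by (auto simp: elations_def)
  qed
  have B: "?B \<noteq> 0 \<and> Polynomial.order 0 ?B = card {g \<in> Q.G - {0}. - dotp g p = 0}"
  proof (rule order_prod_linear)
    show "finite (Q.G - {0})" using Q.finite_G by simp
    fix g assume g: "g \<in> Q.G - {0}" "- dotp g p = 0"
    show "- dotp g q \<noteq> 0"
    proof
      assume "- dotp g q = 0"
      then have "g \<in> Q.N" using g by (simp add: elations_def)
      then show False using g swap.elation_moves_other_centre[of g] by auto
    qed
  qed
  have "Polynomial.order 0 ([:- 0, 1:] * ?B) = Polynomial.order 0 ?A"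
    using arg_cong[OF eq, of "Polynomial.order 0"] P.p_notin Q.p_notin by (simp only: order_smult neg_equal_0_iff_equal not_False_eq_True)
  moreover have "Polynomial.order 0 ([:- 0, 1:] * ?B) = Suc (Polynomial.order 0 ?B)"
    using B order_power_n_n[of "0 :: 'a" 1] by (subst order_mult) auto
  ultimately have 1: "card {f \<in> P.G - {0}. dotp f p = 0} = Suc (card {g \<in> Q.G - {0}. dotp g p = 0})"
    using A B by simp
  have "P.N = insert 0 {f \<in> P.G - {0}. dotp f p = 0}"
    using perspectivities_0[of F p] by (auto simp: elations_def)
  then have "card P.N = Suc (card {f \<in> P.G - {0}. dotp f p = 0})"
    using P.finite_G by (simp only:) (subst card_insert_disjoint, auto)
  then show ?thesis using 1 by simp
qed

text \<open>
  Here \<open>f\<close> is an elation with centre \<open>p\<close>, \<open>r\<close> and \<open>p\<close> span its axis, and \<open>h(t) = D\<^sub>q F(r + t p)\<close>. On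
  the axis \<open>D\<^sub>p F\<close> and, by Euler's identity, \<open>D\<^sub>r F\<close> vanish; as the axis meets the curve, \<open>h \<noteq> 0\<close>. The derivative
  \<open>D\<^sub>p D\<^sub>q F = D\<^sub>q D\<^sub>p F\<close> of \<open>h\<close> vanishes because \<open>D\<^sub>p F\<close> vanishes twice along the axis. So the characteristic divides the
  degree of \<open>h\<close>, which is the number of perspectivities with centre \<open>q\<close> whose axis avoids \<open>p\<close>.
\<close>

lemma no_two_galois_centres: False
proof -
  obtain f where f: "f \<in> P.N" "f \<noteq> 0" using P.exists_elation by blast
  have fp: "dotp f p = 0" using f by (simp add: elations_def)
  have fq: "dotp f q \<noteq> 0" by (rule elation_moves_other_centre[OF f])
  obtain A where A: "poly_on_lines A" "\<And>v. eval3 (Dir p F) v = (dotp f v)\<^sup>2 * A v"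
    using P.polar_double_axis[OF f] by blast
  obtain s where s: "\<And>\<alpha> \<beta>. s \<noteq> \<alpha> *s p + \<beta> *s q" using exists_third_vector[of p q] by blast
  \<comment> \<open>Shift s along q into the plane of the axis of f.\<close>
  define b where "b = dotp f s / dotp f q"
  define r where "r = s - b *s q"
  have fr: "dotp f r = 0" using fq by (simp add: r_def b_def)
  have ind: "indep2 r p"
    unfolding indep2_def
  proof (intro allI impI)
    fix \<alpha> \<beta> assume eq: "\<alpha> *s r + \<beta> *s p = 0"
    have \<alpha>: "\<alpha> = 0"
    proof (rule ccontr)
      assume a: "\<alpha> \<noteq> 0"
      have "s = (- inverse \<alpha> * \<beta>) *s p + b *s q"
      proof -
        have "inverse \<alpha> *s (\<alpha> *s r + \<beta> *s p) = 0" using eq by simp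
        then have "r + (inverse \<alpha> * \<beta>) *s p = 0"
          using a by (simp add: vec_eq_iff algebra_simps)
        then show ?thesis by (simp add: r_def vec_eq_iff algebra_simps)
      qed
      then show False using s by blast
    qed
    then have "\<beta> *s p = 0" using eq by simp
    then show "\<alpha> = 0 \<and> \<beta> = 0" using \<alpha> indep2_nonzero[OF indep] by simp
  qed
  obtain z where z: "eval3 F (r + z *s p) = 0"
    using form_has_zero_on_line[OF P.form_F P.d_pos P.p_notin] by blast
  define h where "h = line (Dir q F) r p"
  have h0: "h \<noteq> 0"
  proof
    assume "h = 0"
    let ?v = "r + z *s p"
    have fv: "dotp f ?v = 0" by (simp add: fr fp)
    have Dq: "eval3 (Dir q F) ?v = 0" using \<open>h = 0\<close> poly_line[of "Dir q F" r p z] by (simp add: h_def)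
    have Dp: "eval3 (Dir p F) ?v = 0" by (simp only: A(2) fv) simp
    have Dr: "eval3 (Dir r F) ?v = 0" using P.Euler[of ?v] Dp by simp
    have "eval3 (Dir w F) ?v = 0" for w
    proof -
      obtain \<alpha> \<beta> \<gamma> where "w = \<alpha> *s r + \<beta> *s p + \<gamma> *s q"
        using basis_from_covector[OF ind fr fp fq] by blast
      then show ?thesis by (simp add: Dr Dp Dq)
    qed
    then show False using smooth_gradient[OF P.smooth indep2_shift[OF ind]] z by blast
  qed
  have "pderiv h = 0"
  proof (rule poly_eqI_all)
    fix t
    let ?v = "r + t *s p"
    have fv: "dotp f ?v = 0" by (simp add: fr fp)
    obtain R where R: "\<And>y. A (?v + y *s q) = poly R y" using A(1) unfolding poly_on_lines_def by metis
    have "line (Dir p F) ?v q = smult ((dotp f q)\<^sup>2) ([:0, 1:] * ([:0, 1:] * R))"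
      by (rule poly_eqI_all)
        (simp only: poly_line A(2) R, simp add: fr fp power2_eq_square algebra_simps)
    then have "poly (pderiv (line (Dir p F) ?v q)) 0 = 0"
      by (simp only: pderiv_smult pderiv_mult) simp
    then have "eval3 (Dir q (Dir p F)) ?v = 0" by (simp add: pderiv_line)
    then show "poly (pderiv h) t = poly 0 t"
      by (simp add: h_def pderiv_line Dir_commute[of p q])
  qed
  then have "of_nat (degree h) = (0 :: 'a)" using h0 by (rule degree_pderiv_0)
  then have 1: "CHAR('a) dvd degree h" by (simp only: of_nat_eq_0_iff_char_dvd)
  have h: "h = smult (eval3 F q) (\<Prod>g\<in>Q.G - {0}. [:- dotp g r, - dotp g p:])"
    unfolding h_def
    by (rule poly_eqI_all) (simp add: Q.polar_product[OF P.CHAR_pos] poly_prod)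
  then have "degree h = card {g \<in> Q.G - {0}. - dotp g p \<noteq> 0}"
    using h0 Q.p_notin Q.finite_G by (simp add: degree_prod_linear)
  moreover have "card (Q.G - {0}) = card {g \<in> Q.G - {0}. dotp g p = 0} + card {g \<in> Q.G - {0}. - dotp g p \<noteq> 0}"
    using Q.finite_G by (subst card_Un_disjoint[symmetric]) (auto intro!: arg_cong[of _ _ card])
  moreover have "card Q.G = Suc (card (Q.G - {0}))"
    by (rule card.remove[OF Q.finite_G perspectivities_0])
  ultimately have "degree h + card P.N = d + 1"
    using Q.card_G card_homologies_through_other_centre by simp
  then have "CHAR('a) dvd d + 1" using 1 P.CHAR_dvd_card_N[OF P.CHAR_pos P.CHAR_dvd] by (metis dvd_add)
  then have "CHAR('a) dvd 1" using P.CHAR_dvd dvd_add_right_iff by blast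
  then show False using prime_CHAR_semidom[OF P.CHAR_pos] by simp
qed

end

section \<open>Polynomials in two variables\<close>

text \<open>
  An element of \<^typ>\<open>'a poly poly\<close> is a polynomial in \<open>z\<close> with coefficients in \<open>K[x]\<close>.
\<close>

definition eval2 :: "'a::comm_ring_1 poly poly \<Rightarrow> 'a \<Rightarrow> 'a \<Rightarrow> 'a" where
  "eval2 u a b = poly (poly u [:b:]) a"

lemma eval2_simps [simp]:
  "eval2 (u + v) a b = eval2 u a b + eval2 v a b" "eval2 (u - v) a b = eval2 u a b - eval2 v a b"
  "eval2 (u * v) a b = eval2 u a b * eval2 v a b" "eval2 (- u) a b = - eval2 u a b"
  "eval2 (u ^ n) a b = eval2 u a b ^ n" "eval2 0 a b = 0" "eval2 1 a b = 1"
  "eval2 [:q:] a b = poly q a" "eval2 (pCons q u) a b = poly q a + b * eval2 u a b"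
  "eval2 (smult q u) a b = poly q a * eval2 u a b"
  by (simp_all add: eval2_def)

lemma eval2_sum [simp]: "eval2 (sum g A) a b = (\<Sum>x\<in>A. eval2 (g x) a b)"
  by (induction A rule: infinite_finite_induct) auto

lemma eval2_prod [simp]: "eval2 (prod g A) a b = (\<Prod>x\<in>A. eval2 (g x) a b)"
  by (induction A rule: infinite_finite_induct) auto

lemma eval2_dvd: "f dvd u \<Longrightarrow> eval2 f a b = 0 \<Longrightarrow> eval2 u a b = 0"
  by (auto simp: dvd_def)

lemma eval2_pcompose: "eval2 (pcompose u w) a b = eval2 u a (eval2 w a b)"
  by (induction u) (auto simp: pcompose_pCons)

definition at_x :: "'a::comm_ring_1 \<Rightarrow> 'a poly poly \<Rightarrow> 'a poly" where
  "at_x a = map_poly (\<lambda>c. poly c a)"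

definition lift_z :: "'a::comm_ring_1 poly \<Rightarrow> 'a poly poly" where
  "lift_z = map_poly (\<lambda>c. [:c:])"

lemma ring_map_at_x: "ring_map (at_x a)" and ring_map_lift_z: "ring_map (lift_z :: 'a::field poly \<Rightarrow> _)"
  unfolding at_x_def lift_z_def
  by (intro ring_map_map_poly ring_map_poly ring_map_const_poly)+

lemmas at_x_simps [simp] = ring_mapD[OF ring_map_at_x] ring_map_power[OF ring_map_at_x]
lemmas lift_z_simps [simp] = ring_mapD[OF ring_map_lift_z] ring_map_power[OF ring_map_lift_z]

lemma at_x_pCons [simp]: "at_x a (pCons c u) = pCons (poly c a) (at_x a u)"
  by (simp add: at_x_def map_poly_pCons)

lemma lift_z_pCons [simp]: "lift_z (pCons c u) = pCons [:c:] (lift_z u)"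
  by (simp add: lift_z_def map_poly_pCons)

lemma at_x_lift_z [simp]: "at_x a (lift_z (g :: 'a::field poly)) = g"
  by (induction g) (simp_all add: ring_mapD[OF ring_map_at_x] ring_mapD[OF ring_map_lift_z])

lemma poly_at_x: "poly (at_x a u) b = eval2 u a b"
  by (induction u) simp_all

lemma eval2_lift_z [simp]: "eval2 (lift_z (g :: 'a::field poly)) a b = poly g b"
  by (simp flip: poly_at_x)

definition x_minus :: "'a::field \<Rightarrow> 'a poly poly" where "x_minus a = [:[:- a, 1:]:]"

lemma eval2_x_minus [simp]: "eval2 (x_minus a) a b = 0" and at_x_x_minus [simp]: "at_x a (x_minus a) = 0"
  by (simp_all add: x_minus_def)

lemma at_x_0_iff: "at_x a u = 0 \<longleftrightarrow> x_minus a dvd (u :: 'a::field poly poly)"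
proof -
  have "at_x a u = 0 \<longleftrightarrow> (\<forall>n. poly (coeff u n) a = 0)"
    by (simp add: at_x_def poly_eq_iff coeff_map_poly)
  then show ?thesis by (simp add: x_minus_def const_poly_dvd_iff poly_eq_0_iff_dvd)
qed

lemma coeff_at_x: "coeff (at_x a u) n = poly (coeff u n) a"
  by (simp add: at_x_def coeff_map_poly)

lemma degree_at_x:
  assumes "lead_coeff f = [:\<kappa>:]" and "\<kappa> \<noteq> 0"
  shows "degree (at_x a f) = degree f"
proof (rule antisym)
  show "degree (at_x a f) \<le> degree f" by (intro degree_le) (simp add: coeff_at_x coeff_eq_0)
  show "degree f \<le> degree (at_x a f)" using assms by (intro le_degree) (simp add: coeff_at_x)
qed

lemma eval2_root_exists:
  fixes f :: "'a::alg_closed_field poly poly"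
  assumes "lead_coeff f = [:\<kappa>:]" and "\<kappa> \<noteq> 0" and "degree f > 0"
  shows "\<exists>b. eval2 f a b = 0"
  using alg_closed_imp_poly_has_root[of "at_x a f"] degree_at_x[OF assms(1,2)] assms(3)
  by (simp add: poly_at_x)

section \<open>Total degree and division\<close>

definition total_degree_le :: "nat \<Rightarrow> 'a::comm_ring_1 poly poly \<Rightarrow> bool" where
  "total_degree_le n u \<longleftrightarrow> (\<forall>k i. coeff (coeff u k) i \<noteq> 0 \<longrightarrow> i + k \<le> n)"

lemma total_degree_le_add: "total_degree_le n u \<Longrightarrow> total_degree_le n v \<Longrightarrow> total_degree_le n (u + v)"
  unfolding total_degree_le_def coeff_add by (metis add.right_neutral)

lemma total_degree_le_uminus: "total_degree_le n u \<Longrightarrow> total_degree_le n (- u)"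
  by (simp add: total_degree_le_def)

lemma total_degree_le_diff: "total_degree_le n u \<Longrightarrow> total_degree_le n v \<Longrightarrow> total_degree_le n (u - v)"
  using total_degree_le_add[OF _ total_degree_le_uminus, of n u v] by simp

lemma total_degree_le_mult:
  assumes "total_degree_le m u" and "total_degree_le n v"
  shows "total_degree_le (m + n) (u * v)"
  unfolding total_degree_le_def
proof (intro allI impI)
  fix k i
  assume "coeff (coeff (u * v) k) i \<noteq> 0"
  then have "(\<Sum>k'\<le>k. \<Sum>i'\<le>i. coeff (coeff u k') i' * coeff (coeff v (k - k')) (i - i')) \<noteq> 0"
    by (simp add: coeff_mult coeff_sum)
  then obtain k' where k: "k' \<le> k"
    and "(\<Sum>i'\<le>i. coeff (coeff u k') i' * coeff (coeff v (k - k')) (i - i')) \<noteq> 0"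
    by (metis (no_types, lifting) sum.neutral atMost_iff)
  then obtain i' where i: "i' \<le> i" and "coeff (coeff u k') i' * coeff (coeff v (k - k')) (i - i') \<noteq> 0"
    by (metis (no_types, lifting) sum.neutral atMost_iff)
  then have "i' + k' \<le> m" and "(i - i') + (k - k') \<le> n"
    using assms unfolding total_degree_le_def by (metis mult_zero_left, metis mult_zero_right)
  then show "i + k \<le> m + n" using i k by linarith
qed

lemma total_degree_le_mono: "total_degree_le m u \<Longrightarrow> m \<le> n \<Longrightarrow> total_degree_le n u"
  by (force simp: total_degree_le_def)

lemma total_degree_le_pCons:
  "total_degree_le (Suc n) (pCons c u) \<longleftrightarrow> degree c \<le> Suc n \<and> total_degree_le n u"
proof -
  have "degree c \<le> Suc n \<longleftrightarrow> (\<forall>i. coeff c i \<noteq> 0 \<longrightarrow> i \<le> Suc n)"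
    using le_degree degree_le by (metis order.trans not_less)
  then show ?thesis
    unfolding total_degree_le_def by (auto simp: coeff_pCons split: nat.splits)
qed

lemma total_degree_le_const: "degree c \<le> n \<Longrightarrow> total_degree_le n [:c:]"
  using le_degree[of c] by (auto simp: total_degree_le_def coeff_pCons split: nat.splits intro: order.trans)

lemma total_degree_le_0 [simp]: "total_degree_le n 0"
  by (simp add: total_degree_le_def)

lemma total_degree_exists: "\<exists>n. total_degree_le n u"
proof (induction u)
  case 0
  then show ?case by auto
next
  case (pCons c u)
  then obtain n where "total_degree_le n u" by blast
  then have "total_degree_le (Suc (max n (degree c))) (pCons c u)"
    using total_degree_le_mono[of n u "max n (degree c)"]
    by (simp add: total_degree_le_pCons le_SucI)
  then show ?case by blast
qed

lemma degree_if_total_degree_le: "total_degree_le n u \<Longrightarrow> degree u \<le> n"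
proof (intro degree_le allI impI, rule ccontr)
  fix i assume u: "total_degree_le n u" and i: "n < i" "coeff u i \<noteq> 0"
  then have "lead_coeff (coeff u i) \<noteq> 0" by simp
  then have "degree (coeff u i) + i \<le> n" using u unfolding total_degree_le_def by blast
  then show False using i by simp
qed

text \<open>
  The leading coefficient of \<open>f\<close> is a constant, so division in \<open>K[x][z]\<close> needs no denominators, and since
  it replaces \<open>z\<^sup>d\<close> by terms of total degree at most \<open>d\<close>, it does not raise the total degree.
\<close>

lemma division_with_total_degree:
  fixes f u :: "'a::field poly poly"
  assumes f: "lead_coeff f = [:\<kappa>:]" "\<kappa> \<noteq> 0" "degree f = d" "d > 0" "total_degree_le d f"
    and u: "total_degree_le n u"
  shows "\<exists>w v. u = f * w + v \<and> degree v < d \<and> total_degree_le n v \<and>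
           (w = 0 \<or> d \<le> n \<and> total_degree_le (n - d) w)"
  using u
proof (induction "degree u" arbitrary: u rule: less_induct)
  case less
  show ?case
  proof (cases "degree u < d")
    case True
    then show ?thesis using less.prems by (intro exI[of _ 0] exI[of _ u]) simp
  next
    case False
    define k where "k = degree u"
    have k: "k \<ge> d" "k > 0" using False f by (auto simp: k_def)
    then have u0: "lead_coeff u \<noteq> 0" by (auto simp: k_def)
    then have "degree (lead_coeff u) + k \<le> n"
      using less.prems unfolding total_degree_le_def k_def by (metis leading_coeff_0_iff)
    define m where "m = monom (smult (inverse \<kappa>) (lead_coeff u)) (k - d)"
    have "total_degree_le (n - d) m"
      unfolding total_degree_le_def m_def
    proof (intro allI impI)
      fix k' i assume "coeff (coeff (monom (smult (inverse \<kappa>) (lead_coeff u)) (k - d)) k') i \<noteq> 0"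
      then have "k' = k - d" "i \<le> degree (lead_coeff u)"
        using le_degree by (auto split: if_splits)
      then show "i + k' \<le> n - d" using \<open>degree (lead_coeff u) + k \<le> n\<close> k by linarith
    qed
    then have tm: "total_degree_le (n - d) m" .
    then have "total_degree_le (d + (n - d)) (f * m)" by (rule total_degree_le_mult[OF f(5)])
    moreover have "d + (n - d) = n" using \<open>degree (lead_coeff u) + k \<le> n\<close> k by linarith
    ultimately have td: "total_degree_le n (u - f * m)" using less.prems total_degree_le_diff by metis
    have m0: "m \<noteq> 0" using u0 f by (simp add: m_def)
    have dm: "degree m = k - d" using u0 f by (simp add: m_def degree_monom_eq)
    have lm: "lead_coeff m = smult (inverse \<kappa>) (lead_coeff u)" unfolding dm by (simp add: m_def)
    have "f \<noteq> 0" using f by auto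
    then have dfm: "degree (f * m) = k" using m0 k f dm by (simp add: degree_mult_eq)
    have "lead_coeff (f * m) = lead_coeff u"
      unfolding lead_coeff_mult lm f(1) using f(2) by simp
    then have "degree (u - f * m) < k"
      using dfm k by (intro degree_lessI) (auto simp: k_def coeff_eq_0 le_less)
    then obtain w v where *: "u - f * m = f * w + v" "degree v < d" "total_degree_le n v"
      "w = 0 \<or> d \<le> n \<and> total_degree_le (n - d) w"
      using less.hyps[of "u - f * m"] td k_def by blast
    have "u = f * (w + m) + v" using *(1) by (simp add: algebra_simps)
    moreover have "total_degree_le (n - d) (w + m)" using *(4) tm by (auto intro: total_degree_le_add)
    moreover have "d \<le> n" using \<open>degree (lead_coeff u) + k \<le> n\<close> k by linarith
    ultimately show ?thesis using *(2,3) by blast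
  qed
qed

lemma total_degree_divide_x_power:
  assumes "total_degree_le (j + n) ([:[:0, 1:] ^ j:] * u)"
  shows "total_degree_le n (u :: 'a::field poly poly)"
proof -
  have "[:0, 1 :: 'a:] ^ j = monom 1 j" by (induction j) (auto simp: monom_Suc monom_0 one_pCons)
  then have eq: "coeff (coeff ([:[:0, 1:] ^ j:] * u) k) (i + j) = coeff (coeff u k) i" for k i
    by (simp add: coeff_monom_mult)
  show ?thesis
    unfolding total_degree_le_def
  proof (intro allI impI)
    fix k i assume "coeff (coeff u k) i \<noteq> 0"
    then have "coeff (coeff ([:[:0, 1:] ^ j:] * u) k) (i + j) \<noteq> 0" by (simp only: eq not_False_eq_True)
    then have "i + j + k \<le> j + n"
      using assms unfolding total_degree_le_def by blast
    then show "i + k \<le> n" by simp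
  qed
qed

lemma quotient_total_degree:
  fixes f u :: "'a::field poly poly"
  assumes f: "lead_coeff f = [:\<kappa>:]" "\<kappa> \<noteq> 0" "degree f = d" "d > 0" "total_degree_le d f"
    and u: "total_degree_le n u" "f dvd u"
  shows "\<exists>w. u = f * w \<and> (w = 0 \<or> d \<le> n \<and> total_degree_le (n - d) w)"
proof -
  obtain w v where *: "u = f * w + v" "degree v < d" "w = 0 \<or> d \<le> n \<and> total_degree_le (n - d) w"
    using division_with_total_degree[OF f u(1)] by blast
  have "f dvd v" using u(2) unfolding *(1) by (metis dvd_add_right_iff dvd_triv_left)
  then have "v = 0" using *(2) f(3) dvd_imp_degree_le[of f v] by auto
  then show ?thesis using * by auto
qed

section \<open>Factorization in two variables\<close>

text \<open>
  Gauss's lemma: a linear factor \<open>x - a\<close> of \<open>c\<close> divides \<open>r\<close> or \<open>s\<close>, since \<open>K[x, z] / (x - a) = K[z]\<close> is a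
  domain. The factors of \<open>c\<close> are thus distributed between \<open>r\<close> and \<open>s\<close>.
\<close>

lemma gauss_split:
  fixes r s u :: "'a::alg_closed_field poly poly"
  assumes "c \<noteq> 0" and "r * s = [:c:] * u"
  shows "\<exists>c' r' s'. c' \<noteq> 0 \<and> r = [:c':] * r' \<and> u = r' * s'"
  using assms
proof (induction "degree c" arbitrary: c r s rule: less_induct)
  case less
  show ?case
  proof (cases "degree c = 0")
    case True
    then obtain k where k: "c = [:k:]" by (rule degree_eq_zeroE)
    then have k0: "k \<noteq> 0" using less.prems by auto
    have "[:[:inverse k:]:] * [:c:] = 1" using k k0 by (simp add: one_pCons)
    then have "u = [:[:inverse k:]:] * ([:c:] * u)" by (simp only: mult.assoc[symmetric] mult_1)
    also have "\<dots> = r * ([:[:inverse k:]:] * s)" unfolding less.prems(2)[symmetric] by (simp only: mult_ac)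
    finally have "u = r * ([:[:inverse k:]:] * s)" .
    moreover have "r = [:1:] * r" by simp
    ultimately show ?thesis using one_neq_zero by blast
  next
    case False
    then obtain a where "poly c a = 0" using alg_closed_imp_poly_has_root by blast
    then obtain c1 where c1: "c = [:- a, 1:] * c1" by (auto simp: poly_eq_0_iff_dvd dvd_def)
    have c1': "c1 \<noteq> 0" using less.prems c1 by auto
    then have deg: "degree c1 < degree c" unfolding c1 by (subst degree_mult_eq) auto
    have cX: "[:c:] = x_minus a * [:c1:]" by (simp add: c1 x_minus_def)
    have X0: "x_minus a \<noteq> 0" by (simp add: x_minus_def)
    have "at_x a (r * s) = 0" by (simp only: less.prems(2) cX at_x_simps) simp
    then have "x_minus a dvd r \<or> x_minus a dvd s" by (simp add: at_x_0_iff[symmetric])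
    then show ?thesis
    proof
      assume "x_minus a dvd r"
      then obtain r1 where r1: "r = x_minus a * r1" by (auto simp: dvd_def)
      have "x_minus a * (r1 * s) = x_minus a * ([:c1:] * u)" using less.prems(2) by (simp only: r1 cX mult.assoc)
      then have "r1 * s = [:c1:] * u" by (rule mult_left_cancel[OF X0, THEN iffD1])
      then obtain c' r' s' where *: "c' \<noteq> 0" "r1 = [:c':] * r'" "u = r' * s'"
        using less.hyps[OF deg c1'] by blast
      have "[:- a, 1:] * c' \<noteq> 0" using *(1) unfolding mult_eq_0_iff by simp
      moreover have "r = [:[:- a, 1:] * c':] * r'" by (simp add: r1 *(2) x_minus_def)
      ultimately show ?thesis using *(3) by blast
    next
      assume "x_minus a dvd s"
      then obtain s1 where s1: "s = x_minus a * s1" by (auto simp: dvd_def)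
      have "x_minus a * (r * s1) = x_minus a * ([:c1:] * u)" using less.prems(2) by (simp only: s1 cX mult_ac)
      then have "r * s1 = [:c1:] * u" by (rule mult_left_cancel[OF X0, THEN iffD1])
      then show ?thesis using less.hyps[OF deg c1'] by blast
    qed
  qed
qed

lemma lead_const_mult:
  fixes r s :: "'a::field poly poly"
  assumes "lead_coeff (r * s) = [:\<kappa>:]" and "\<kappa> \<noteq> 0"
  shows "\<exists>\<kappa>'. \<kappa>' \<noteq> 0 \<and> lead_coeff r = [:\<kappa>':]"
proof -
  have eq: "lead_coeff r * lead_coeff s = [:\<kappa>:]" using assms(1) by (simp only: lead_coeff_mult)
  then have ne: "lead_coeff r \<noteq> 0" "lead_coeff s \<noteq> 0" using assms(2) by (metis mult_zero_left mult_zero_right pCons_eq_0_iff)+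
  then have "degree (lead_coeff r) + degree (lead_coeff s) = 0"
    using eq degree_mult_eq[OF ne] by simp
  then have "degree (lead_coeff r) = 0" by simp
  then show ?thesis using ne(1) by (metis degree_eq_zeroE pCons_0_0)
qed

lemma gauss_cancel:
  fixes f u :: "'a::alg_closed_field poly poly"
  assumes "lead_coeff f = [:\<kappa>:]" and "\<kappa> \<noteq> 0" and "c \<noteq> 0" and "f dvd [:c:] * u"
  shows "f dvd u"
proof -
  obtain s where "[:c:] * u = f * s" using assms(4) unfolding dvd_def by blast
  from gauss_split[OF assms(3) this[symmetric]]
  obtain c' r' s' where *: "c' \<noteq> 0" "f = [:c':] * r'" "u = r' * s'" by blast
  obtain \<kappa>' where k: "\<kappa>' \<noteq> 0" "lead_coeff [:c':] = [:\<kappa>':]"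
    using lead_const_mult[of "[:c':]" r'] assms(1,2) *(2) by metis
  then have eq: "[:[:inverse \<kappa>':]:] * f = r'" by (simp add: *(2) flip: one_pCons)
  have "u = ([:[:inverse \<kappa>':]:] * f) * s'" unfolding eq by (rule *(3))
  then show ?thesis by (simp only:) (rule dvd_mult2[OF dvd_triv_right])
qed

text \<open>
  Take a nonzero element \<open>r\<close> of the ideal \<open>(f, u)\<close> of least degree in \<open>z\<close>. If this degree is positive, then pseudo-division shows that
  \<open>r\<close> divides \<open>f\<close> and \<open>u\<close> up to factors from \<open>K[x]\<close>, and Gauss's lemma turns it into a common factor.
\<close>

lemma bezout_or_common_factor:
  fixes f u :: "'a::alg_closed_field poly poly"
  assumes f: "lead_coeff f = [:\<kappa>:]" "\<kappa> \<noteq> 0"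
  shows "(\<exists>s t q. q \<noteq> 0 \<and> s * u + t * f = [:q:]) \<or>
         (\<exists>g \<kappa>'. \<kappa>' \<noteq> 0 \<and> lead_coeff g = [:\<kappa>':] \<and> degree g > 0 \<and> g dvd f \<and> g dvd u)"
proof -
  define I where "I = {r. r \<noteq> 0 \<and> (\<exists>s t. r = s * u + t * f)}"
  have "f \<noteq> 0" using f by auto
  moreover have "f = 0 * u + 1 * f" by simp
  ultimately have "f \<in> I" unfolding I_def by blast
  then obtain r where r: "r \<in> I" and min: "\<And>r'. r' \<in> I \<Longrightarrow> degree r \<le> degree r'"
    using ex_has_least_nat[of "\<lambda>r. r \<in> I" f degree] by blast
  obtain s t where st: "r = s * u + t * f" and r0: "r \<noteq> 0" using r by (auto simp: I_def)
  show ?thesis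
  proof (cases "degree r = 0")
    case True
    then obtain q where "r = [:q:]" using degree_eq_zeroE by blast
    then show ?thesis using st r0 by auto
  next
    case False
    have div: "\<exists>c. c \<noteq> 0 \<and> r dvd [:c:] * y" if y: "y = s' * u + t' * f" for y s' t'
    proof -
      obtain Q R where QR: "pseudo_divmod y r = (Q, R)" by fastforce
      define c where "c = lead_coeff r ^ (Suc (degree y) - degree r)"
      have c: "c \<noteq> 0" using r0 by (simp add: c_def)
      have eq: "[:c:] * y = r * Q + R" using pseudo_divmod(1)[OF r0 QR] by (simp add: c_def)
      have R: "R = 0 \<or> degree R < degree r" by (rule pseudo_divmod(2)[OF r0 QR])
      have "R = [:c:] * y - r * Q" unfolding eq by simp
      then have "R = ([:c:] * s' - s * Q) * u + ([:c:] * t' - t * Q) * f"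
        unfolding y st by (simp only: algebra_simps)
      then have "R = 0" using min[of R] R by (force simp: I_def)
      then show ?thesis using c eq by (auto intro!: exI[of _ c])
    qed
    obtain c where c: "c \<noteq> 0" "r dvd [:c:] * f" using div[of f 0 1] by auto
    then obtain s1 where "[:c:] * f = r * s1" unfolding dvd_def by blast
    from gauss_split[OF c(1) this[symmetric]] obtain c' r' s' where
      r': "c' \<noteq> 0" "r = [:c':] * r'" "f = r' * s'" by blast
    obtain \<kappa>' where k: "\<kappa>' \<noteq> 0" "lead_coeff r' = [:\<kappa>':]"
      using lead_const_mult[of r' s'] f r'(3) by metis
    obtain c2 where c2: "c2 \<noteq> 0" "r dvd [:c2:] * u" using div[of u 1 0] by auto
    have "r' dvd [:c2:] * u" using c2(2) r'(2) dvd_mult_right by blast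
    then have "r' dvd u" by (rule gauss_cancel[OF k(2,1) c2(1)])
    have "degree r' > 0" using False r' by simp
    moreover have "r' dvd f" unfolding r'(3) by (rule dvd_triv_left)
    ultimately show ?thesis using k \<open>r' dvd u\<close>
      by (intro disjI2 exI[of _ r'] exI[of _ \<kappa>'] conjI)
  qed
qed

lemma bezout_irreducible:
  fixes f u :: "'a::alg_closed_field poly poly"
  assumes f: "lead_coeff f = [:\<kappa>:]" "\<kappa> \<noteq> 0"
    and irr: "\<And>g h. f = g * h \<Longrightarrow> degree g = 0 \<or> degree h = 0"
    and "\<not> f dvd u"
  shows "\<exists>s t q. q \<noteq> 0 \<and> s * u + t * f = [:q:]"
proof (rule ccontr)
  assume "\<not> ?thesis"
  then obtain g where g: "degree g > 0" "g dvd f" "g dvd u"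
    using bezout_or_common_factor[OF f, of u] by blast
  then obtain h where h: "f = g * h" by (auto simp: dvd_def)
  then have "degree h = 0" using irr g by fastforce
  then obtain c where c: "h = [:c:]" using degree_eq_zeroE by blast
  obtain \<kappa>' where "\<kappa>' \<noteq> 0" "lead_coeff h = [:\<kappa>':]"
    using lead_const_mult[of h g] f h by (metis mult.commute)
  then have "g = f * [:[:inverse \<kappa>':]:]" using h c by (simp flip: one_pCons)
  then have "f dvd g" by (rule dvdI)
  then show False using g(3) assms(4) dvd_trans by blast
qed

lemma prime_if_no_factorization:
  fixes f :: "'a::alg_closed_field poly poly"
  assumes f: "lead_coeff f = [:\<kappa>:]" "\<kappa> \<noteq> 0" "degree f > 0"
    and irr: "\<And>g h. f = g * h \<Longrightarrow> degree g = 0 \<or> degree h = 0"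
  shows "prime_elem f"
proof (rule prime_elemI)
  show "f \<noteq> 0" using f by auto
  show "\<not> f dvd 1" using f(3) by (auto dest: dvd_imp_degree_le)
  fix u v assume uv: "f dvd u * v"
  show "f dvd u \<or> f dvd v"
  proof (rule disjCI)
    assume "\<not> f dvd v"
    then obtain s t q where q: "q \<noteq> 0" "s * v + t * f = [:q:]"
      using bezout_irreducible[OF f(1,2) irr] by blast
    have "[:q:] * u = s * (u * v) + t * u * f" unfolding q(2)[symmetric] by (simp only: algebra_simps)
    then have "f dvd [:q:] * u" using uv by simp
    then show "f dvd u" by (rule gauss_cancel[OF f(1,2) q(1)])
  qed
qed

section \<open>Integral closedness of a smooth affine curve\<close>

lemma cong_mult:
  fixes f :: "'b::comm_ring_1"
  assumes "f dvd u - u'" and "f dvd v - v'"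
  shows "f dvd u * v - u' * v'"
proof -
  have "u * v - u' * v' = (u - u') * v + u' * (v - v')" by (simp add: algebra_simps)
  then show ?thesis using assms by simp
qed

lemma cong_power: "f dvd u - u' \<Longrightarrow> f dvd u ^ n - u' ^ n" for f :: "'b::comm_ring_1"
  by (induction n) (auto intro: cong_mult)

lemma cong_sum:
  fixes f :: "'b::comm_ring_1"
  shows "(\<And>x. x \<in> A \<Longrightarrow> f dvd g x - h x) \<Longrightarrow> f dvd sum g A - sum h A"
  by (simp add: dvd_sum flip: sum_subtractf)

lemma cong_dvd: "f dvd u - u' \<Longrightarrow> f dvd u \<longleftrightarrow> f dvd u'" for f :: "'b::comm_ring_1"
  by (metis diff_add_cancel dvd_add_right_iff)

definition homog :: "'a::comm_ring_1 poly poly \<Rightarrow> 'a poly poly \<Rightarrow> 'a poly poly \<Rightarrow> 'a poly poly" where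
  "homog f v q = (\<Sum>k\<le>degree f. [:coeff f k:] * v ^ k * q ^ (degree f - k))"

text \<open>
  If \<open>f\<close> divides \<open>homog f v q\<close> and \<open>q \<in> K[x]\<close>, then \<open>v / q\<close> is a root of \<open>f(x, T)\<close> in the function field of
  the curve, hence integral over \<open>K[x]\<close>. This is the form in which integrality is used.
\<close>

lemma homog_scale: "homog f (c * v) (c * q) = c ^ degree f * homog f v q"
  unfolding homog_def sum_distrib_left
proof (intro sum.cong refl)
  fix k assume "k \<in> {..degree f}"
  then have "c ^ degree f = c ^ k * c ^ (degree f - k)" by (simp flip: power_add)
  then show "[:coeff f k:] * (c * v) ^ k * (c * q) ^ (degree f - k)
      = c ^ degree f * ([:coeff f k:] * v ^ k * q ^ (degree f - k))"
    by (simp only: power_mult_distrib mult_ac)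
qed

lemma homog_cong:
  assumes "g dvd v - v'" and "g dvd q - q'"
  shows "g dvd homog f v q - homog f v' q'"
  unfolding homog_def by (intro cong_sum cong_mult cong_power assms) simp

lemma eval2_homog_0:
  assumes "lead_coeff f = [:\<kappa>:]" and "eval2 q a b = 0"
  shows "eval2 (homog f v q) a b = \<kappa> * eval2 v a b ^ degree f"
proof -
  have "eval2 (homog f v q) a b
      = (\<Sum>k\<le>degree f. poly (coeff f k) a * eval2 v a b ^ k * 0 ^ (degree f - k))"
    by (simp add: homog_def assms(2) mult.assoc)
  also have "\<dots> = (\<Sum>k\<in>{degree f}. poly (coeff f k) a * eval2 v a b ^ k * 0 ^ (degree f - k))"
    by (intro sum.mono_neutral_right) (auto simp: power_0_left split: if_splits)
  finally show ?thesis using assms(1) by simp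
qed

text \<open>
  Smoothness in the form needed below: if \<open>b\<close> is a multiple root of \<open>f(a, z)\<close>, then \<open>\<partial>f/\<partial>x\<close>, whose
  value at \<open>(a, b)\<close> is that of \<open>s = (f - f(a, z)) / (x - a)\<close>, does not vanish there.
\<close>

definition affine_smooth :: "'a::field poly poly \<Rightarrow> bool" where
  "affine_smooth f \<longleftrightarrow> (\<forall>a b s. eval2 f a b = 0 \<and> poly (pderiv (at_x a f)) b = 0 \<and>
     f = lift_z (at_x a f) + x_minus a * s \<longrightarrow> eval2 s a b \<noteq> 0)"

text \<open>
  Over an algebraically closed field divisibility is decided by the multiplicities of the roots.
\<close>

lemma not_dvd_root_multiplicity:
  fixes g h :: "'a::alg_closed_field poly"
  assumes "g \<noteq> 0" and "\<not> g dvd h"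
  shows "\<exists>b k m g0 h0. g = [:- b, 1:] ^ m * g0 \<and> h = [:- b, 1:] ^ k * h0 \<and> k < m \<and> poly h0 b \<noteq> 0"
  using assms
proof (induction "degree g" arbitrary: g h rule: less_induct)
  case less
  show ?case
  proof (cases "degree g = 0")
    case True
    then have "is_unit g" using less.prems(1) is_unit_iff_degree by blast
    then show ?thesis using less.prems(2) by (simp add: unit_imp_dvd)
  next
    case False
    then obtain b where b: "poly g b = 0" using alg_closed_imp_poly_has_root by blast
    then obtain g1 where g1: "g = [:- b, 1:] * g1" by (auto simp: poly_eq_0_iff_dvd dvd_def)
    have g10: "g1 \<noteq> 0" using less.prems g1 by auto
    then have deg: "degree g1 < degree g" unfolding g1 by (subst degree_mult_eq) auto
    show ?thesis
    proof (cases "poly h b = 0")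
      case True
      then obtain h1 where h1: "h = [:- b, 1:] * h1" by (auto simp: poly_eq_0_iff_dvd dvd_def)
      have "\<not> g1 dvd h1" using less.prems(2) unfolding g1 h1 by (metis mult_dvd_mono dvd_refl)
      from less.hyps[OF deg g10 this] obtain c k m g0 h0 where
        *: "g1 = [:- c, 1:] ^ m * g0" "h1 = [:- c, 1:] ^ k * h0" "k < m" "poly h0 c \<noteq> 0" by blast
      show ?thesis
      proof (cases "c = b")
        case True
        then show ?thesis using *
          by (intro exI[of _ b] exI[of _ "Suc k"] exI[of _ "Suc m"] exI[of _ g0] exI[of _ h0])
            (simp only: g1 h1 power_Suc mult.assoc Suc_less_eq simp_thms)
      next
        case False
        then have "poly ([:- b, 1:] * h0) c \<noteq> 0" using *(4) by simp
        then show ?thesis using *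
          by (intro exI[of _ c] exI[of _ k] exI[of _ m] exI[of _ "[:- b, 1:] * g0"] exI[of _ "[:- b, 1:] * h0"])
            (simp only: g1 h1 mult_ac simp_thms)
      qed
    next
      case False
      then show ?thesis
        by (intro exI[of _ b] exI[of _ 0] exI[of _ 1] exI[of _ g1] exI[of _ h]) (simp add: g1)
    qed
  qed
qed

locale smooth_affine_curve =
  fixes f :: "'a::alg_closed_field poly poly" and \<kappa> :: 'a
  assumes lead_f: "lead_coeff f = [:\<kappa>:]" and kappa: "\<kappa> \<noteq> 0" and degree_f: "degree f \<ge> 2"
    and irreducible_f: "\<And>g h. f = g * h \<Longrightarrow> degree g = 0 \<or> degree h = 0"
    and smooth_f: "affine_smooth f"
begin

lemma prime_f: "prime_elem f"
  using prime_if_no_factorization[OF lead_f kappa _ irreducible_f] degree_f by simp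

lemma f_dvd_mult: "f dvd u * v \<longleftrightarrow> f dvd u \<or> f dvd v"
  by (rule prime_elem_dvd_mult_iff[OF prime_f])

lemma f_dvd_power: "f dvd u ^ n \<Longrightarrow> f dvd u"
  by (rule prime_elem_dvd_power[OF prime_f])

lemma f_dvd_prod: "f dvd (\<Prod>x\<in>A. g x) \<Longrightarrow> \<exists>x\<in>A. f dvd g x"
proof (induction A rule: infinite_finite_induct)
  case (insert x A)
  then show ?case by (auto simp: f_dvd_mult)
qed (use prime_f in \<open>auto simp: prime_elem_def\<close>)

lemma f_not_dvd_low_degree: "u \<noteq> 0 \<Longrightarrow> degree u < degree f \<Longrightarrow> \<not> f dvd u"
  using dvd_imp_degree_le[of f u] by linarith

text \<open>
  Suppose \<open>v / (x - a)\<close> is integral but not regular. Then at some root \<open>b\<close> of \<open>f(a, z)\<close>, of multiplicity \<open>m\<close>, the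
  polynomial \<open>v(a, z)\<close> has a smaller multiplicity \<open>k\<close>. By the equation of the curve
  \<open>(x - a) f\<^sub>1 = - (z - b)\<^sup>m g\<^sub>0\<close>, where \<open>f\<^sub>1(a, b) \<noteq> 0\<close> if \<open>m \<ge> 2\<close>, so \<open>z - b\<close> is a local parameter in which \<open>x - a\<close> has order \<open>m\<close> and
  \<open>v\<close> has order \<open>k < m\<close>. All terms of the integral equation but the leading one
  have higher order than the leading one, which is impossible. Multiplying by powers of \<open>f\<^sub>1\<close> and cancelling powers of \<open>z - b\<close> avoids passing to
  the local ring.
\<close>

lemma normal_step:
  assumes "f dvd homog f v (x_minus a * q)"
  shows "\<exists>v'. f dvd v - x_minus a * v'"
proof (cases "at_x a f dvd at_x a v")
  case True
  then obtain w where w: "at_x a v = at_x a f * w" by (auto simp: dvd_def)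
  then have "at_x a (v - f * lift_z w) = 0" by simp
  then obtain v' where "v - f * lift_z w = x_minus a * v'" unfolding at_x_0_iff dvd_def by blast
  then have "v - x_minus a * v' = f * lift_z w" by (simp add: algebra_simps)
  then show ?thesis by (intro exI[of _ v']) simp
next
  case False
  have "at_x a f \<noteq> 0" using degree_at_x[OF lead_f kappa, of a] degree_f by auto
  then obtain b k m g0 h0 where
    fa: "at_x a f = [:- b, 1:] ^ m * g0" and va: "at_x a v = [:- b, 1:] ^ k * h0"
    and km: "k < m" and h0: "poly h0 b \<noteq> 0"
    using not_dvd_root_multiplicity[OF _ False] by blast
  have f_ab: "eval2 f a b = 0" using km by (simp add: poly_at_x[symmetric] fa)
  show ?thesis
  \<comment> \<open>If k = 0, it suffices to evaluate the integral equation at (a, b); otherwise m is at least 2.\<close>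
  proof (cases "k = 0")
    case True
    have "eval2 (homog f v (x_minus a * q)) a b = \<kappa> * eval2 v a b ^ degree f"
      by (rule eval2_homog_0[OF lead_f]) simp
    then have "eval2 v a b = 0" using eval2_dvd[OF assms f_ab] kappa by simp
    then have "poly h0 b = 0" using True va by (simp add: poly_at_x[symmetric])
    then show ?thesis using h0 by simp
  next
    case False
    define Z where "Z = lift_z [:- b, 1:]"
    have "at_x a (f - lift_z (at_x a f)) = 0" "at_x a (v - lift_z (at_x a v)) = 0" by simp_all
    then obtain f1 s where "f - lift_z (at_x a f) = x_minus a * f1" and "v - lift_z (at_x a v) = x_minus a * s"
      unfolding at_x_0_iff dvd_def by blast
    then have f: "f = lift_z (at_x a f) + x_minus a * f1" and v: "v = lift_z (at_x a v) + x_minus a * s"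
      by (simp_all add: algebra_simps)
    define w where "w = lift_z h0 * f1 - Z ^ (m - k) * lift_z g0 * s"
    define y where "y = - (Z ^ (m - k) * lift_z g0 * q)"
    have Zm: "Z ^ m = Z ^ k * Z ^ (m - k)" using km by (simp flip: power_add)
    have Xf: "x_minus a * f1 = f - Z ^ m * lift_z g0"
      using f by (simp add: fa Z_def algebra_simps)
    have vv: "v = Z ^ k * lift_z h0 + x_minus a * s" using v by (simp add: va Z_def)
    have "f1 * v = Z ^ k * (lift_z h0 * f1) + (x_minus a * f1) * s" unfolding vv by (simp add: algebra_simps)
    also have "\<dots> = Z ^ k * w + f * s" unfolding Xf Zm w_def by (simp add: algebra_simps)
    finally have c1: "f dvd f1 * v - Z ^ k * w" by simp
    have "f1 * (x_minus a * q) = (x_minus a * f1) * q" by (simp add: algebra_simps)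
    also have "\<dots> = Z ^ k * y + f * q" unfolding Xf Zm y_def by (simp add: algebra_simps)
    finally have c2: "f dvd f1 * (x_minus a * q) - Z ^ k * y" by simp
    have "f dvd f1 ^ degree f * homog f v (x_minus a * q)" using assms by simp
    then have "f dvd homog f (f1 * v) (f1 * (x_minus a * q))" by (simp only: homog_scale)
    then have "f dvd homog f (Z ^ k * w) (Z ^ k * y)" using cong_dvd[OF homog_cong[OF c1 c2]] by blast
    then have "f dvd (Z ^ k) ^ degree f * homog f w y" by (simp only: homog_scale)
    moreover have "\<not> f dvd Z" using degree_f by (intro f_not_dvd_low_degree) (auto simp: Z_def one_pCons)
    ultimately have "f dvd homog f w y" using f_dvd_power f_dvd_mult by blast
    then have "eval2 (homog f w y) a b = 0" by (rule eval2_dvd[OF _ f_ab])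
    moreover have "eval2 Z a b = 0" by (simp add: Z_def)
    then have "eval2 y a b = 0" using km by (simp add: y_def)
    ultimately have "eval2 w a b = 0" using eval2_homog_0[OF lead_f] kappa by simp
    then have f1: "eval2 f1 a b = 0" using \<open>eval2 Z a b = 0\<close> km h0 by (simp add: w_def power_0_left)
    have "m = Suc (Suc (m - 2))" using km False by simp
    then have "at_x a f = [:- b, 1:] * ([:- b, 1:] * ([:- b, 1:] ^ (m - 2) * g0))"
      using fa by (metis power_Suc mult.assoc)
    then have "poly (pderiv (at_x a f)) b = 0" by (simp only: pderiv_mult) simp
    then show ?thesis using smooth_f f_ab f f1 unfolding affine_smooth_def by blast
  qed
qed

lemma normal:
  assumes "q \<noteq> 0" and "f dvd homog f v [:q:]"
  shows "\<exists>w. f dvd v - [:q:] * w"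
  using assms
proof (induction "degree q" arbitrary: q v rule: less_induct)
  case less
  show ?case
  proof (cases "degree q = 0")
    case True
    then obtain k where k: "q = [:k:]" by (rule degree_eq_zeroE)
    then have "k \<noteq> 0" using less.prems by auto
    then have "[:q:] * ([:[:inverse k:]:] * v) = v" using k by (simp flip: one_pCons)
    then show ?thesis by (metis diff_self dvd_0_right)
  next
    case False
    then obtain a where "poly q a = 0" using alg_closed_imp_poly_has_root by blast
    then obtain q1 where q1: "q = [:- a, 1:] * q1" by (auto simp: poly_eq_0_iff_dvd dvd_def)
    have q10: "q1 \<noteq> 0" using less.prems q1 by auto
    then have deg: "degree q1 < degree q" unfolding q1 by (subst degree_mult_eq) auto
    have qX: "[:q:] = x_minus a * [:q1:]" by (simp add: q1 x_minus_def)
    obtain v' where v': "f dvd v - x_minus a * v'" using normal_step less.prems(2) qX by metis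
    have "f dvd homog f v [:q:] - homog f (x_minus a * v') (x_minus a * [:q1:])"
      unfolding qX by (intro homog_cong v') simp
    then have "f dvd x_minus a ^ degree f * homog f v' [:q1:]"
      using cong_dvd less.prems(2) homog_scale by metis
    moreover have "\<not> f dvd x_minus a" using degree_f by (intro f_not_dvd_low_degree) (auto simp: x_minus_def)
    ultimately have "f dvd homog f v' [:q1:]" using f_dvd_power f_dvd_mult by blast
    then obtain w where w: "f dvd v' - [:q1:] * w" using less.hyps[OF deg q10] by blast
    have "v - [:q:] * w = (v - x_minus a * v') + x_minus a * (v' - [:q1:] * w)"
      unfolding qX by (simp add: algebra_simps)
    then show ?thesis using v' w by (metis dvd_add dvd_mult)
  qed
qed

text \<open>
  The differences of the elements of \<open>S\<close> are not divisible by \<open>f\<close>, so there is a point \<open>(a, b)\<close> of the curve at which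
  the elements of \<open>S\<close> take distinct values. These are roots of \<open>f(a, z)\<close>.
\<close>

lemma card_linear_roots:
  assumes "finite S" and lin: "\<And>w. w \<in> S \<Longrightarrow> degree w \<le> 1" and root: "\<And>w. w \<in> S \<Longrightarrow> f dvd pcompose f w"
  shows "card S \<le> degree f"
proof -
  define P where "P = (\<Prod>(w, w') \<in> S \<times> S - Id. w - w')"
  have "\<not> f dvd w - w'" if "w \<in> S" "w' \<in> S" "w \<noteq> w'" for w w'
  proof (rule f_not_dvd_low_degree)
    have "degree (w - w') \<le> 1" using lin that by (intro degree_diff_le) auto
    then show "degree (w - w') < degree f" using degree_f by simp
  qed (use that in simp)
  then have "\<not> f dvd P"
    unfolding P_def by (auto dest!: f_dvd_prod)
  then obtain s t q where q: "q \<noteq> 0" "s * P + t * f = [:q:]"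
    using bezout_irreducible[OF lead_f kappa irreducible_f] by blast
  then obtain a where a: "poly q a \<noteq> 0" using poly_eqI_all[of q 0] by auto
  obtain b where b: "eval2 f a b = 0" using eval2_root_exists[OF lead_f kappa] degree_f by fastforce
  have "eval2 (s * P + t * f) a b \<noteq> 0" unfolding q(2) using a by simp
  then have P: "eval2 P a b \<noteq> 0" using b by auto
  have "inj_on (\<lambda>w. eval2 w a b) S"
  proof (rule inj_onI, rule ccontr)
    fix w w' assume *: "w \<in> S" "w' \<in> S" "eval2 w a b = eval2 w' a b" "w \<noteq> w'"
    then have "\<exists>x\<in>S \<times> S - Id. eval2 (case x of (w, w') \<Rightarrow> w - w') a b = 0"
      by (intro bexI[of _ "(w, w')"]) auto
    then show False using P \<open>finite S\<close> by (simp add: P_def)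
  qed
  then have "card S = card ((\<lambda>w. eval2 w a b) ` S)" by (simp add: card_image)
  also have "\<dots> \<le> card {c. poly (at_x a f) c = 0}"
  proof (rule card_mono)
    have "at_x a f \<noteq> 0" using degree_at_x[OF lead_f kappa, of a] degree_f by auto
    then show "finite {c. poly (at_x a f) c = 0}" by (rule poly_roots_finite)
    show "(\<lambda>w. eval2 w a b) ` S \<subseteq> {c. poly (at_x a f) c = 0}"
      using eval2_dvd[OF root b] by (auto simp: poly_at_x eval2_pcompose)
  qed
  also have "\<dots> \<le> degree (at_x a f)"
    using degree_at_x[OF lead_f kappa, of a] degree_f by (intro card_poly_roots_bound) auto
  also have "\<dots> = degree f" by (rule degree_at_x[OF lead_f kappa])
  finally show ?thesis .
qed

end

section \<open>The affine chart adapted to a centre\<close>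

lemma eval2_eqI:
  fixes u v :: "'a::alg_closed_field poly poly"
  assumes "\<And>s t. eval2 u s t = eval2 v s t"
  shows "u = v"
proof -
  have "at_x s (u - v) = 0" for s
    by (rule poly_eqI_all) (simp only: poly_at_x, simp add: assms)
  then have "coeff (u - v) n = 0" for n
    using coeff_at_x[of _ "u - v" n] by (intro poly_eqI_all) (metis coeff_0 poly_0)
  then have "u - v = 0" by (intro poly_eqI) simp
  then show ?thesis by simp
qed

text \<open>
  A double component would consist of singular points.
\<close>

lemma affine_smooth_squarefree:
  fixes f k m :: "'a::alg_closed_field poly poly"
  assumes smooth: "affine_smooth f" and f: "f = k * k * m"
    and k: "lead_coeff k = [:\<kappa>:]" "\<kappa> \<noteq> 0" "degree k > 0"
  shows False
proof -
  obtain t where t: "eval2 k 0 t = 0" using eval2_root_exists[OF k] by blast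
  have "at_x 0 (k - lift_z (at_x 0 k)) = 0" "at_x 0 (m - lift_z (at_x 0 m)) = 0" by simp_all
  then obtain k1 m1 where k1: "k - lift_z (at_x 0 k) = x_minus 0 * k1" and m1: "m - lift_z (at_x 0 m) = x_minus 0 * m1"
    unfolding at_x_0_iff dvd_def by blast
  define k0 where "k0 = lift_z (at_x 0 k)"
  define m0 where "m0 = lift_z (at_x 0 m)"
  have ke: "k = k0 + x_minus 0 * k1" and me: "m0 = m - x_minus 0 * m1"
    using k1 m1 by (simp_all add: k0_def m0_def algebra_simps)
  have k0t: "eval2 k0 0 t = 0" using t by (simp add: k0_def poly_at_x)
  define s where "s = k0 * k0 * m1 + k0 * k1 * m + k1 * k * m"
  have "f = k0 * k0 * m0 + x_minus 0 * s"
    unfolding f s_def me ke by (simp add: algebra_simps)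
  moreover have "lift_z (at_x 0 f) = k0 * k0 * m0" by (simp add: f k0_def m0_def)
  ultimately have "f = lift_z (at_x 0 f) + x_minus 0 * s" by simp
  moreover have "eval2 f 0 t = 0" by (simp add: f t)
  moreover have "poly (pderiv (at_x 0 f)) t = 0" 
    by (simp add: f pderiv_mult poly_at_x t)
  moreover have "eval2 s 0 t = 0" by (simp add: s_def k0t t)
  ultimately show False using smooth unfolding affine_smooth_def by blast
qed

text \<open>
  A centre \<open>p\<close> off the curve, coordinates \<open>a, b, c\<close> on the space such that \<open>a\<close> and \<open>b\<close> vanish at \<open>p\<close>, and the dual basis
  \<open>r, q, p\<close>. The chart is the plane \<open>b = 1\<close> with the points \<open>x r + q + z p\<close>, and \<open>x = a / b\<close> is the coordinate of the
  projection. Exchanging \<open>a\<close> with \<open>b\<close> gives the second chart with the same centre.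
\<close>

locale chart =
  fixes F :: "'a::alg_closed_field poly3" and d :: nat and a b c p q r :: "'a ^ 3"
  assumes smooth: "smooth_plane_curve d F" and d2: "d \<ge> 2" and p_notin: "eval3 F p \<noteq> 0"
    and dual [simp]: "dotp a r = 1" "dotp a q = 0" "dotp a p = 0" "dotp b r = 0" "dotp b q = 1"
      "dotp b p = 0" "dotp c r = 0" "dotp c q = 0" "dotp c p = 1"
    and expand: "\<And>v. v = dotp a v *s r + dotp b v *s q + dotp c v *s p"
    and field_L: "field (function_field F)"
begin

lemma form_F: "form d F" and F_nonzero: "F \<noteq> 0"
  using smooth by (auto simp: smooth_plane_curve_def)

abbreviation "A \<equiv> linear_form a"
abbreviation "B \<equiv> linear_form b"
abbreviation "C \<equiv> linear_form c"

definition point :: "3 \<Rightarrow> 'a poly poly" where "point i = [:[:q $ i, r $ i:], [:p $ i:]:]"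

definition \<delta> :: "'a poly3 \<Rightarrow> 'a poly poly" where
  "\<delta> = subst3 (\<lambda>k. [:[:k:]:]) (point 1) (point 2) (point 3)"

lemma ring_map_const2: "ring_map (\<lambda>k. [:[:k:]:])"
  by (simp add: ring_map_def one_pCons)

lemma ring_map_\<delta>: "ring_map \<delta>"
  unfolding \<delta>_def by (intro ring_map_subst3 ring_map_const2)

lemmas \<delta>_simps [simp] = ring_mapD[OF ring_map_\<delta>] ring_map_power[OF ring_map_\<delta>]

lemma \<delta>_generators [simp]:
  "\<delta> (const3 k) = [:[:k:]:]" "\<delta> VarX = point 1" "\<delta> VarY = point 2" "\<delta> VarZ = point 3"
  by (simp_all add: \<delta>_def subst3_generators[OF ring_map_const2])

lemma \<delta>_linear_form: "\<delta> (linear_form u) = [:[:dotp u q, dotp u r:], [:dotp u p:]:]"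
  by (simp add: linear_form_def dotp_def point_def algebra_simps)

lemma \<delta>_ABC [simp]: "\<delta> A = [:[:0, 1:]:]" "\<delta> B = 1" "\<delta> C = [:0, 1:]"
  by (simp_all add: \<delta>_linear_form one_pCons)

lemma eval2_\<delta>: "eval2 (\<delta> E) s t = eval3 E (s *s r + q + t *s p)"
  by (induction E rule: poly3_induct) (auto simp: point_def algebra_simps)

text \<open>
  Dehomogenizing does not raise the degree, and the coefficient of \<open>z\<^sup>n\<close> is the value at the centre. So the equation of
  the curve becomes monic in \<open>z\<close> up to a constant.
\<close>

lemma \<delta>_form:
  assumes "form n E"
  shows "total_degree_le n (\<delta> E)" and "coeff (\<delta> E) n = [:eval3 E p:]"
proof -
  define Q where "Q n u x \<longleftrightarrow> total_degree_le n u \<and> coeff u n = [:x:]" for n u and x :: 'a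
  have Qmult: "Q (m + n) (u * v) (x * y)" if "Q m u x" "Q n v y" for m n u v x y
    using that unfolding Q_def
    by (auto simp: total_degree_le_mult coeff_mult_top degree_if_total_degree_le)
  have Qone: "Q 0 1 1" by (simp add: Q_def one_pCons total_degree_le_const)
  have Qpow: "Q n (u ^ n) (x ^ n)" if "Q 1 u x" for u x n
  proof (induction n)
    case (Suc n)
    then show ?case using Qmult[OF that Suc] by simp
  qed (simp add: Qone)
  have Qpoint: "Q 1 (point i) (p $ i)" for i
    using total_degree_le_pCons[of 0 "[:q $ i, r $ i:]" "[:[:p $ i:]:]"]
    by (simp add: Q_def point_def total_degree_le_const)
  have Qconst: "Q 0 [:[:k:]:] k" for k by (simp add: Q_def total_degree_le_const)
  have "Q n (\<delta> E) (eval3 E p)"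
    using assms
  proof (induction rule: form_induct)
    case zero
    then show ?case by (simp add: Q_def)
  next
    case (add u v)
    then show ?case by (simp add: Q_def total_degree_le_add)
  next
    case (monomial k i1 i2 i3)
    have "Q (0 + i1 + i2 + i3) ([:[:k:]:] * point 1 ^ i1 * point 2 ^ i2 * point 3 ^ i3)
       (k * (p $ 1) ^ i1 * (p $ 2) ^ i2 * (p $ 3) ^ i3)"
      by (intro Qmult Qpow Qpoint Qconst)
    then show ?case using monomial by simp
  qed
  then show "total_degree_le n (\<delta> E)" and "coeff (\<delta> E) n = [:eval3 E p:]" by (simp_all add: Q_def)
qed

lemma \<delta>_zero:
  assumes "form n E" and "\<delta> E = 0"
  shows "E = 0"
proof -
  have "eval3 (E * B) v = 0" for v
  proof (cases "dotp b v = 0")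
    case False
    let ?s = "dotp a v / dotp b v" and ?t = "dotp c v / dotp b v"
    have "v = dotp b v *s (?s *s r + q + ?t *s p)"
      using False by (subst (1) expand) (simp add: vec_eq_iff field_simps)
    then have "eval3 E v = dotp b v ^ n * eval3 E (?s *s r + q + ?t *s p)"
      using eval3_scale[OF assms(1)] by metis
    also have "\<dots> = 0" using eval2_\<delta>[of E ?s ?t] assms(2) by simp
    finally show ?thesis by simp
  qed simp
  then have "E * B = 0" by (rule poly3_eq_0_if_eval3)
  moreover have "B \<noteq> 0" using eval3_linear_form[of b q] by (metis dual(5) eval3_simps(5) one_neq_zero)
  ultimately show ?thesis by simp
qed

lemma \<delta>_inject: "form n E \<Longrightarrow> form n E' \<Longrightarrow> \<delta> E = \<delta> E' \<Longrightarrow> E = E'"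
  using \<delta>_zero[of n "E - E'"] by (simp add: form_diff)

lemma form_binary: "form n (binary_form n g A B)"
  unfolding binary_form_def
proof (intro form_sum)
  fix i assume "i \<in> {..n}"
  then have "0 + i + (n - i) = n" by simp
  moreover have "form (0 + i + (n - i)) (const3 (g i) * A ^ i * B ^ (n - i))"
    by (intro form_mult form_const3 form_power1 form_linear_form)
  ultimately show "form n (const3 (g i) * A ^ i * B ^ (n - i))" by simp
qed

lemma \<delta>_binary: "\<delta> (binary_form n g A B) = [:\<Sum>i\<le>n. monom (g i) i:]"
proof -
  have "[:0, 1 :: 'a:] ^ i = monom 1 i" for i by (induction i) (auto simp: monom_Suc monom_0 one_pCons)
  then have "[:[:0, 1 :: 'a:]:] ^ i = [:monom 1 i:]" for i
    by (metis poly_const_pow)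
  then have "\<delta> (binary_form n g A B) = (\<Sum>i\<le>n. [:monom (g i) i:])"
    by (simp add: binary_form_def ring_map_sum[OF ring_map_\<delta>] smult_monom)
  then show ?thesis by (simp only: sum_const_poly)
qed

lemma \<delta>_binary_coeff: "degree g \<le> n \<Longrightarrow> \<delta> (binary_form n (coeff g) A B) = [:g:]"
  by (simp only: \<delta>_binary poly_as_sum_of_monoms')

text \<open>
  Homogenization, built with Horner's scheme in \<open>z\<close>.
\<close>

lemma \<delta>_surj: "total_degree_le n u \<Longrightarrow> \<exists>W. form n W \<and> \<delta> W = u"
proof (induction u arbitrary: n)
  case 0
  then show ?case by (intro exI[of _ 0]) simp
next
  case (pCons g u)
  have g: "degree g \<le> n"
    using pCons.prems le_degree[of g] unfolding total_degree_le_def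
    by (intro degree_le) (metis add_0_right coeff_pCons_0 not_less)
  show ?case
  proof (cases n)
    case 0
    have "degree (pCons g u) = 0" using degree_if_total_degree_le[OF pCons.prems] 0 by simp
    then have "u = 0" by (simp split: if_splits)
    then show ?thesis
      using g by (intro exI[of _ "binary_form n (coeff g) A B"]) (simp add: form_binary \<delta>_binary_coeff)
  next
    case (Suc m)
    then obtain W where W: "form m W" "\<delta> W = u"
      using pCons by (auto simp: total_degree_le_pCons)
    have "form (Suc 0 + m) (C * W)" by (intro form_mult form_linear_form W)
    then have "form n (binary_form n (coeff g) A B + C * W)" using Suc by (simp add: form_add form_binary)
    moreover have "\<delta> (binary_form n (coeff g) A B + C * W) = pCons g u"
      using g W by (simp add: \<delta>_binary_coeff)
    ultimately show ?thesis by blast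
  qed
qed

definition f where "f = \<delta> F"
definition \<kappa> where "\<kappa> = eval3 F p"

lemma total_degree_f: "total_degree_le d f"
  unfolding f_def by (rule \<delta>_form[OF form_F])

lemma degree_f: "degree f = d"
proof (rule antisym)
  show "degree f \<le> d" by (rule degree_if_total_degree_le[OF total_degree_f])
  show "d \<le> degree f" using \<delta>_form(2)[OF form_F] p_notin by (intro le_degree) (simp add: f_def)
qed

lemma lead_f: "lead_coeff f = [:\<kappa>:]" and kappa: "\<kappa> \<noteq> 0"
  using \<delta>_form(2)[OF form_F] p_notin degree_f by (simp_all add: f_def \<kappa>_def)

text \<open>
  Since \<open>F\<close> does not vanish at the centre, no degree is lost in the quotient, which can thus be homogenized.
\<close>

lemma dvd_\<delta>:
  assumes "form n E"
  shows "F dvd E \<longleftrightarrow> f dvd \<delta> E"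
proof
  assume "F dvd E"
  then show "f dvd \<delta> E" unfolding f_def by (rule ring_map_dvd[OF ring_map_\<delta>])
next
  assume "f dvd \<delta> E"
  then obtain w where w: "\<delta> E = f * w" "w = 0 \<or> d \<le> n \<and> total_degree_le (n - d) w"
    using quotient_total_degree[OF lead_f kappa degree_f _ total_degree_f \<delta>_form(1)[OF assms]] d2 by auto
  show "F dvd E"
  proof (cases "w = 0")
    case True
    then show ?thesis using w \<delta>_zero[OF assms] by simp
  next
    case False
    then obtain W where W: "form (n - d) W" "\<delta> W = w" "d \<le> n" using w \<delta>_surj by blast
    then have "form n (F * W)" using form_mult[OF form_F W(1)] by simp
    then have "E = F * W" using \<delta>_inject[OF assms] w W by (simp add: f_def)
    then show ?thesis by simp
  qed
qed

lemma point_nonzero: "s *s r + q + t *s p \<noteq> 0"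
proof
  assume "s *s r + q + t *s p = 0"
  then have "dotp b (s *s r + q + t *s p) = 0" by (simp only: dotp_simps)
  then show False by simp
qed

text \<open>
  If \<open>f(s, z)\<close> has a multiple root \<open>t\<close>, then \<open>D\<^sub>p F\<close> vanishes at the corresponding point \<open>v\<close> of the curve. If \<open>D\<^sub>r F\<close> vanished as well,
  then by Euler's identity at \<open>v = s r + q + t p\<close> so would \<open>D\<^sub>q F\<close>.
\<close>

lemma affine_smooth_f: "affine_smooth f"
  unfolding affine_smooth_def
proof (intro allI impI notI)
  fix s t e
  assume "eval2 f s t = 0 \<and> poly (pderiv (at_x s f)) t = 0 \<and> f = lift_z (at_x s f) + x_minus s * e"
  then have f0: "eval2 f s t = 0" and dz: "poly (pderiv (at_x s f)) t = 0"
    and fe: "f = lift_z (at_x s f) + x_minus s * e" by blast+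
  assume e: "eval2 e s t = 0"
  define v where "v = s *s r + q + t *s p"
  have v0: "v \<noteq> 0" unfolding v_def by (rule point_nonzero)
  have Fv: "eval3 F v = 0" using f0 by (simp add: f_def eval2_\<delta> v_def)
  have "line F (s *s r + q) p = at_x s f"
    by (rule poly_eqI_all) (simp add: poly_at_x f_def eval2_\<delta>)
  then have "poly (line (Dir p F) (s *s r + q) p) t = 0" using dz by (simp add: pderiv_line[symmetric])
  then have Dp: "eval3 (Dir p F) v = 0" by (simp add: v_def)
  have "line F v r = [:poly (at_x s f) t:] + [:0, 1:] * pcompose (poly e [:t:]) [:s, 1:]"
  proof (rule poly_eqI_all)
    fix h
    have "v + h *s r = (s + h) *s r + q + t *s p" by (simp add: v_def vec_eq_iff algebra_simps)
    then have "poly (line F v r) h = eval2 f (s + h) t" by (simp only: poly_line f_def eval2_\<delta>)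
    also have "\<dots> = poly (at_x s f) t + h * eval2 e (s + h) t"
      by (subst fe) (simp add: x_minus_def)
    finally show "poly (line F v r) h
        = poly ([:poly (at_x s f) t:] + [:0, 1:] * pcompose (poly e [:t:]) [:s, 1:]) h"
      by (simp add: poly_pcompose eval2_def add.commute)
  qed
  then have "poly (pderiv (line F v r)) 0
      = poly (pderiv ([:poly (at_x s f) t:] + [:0, 1:] * pcompose (poly e [:t:]) [:s, 1:])) 0"
    by (simp only:)
  then have "eval3 (Dir r F) v = eval2 e s t"
    by (simp add: pderiv_line pderiv_add pderiv_mult pderiv_pCons poly_pcompose eval2_def)
  then have Dr: "eval3 (Dir r F) v = 0" using e by simp
  have "eval3 (Dir v F) v = 0" using Euler_identity[OF form_F, of v] Fv by simp
  moreover have "eval3 (Dir v F) v = s * eval3 (Dir r F) v + eval3 (Dir q F) v + t * eval3 (Dir p F) v"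
    by (subst (1) v_def) simp
  ultimately have Dq: "eval3 (Dir q F) v = 0" using Dr Dp by simp
  have "eval3 (Dir w F) v = 0" for w
    by (subst expand[of w]) (simp add: Dr Dp Dq)
  then show False using smooth_gradient[OF smooth v0 Fv] by blast
qed

section \<open>Irreducibility of the equation\<close>

abbreviation "R \<equiv> local_ring F"
abbreviation "I \<equiv> vanishing_ideal F"
abbreviation "L \<equiv> function_field F"

lemma R_simps:
  "carrier R = {Fract G H | G H n. form n G \<and> form n H \<and> \<not> F dvd H}"
  "x \<oplus>\<^bsub>R\<^esub> y = x + y" "x \<otimes>\<^bsub>R\<^esub> y = x * y" "\<zero>\<^bsub>R\<^esub> = 0" "\<one>\<^bsub>R\<^esub> = 1"
  by (simp_all add: local_ring_def ring_of_type_algebra_def)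

text \<open>
  Before \<open>F\<close> is known to be irreducible, the local ring need not be closed under its operations. But the
  quotient is a field by assumption, and its zero element \<open>I\<close> satisfies \<open>I + I = I\<close>.
\<close>

lemma I_add: assumes "x \<in> I" "y \<in> I" shows "x + y \<in> I"
proof -
  interpret L: field L by (rule field_L)
  have "\<zero>\<^bsub>L\<^esub> \<oplus>\<^bsub>L\<^esub> \<zero>\<^bsub>L\<^esub> = \<zero>\<^bsub>L\<^esub>" by simp
  then have "I <+>\<^bsub>R\<^esub> I = I" by (simp add: function_field_def FactRing_def)
  then show ?thesis using assms by (auto simp: set_add_def' R_simps)
qed

lemma I_uminus: "x \<in> I \<Longrightarrow> - x \<in> I"
  unfolding vanishing_ideal_def using form_uminus by (force simp flip: minus_fract)

lemma one_notin_I: "1 \<notin> I"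
proof
  assume 1: "1 \<in> I"
  interpret L: field L by (rule field_L)
  have "I +>\<^bsub>R\<^esub> 1 = I"
  proof (intro equalityI subsetI)
    fix x assume "x \<in> I +>\<^bsub>R\<^esub> 1"
    then show "x \<in> I" using 1 I_add by (auto simp: a_r_coset_def' R_simps)
  next
    fix x assume "x \<in> I"
    then have "x + - 1 \<in> I" using I_add I_uminus 1 by blast
    then show "x \<in> I +>\<^bsub>R\<^esub> 1" unfolding a_r_coset_def' R_simps by force
  qed
  then have "\<one>\<^bsub>L\<^esub> = \<zero>\<^bsub>L\<^esub>" by (simp add: function_field_def FactRing_def R_simps)
  then show False using L.one_not_zero by simp
qed

text \<open>
  Two factors \<open>g\<close>, \<open>h\<close> of positive degree have no common factor, by smoothness, hence satisfy \<open>s h + t g = Q\<close>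
  with \<open>0 \<noteq> Q \<in> K[x]\<close>. Now \<open>s h / Q\<close> and \<open>t g / Q\<close> belong to \<open>I\<close>: expanding the first by \<open>g\<close> and the second by \<open>h\<close> gives
  a numerator divisible by \<open>f = g h\<close> while the denominator is not. Their sum is \<open>1\<close>, which is
  not in \<open>I\<close>.
\<close>

lemma no_factorization_f:
  assumes f: "f = g * h"
  shows "degree g = 0 \<or> degree h = 0"
proof (rule ccontr)
  assume "\<not> ?thesis"
  then have deg: "degree g > 0" "degree h > 0" by auto
  obtain \<kappa>g where g: "\<kappa>g \<noteq> 0" "lead_coeff g = [:\<kappa>g:]" using lead_const_mult[of g h] lead_f kappa f by metis
  have "f = h * g" using f by (simp add: mult.commute)
  then obtain \<kappa>h where h: "\<kappa>h \<noteq> 0" "lead_coeff h = [:\<kappa>h:]" using lead_const_mult[of h g] lead_f kappa by metis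
  have not_dvd: "\<not> f dvd [:Q:] * h" "\<not> f dvd [:Q:] * g" if "Q \<noteq> 0" for Q
  proof -
    have *: "\<not> u * v dvd [:Q:] * v" if "degree u > 0" "v \<noteq> 0" for u v :: "'a poly poly"
    proof
      assume "u * v dvd [:Q:] * v"
      then have "u dvd [:Q:]" using that(2) dvd_times_right_cancel_iff by blast
      then show False using dvd_imp_degree_le[of u "[:Q:]"] \<open>Q \<noteq> 0\<close> that(1) by simp
    qed
    show "\<not> f dvd [:Q:] * h" unfolding f by (rule *) (use deg in auto)
    show "\<not> f dvd [:Q:] * g" unfolding \<open>f = h * g\<close> by (rule *) (use deg in auto)
  qed
  consider (bezout) s t Q where "Q \<noteq> 0" "s * h + t * g = [:Q:]"
    | (common) k \<kappa>' where "\<kappa>' \<noteq> 0" "lead_coeff k = [:\<kappa>':]" "degree k > 0" "k dvd g" "k dvd h"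
    using bezout_or_common_factor[OF g(2,1), of h] by blast
  then show False
  proof cases
    case common
    then obtain g' h' where "g = k * g'" "h = k * h'" by (auto simp: dvd_def)
    then have "f = k * k * (g' * h')" using f by (simp add: mult_ac)
    then show False using affine_smooth_squarefree[OF affine_smooth_f _ common(2,1,3)] by blast
  next
    case bezout
    obtain n1 n2 n3 where "total_degree_le n1 (s * h)" "total_degree_le n2 (t * g)" "total_degree_le n3 [:Q:]"
      using total_degree_exists by meson
    then have n: "total_degree_le (n1 + n2 + n3) (s * h)" "total_degree_le (n1 + n2 + n3) (t * g)"
      "total_degree_le (n1 + n2 + n3) [:Q:]"
      by (auto elim: total_degree_le_mono)
    define n where "n = n1 + n2 + n3"
    obtain S T Q' where STQ: "form n S" "\<delta> S = s * h" "form n T" "\<delta> T = t * g" "form n Q'" "\<delta> Q' = [:Q:]"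
      using n[folded n_def] \<delta>_surj by metis
    have sum: "S + T = Q'"
      by (rule \<delta>_inject[of n]) (simp_all add: STQ form_add bezout(2))
    have Q'0: "Q' \<noteq> 0" using STQ bezout(1) by auto
    have in_I: "Fract U Q' \<in> I" if U: "form n U" "\<delta> U = x * y" and y: "f = y * z" "\<not> f dvd [:Q:] * z"
      for U x y z
    proof -
      obtain m where "total_degree_le m z" using total_degree_exists by blast
      then obtain Z where Z: "form m Z" "\<delta> Z = z" using \<delta>_surj by blast
      have "Z \<noteq> 0" using Z y by auto
      then have "Fract U Q' = Fract (U * Z) (Q' * Z)" using Q'0 by (simp add: eq_fract mult_ac)
      moreover have fU: "form (n + m) (U * Z)" and fQ: "form (n + m) (Q' * Z)"
        using form_mult U Z STQ by blast+
      moreover have "F dvd U * Z" using dvd_\<delta>[OF fU] U Z y by (simp add: mult_ac)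
      moreover have "\<not> F dvd Q' * Z" using dvd_\<delta>[OF fQ] STQ Z y by simp
      ultimately show ?thesis unfolding vanishing_ideal_def by blast
    qed
    have "Fract S Q' \<in> I" using in_I[OF STQ(1,2) \<open>f = h * g\<close>] not_dvd bezout(1) by blast
    moreover have "Fract T Q' \<in> I" using in_I[OF STQ(3,4) f] not_dvd bezout(1) by blast
    ultimately have "Fract S Q' + Fract T Q' \<in> I" by (rule I_add)
    moreover have "Fract S Q' + Fract T Q' = 1"
    proof -
      have "Fract S Q' + Fract T Q' = Fract (Q' * Q') (Q' * Q')"
        using Q'0 by (simp add: sum[symmetric] algebra_simps)
      then show ?thesis using Q'0 by (simp add: One_fract_def eq_fract)
    qed
    ultimately show False using one_notin_I by simp
  qed
qed

end

sublocale chart \<subseteq> smooth_affine_curve f \<kappa>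
  using lead_f kappa degree_f d2 no_factorization_f affine_smooth_f by unfold_locales auto

section \<open>Arithmetic of the function field\<close>

context chart
begin

lemma f_not_dvd_const: "Q \<noteq> 0 \<Longrightarrow> \<not> f dvd [:Q:]"
  using degree_f d2 by (intro f_not_dvd_low_degree) auto

lemma f_not_dvd_1 [simp]: "\<not> f dvd 1"
  using f_not_dvd_const[of 1] by (simp flip: one_pCons)

lemma not_dvd_mult:
  assumes "form m H" "\<not> F dvd H" "form n H'" "\<not> F dvd H'"
  shows "\<not> F dvd H * H'"
  using assms dvd_\<delta>[OF form_mult[OF assms(1,3)]] by (simp add: dvd_\<delta> f_dvd_mult)

lemma carrier_R: "form n G \<Longrightarrow> form n H \<Longrightarrow> \<not> F dvd H \<Longrightarrow> Fract G H \<in> carrier R"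
  unfolding R_simps by blast

lemma carrier_R_closed:
  assumes "x \<in> carrier R" "y \<in> carrier R"
  shows "x + y \<in> carrier R" "x * y \<in> carrier R" "- x \<in> carrier R"
proof -
  obtain G H n where x: "x = Fract G H" "form n G" "form n H" "\<not> F dvd H"
    using assms(1) unfolding R_simps by blast
  obtain G' H' m where y: "y = Fract G' H'" "form m G'" "form m H'" "\<not> F dvd H'"
    using assms(2) unfolding R_simps by blast
  have nz: "H \<noteq> 0" "H' \<noteq> 0" using x y by auto
  have HH: "form (n + m) (H * H')" "\<not> F dvd H * H'" using x y form_mult not_dvd_mult by blast+
  have "x + y = Fract (G * H' + G' * H) (H * H')" using nz by (simp add: x y)
  moreover have "form (m + n) (G' * H)" using x y form_mult by blast
  then have "form (n + m) (G * H' + G' * H)" using x y form_mult form_add by (metis add.commute)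
  ultimately show "x + y \<in> carrier R" using HH carrier_R by simp
  have "x * y = Fract (G * G') (H * H')" by (simp add: x y)
  then show "x * y \<in> carrier R" using HH carrier_R form_mult x y by metis
  have "- x = Fract (- G) H" by (simp add: x)
  then show "- x \<in> carrier R" using carrier_R form_uminus x by metis
qed

lemma cring_R: "cring R"
proof -
  let ?K = "ring_of_type_algebra :: 'a poly3 fract ring"
  interpret K: cring ?K by (rule cring_from_type_algebra)
  have K: "carrier ?K = UNIV" "\<And>x y. x \<oplus>\<^bsub>?K\<^esub> y = x + y" "\<And>x y. x \<otimes>\<^bsub>?K\<^esub> y = x * y"
    "\<zero>\<^bsub>?K\<^esub> = 0" "\<one>\<^bsub>?K\<^esub> = 1"
    by (simp_all add: ring_of_type_algebra_def)
  have neg: "\<ominus>\<^bsub>?K\<^esub> x = - x" for x by (rule K.minus_equality) (simp_all add: K)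
  have one: "1 \<in> carrier R"
    using carrier_R[OF form_1 form_1] dvd_\<delta>[OF form_1] by (simp add: One_fract_def)
  have "subring (carrier R) ?K"
    by (rule K.subringI) (auto simp: K neg one intro: carrier_R_closed)
  then have "subcring (carrier R) ?K" by (rule K.subcringI')
  then have "cring (?K\<lparr>carrier := carrier R\<rparr>)" using K.subcring_iff[of "carrier R"] by (simp add: K)
  moreover have "?K\<lparr>carrier := carrier R\<rparr> = R" by (simp add: local_ring_def)
  ultimately show ?thesis by simp
qed

lemma I_subset: "I \<subseteq> carrier R"
  unfolding vanishing_ideal_def R_simps by blast

lemma uminus_R: "x \<in> carrier R \<Longrightarrow> \<ominus>\<^bsub>R\<^esub> x = - x"
proof -
  assume x: "x \<in> carrier R"
  interpret R: cring R by (rule cring_R)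
  show ?thesis
    by (rule R.minus_equality) (use x carrier_R_closed in \<open>auto simp: R_simps(2-)\<close>)
qed

lemma Fract_in_I_iff:
  assumes "form n G" "form n H" "\<not> F dvd H"
  shows "Fract G H \<in> I \<longleftrightarrow> F dvd G"
proof
  assume "Fract G H \<in> I"
  then obtain G' H' m where *: "Fract G H = Fract G' H'" "form m G'" "form m H'" "\<not> F dvd H'" "F dvd G'"
    unfolding vanishing_ideal_def by blast
  have "H \<noteq> 0" "H' \<noteq> 0" using * assms by auto
  then have "G * H' = G' * H" using * by (simp add: eq_fract)
  then have "F dvd G * H'" using * by simp
  then show "F dvd G" using not_dvd_mult[OF assms(1) _ *(3,4)] by blast
qed (use assms in \<open>auto simp: vanishing_ideal_def\<close>)

lemma ideal_I: "ideal I R"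
proof -
  interpret R: cring R by (rule cring_R)
  have l: "x * y \<in> I" if xy: "x \<in> I" "y \<in> carrier R" for x y
  proof -
    obtain G H n where x: "x = Fract G H" "form n G" "form n H" "\<not> F dvd H" "F dvd G"
      using xy(1) unfolding vanishing_ideal_def by blast
    obtain G' H' m where y: "y = Fract G' H'" "form m G'" "form m H'" "\<not> F dvd H'"
      using xy(2) unfolding R_simps by blast
    have "x * y = Fract (G * G') (H * H')" by (simp add: x y)
    moreover have "F dvd G * G'" using x by simp
    ultimately show ?thesis using x y form_mult not_dvd_mult unfolding vanishing_ideal_def by blast
  qed
  have "\<not> F dvd 1" using dvd_\<delta>[OF form_1] by simp
  then have "Fract 0 1 \<in> I" using Fract_in_I_iff[OF form_0 form_1] by simp
  then have zero: "0 \<in> I" by (simp add: Zero_fract_def)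
  show ?thesis
  proof (rule idealI)
    show "ring R" by (rule R.ring_axioms)
    show "subgroup I (add_monoid R)"
    proof (rule R.add.subgroupI)
      show "I \<noteq> {}" using zero by blast
      show "I \<subseteq> carrier R" by (rule I_subset)
      show "\<And>x. x \<in> I \<Longrightarrow> \<ominus>\<^bsub>R\<^esub> x \<in> I" using I_uminus uminus_R I_subset by auto
      show "\<And>x y. x \<in> I \<Longrightarrow> y \<in> I \<Longrightarrow> x \<oplus>\<^bsub>R\<^esub> y \<in> I" using I_add by (simp add: R_simps)
    qed
    fix x y assume *: "x \<in> I" "y \<in> carrier R"
    show "x \<otimes>\<^bsub>R\<^esub> y \<in> I" using l[OF *] by (simp add: R_simps)
    then show "y \<otimes>\<^bsub>R\<^esub> x \<in> I" by (simp add: R_simps mult.commute)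
  qed
qed

abbreviation "\<rho> \<equiv> rational_function F"

lemma \<rho>_eq_iff:
  assumes "form n G" "form n H" "\<not> F dvd H" "form m G'" "form m H'" "\<not> F dvd H'"
  shows "\<rho> G H = \<rho> G' H' \<longleftrightarrow> f dvd \<delta> G * \<delta> H' - \<delta> G' * \<delta> H"
proof -
  interpret R: cring R by (rule cring_R)
  have c: "Fract G H \<in> carrier R" "Fract G' H' \<in> carrier R" using assms carrier_R by blast+
  have "Fract G H \<ominus>\<^bsub>R\<^esub> Fract G' H' = Fract G H - Fract G' H'"
    using c by (simp only: a_minus_def uminus_R R_simps(2)) simp
  also have "\<dots> = Fract (G * H' - G' * H) (H * H')"
    using assms by (intro diff_fract) auto
  finally have eq: "Fract G H \<ominus>\<^bsub>R\<^esub> Fract G' H' = Fract (G * H' - G' * H) (H * H')" .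
  have f1: "form (n + m) (G * H')" using assms form_mult by blast
  have "form (m + n) (G' * H)" using assms form_mult by blast
  then have f2: "form (n + m) (G' * H)" by (simp add: add.commute)
  have "\<rho> G H = \<rho> G' H' \<longleftrightarrow> Fract G H \<ominus>\<^bsub>R\<^esub> Fract G' H' \<in> I"
    unfolding rational_function_def
    using R.quotient_eq_iff_same_a_r_cos[OF ideal_I c] by blast
  also have "\<dots> \<longleftrightarrow> F dvd G * H' - G' * H"
    unfolding eq by (rule Fract_in_I_iff[OF form_diff[OF f1 f2]])
      (use assms form_mult not_dvd_mult in blast)+
  also have "\<dots> \<longleftrightarrow> f dvd \<delta> G * \<delta> H' - \<delta> G' * \<delta> H"
    unfolding dvd_\<delta>[OF form_diff[OF f1 f2]] by simp
  finally show ?thesis .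
qed

text \<open>
  The class of \<open>u / h\<close> in the function field. Its representation by forms of some common degree is
  immaterial, so that the function field is described by affine fractions from here on.
\<close>

definition fr :: "'a poly poly \<Rightarrow> 'a poly poly \<Rightarrow> 'a poly3 fract set" where
  "fr u h = (SOME x. \<exists>n G H. form n G \<and> form n H \<and> \<delta> G = u \<and> \<delta> H = h \<and> x = \<rho> G H)"

lemma \<rho>_fr:
  assumes "form n G" "form n H" "\<not> F dvd H"
  shows "\<rho> G H = fr (\<delta> G) (\<delta> H)"
  unfolding fr_def
proof (rule some_equality[symmetric])
  show "\<exists>n' G' H'. form n' G' \<and> form n' H' \<and> \<delta> G' = \<delta> G \<and> \<delta> H' = \<delta> H \<and> \<rho> G H = \<rho> G' H'"
    using assms by blast
  fix x assume "\<exists>n' G' H'. form n' G' \<and> form n' H' \<and> \<delta> G' = \<delta> G \<and> \<delta> H' = \<delta> H \<and> x = \<rho> G' H'"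
  then obtain n' G' H' where *: "form n' G'" "form n' H'" "\<delta> G' = \<delta> G" "\<delta> H' = \<delta> H" "x = \<rho> G' H'" by blast
  have "\<not> F dvd H'" using * assms by (simp add: dvd_\<delta>)
  then show "x = \<rho> G H" using * \<rho>_eq_iff[OF *(1,2) _ assms] by simp
qed

lemma fr_rep:
  assumes "\<not> f dvd h"
  shows "\<exists>n G H. form n G \<and> form n H \<and> \<not> F dvd H \<and> \<delta> G = u \<and> \<delta> H = h \<and> fr u h = \<rho> G H"
proof -
  obtain n1 n2 where "total_degree_le n1 u" "total_degree_le n2 h" using total_degree_exists by meson
  then have "total_degree_le (n1 + n2) u" "total_degree_le (n1 + n2) h"
    by (auto elim: total_degree_le_mono)
  then obtain G H where *: "form (n1 + n2) G" "form (n1 + n2) H" "\<delta> G = u" "\<delta> H = h" using \<delta>_surj by metis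
  then have "\<not> F dvd H" using assms by (simp add: dvd_\<delta>)
  then show ?thesis using * \<rho>_fr by metis
qed

lemma fr_eq_iff:
  assumes "\<not> f dvd h" "\<not> f dvd h'"
  shows "fr u h = fr u' h' \<longleftrightarrow> f dvd u * h' - u' * h"
proof -
  obtain n G H where 1: "form n G" "form n H" "\<not> F dvd H" "\<delta> G = u" "\<delta> H = h" "fr u h = \<rho> G H"
    using fr_rep[OF assms(1)] by metis
  obtain m G' H' where 2: "form m G'" "form m H'" "\<not> F dvd H'" "\<delta> G' = u'" "\<delta> H' = h'" "fr u' h' = \<rho> G' H'"
    using fr_rep[OF assms(2)] by metis
  show ?thesis using \<rho>_eq_iff[OF 1(1-3) 2(1-3)] 1 2 by simp
qed

lemma \<rho>_hom: "ring_hom_ring R L (\<lambda>x. I +>\<^bsub>R\<^esub> x)"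
  unfolding function_field_def by (rule ideal.rcos_ring_hom_ring[OF ideal_I])

lemma
  assumes h: "\<not> f dvd h" "\<not> f dvd h'"
  shows fr_add: "fr u h \<oplus>\<^bsub>L\<^esub> fr u' h' = fr (u * h' + u' * h) (h * h')"
    and fr_mult: "fr u h \<otimes>\<^bsub>L\<^esub> fr u' h' = fr (u * u') (h * h')"
proof -
  interpret \<rho>: ring_hom_ring R L "\<lambda>x. I +>\<^bsub>R\<^esub> x" by (rule \<rho>_hom)
  obtain n G H where 1: "form n G" "form n H" "\<not> F dvd H" "\<delta> G = u" "\<delta> H = h" "fr u h = \<rho> G H"
    using fr_rep[OF h(1)] by metis
  obtain m G' H' where 2: "form m G'" "form m H'" "\<not> F dvd H'" "\<delta> G' = u'" "\<delta> H' = h'" "fr u' h' = \<rho> G' H'"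
    using fr_rep[OF h(2)] by metis
  have nz: "H \<noteq> 0" "H' \<noteq> 0" using 1 2 by auto
  have c: "Fract G H \<in> carrier R" "Fract G' H' \<in> carrier R" using 1 2 carrier_R by blast+
  have f1: "form (n + m) (G * H')" "form (n + m) (G * G')" "form (n + m) (H * H')"
    using 1 2 form_mult by blast+
  have "form (m + n) (G' * H)" using 1 2 form_mult by blast
  then have f2: "form (n + m) (G * H' + G' * H)" using f1 by (simp add: add.commute form_add)
  have nd: "\<not> F dvd H * H'" using 1 2 not_dvd_mult by blast
  have "fr u h \<oplus>\<^bsub>L\<^esub> fr u' h' = \<rho> (G * H' + G' * H) (H * H')"
    using \<rho>.hom_add[OF c] nz by (simp add: 1(6) 2(6) rational_function_def R_simps(2))
  then show "fr u h \<oplus>\<^bsub>L\<^esub> fr u' h' = fr (u * h' + u' * h) (h * h')"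
    using \<rho>_fr[OF f2 f1(3) nd] 1 2 by simp
  have "fr u h \<otimes>\<^bsub>L\<^esub> fr u' h' = \<rho> (G * G') (H * H')"
    using \<rho>.hom_mult[OF c] nz by (simp add: 1(6) 2(6) rational_function_def R_simps(3))
  then show "fr u h \<otimes>\<^bsub>L\<^esub> fr u' h' = fr (u * u') (h * h')"
    using \<rho>_fr[OF f1(2,3) nd] 1 2 by simp
qed

lemma carrier_L: "x \<in> carrier L \<longleftrightarrow> (\<exists>u h. \<not> f dvd h \<and> x = fr u h)"
proof
  assume "x \<in> carrier L"
  then obtain y where "y \<in> carrier R" "x = I +>\<^bsub>R\<^esub> y"
    by (auto simp: function_field_def FactRing_def A_RCOSETS_def')
  then obtain n G H where "form n G" "form n H" "\<not> F dvd H" "x = \<rho> G H"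
    unfolding R_simps rational_function_def by blast
  then show "\<exists>u h. \<not> f dvd h \<and> x = fr u h" using \<rho>_fr dvd_\<delta> by metis
next
  interpret \<rho>: ring_hom_ring R L "\<lambda>x. I +>\<^bsub>R\<^esub> x" by (rule \<rho>_hom)
  assume "\<exists>u h. \<not> f dvd h \<and> x = fr u h"
  then obtain n G H where "form n G" "form n H" "\<not> F dvd H" "x = \<rho> G H" using fr_rep by metis
  then show "x \<in> carrier L" using carrier_R \<rho>.hom_closed unfolding rational_function_def by blast
qed

lemma fr_carrier: "\<not> f dvd h \<Longrightarrow> fr u h \<in> carrier L"
  using carrier_L by blast

abbreviation "base_field \<equiv> pullback_field F a b"

lemma pullback_eq: "base_field = {fr [:g:] [:h:] | g h. h \<noteq> 0}"
proof (intro equalityI subsetI)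
  fix x assume "x \<in> base_field"
  then obtain n g h i where *: "x = \<rho> (binary_form n g A B) (binary_form n h A B)" "i \<le> n" "h i \<noteq> 0"
    unfolding pullback_field_def by blast
  have "coeff (\<Sum>i\<le>n. monom (h i) i) i = h i" using *(2) by (simp add: coeff_sum)
  then have h: "(\<Sum>i\<le>n. monom (h i) i) \<noteq> 0" using *(3) by auto
  then have "\<not> F dvd binary_form n h A B"
    using f_not_dvd_const by (simp add: dvd_\<delta>[OF form_binary] \<delta>_binary)
  then have "x = fr [:\<Sum>i\<le>n. monom (g i) i:] [:\<Sum>i\<le>n. monom (h i) i:]"
    using \<rho>_fr[OF form_binary form_binary] *(1) by (simp only: \<delta>_binary)
  then show "x \<in> {fr [:g:] [:h:] | g h. h \<noteq> 0}" using h by blast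
next
  fix x assume "x \<in> {fr [:g:] [:h:] | g h. h \<noteq> 0}"
  then obtain g h where *: "x = fr [:g:] [:h:]" "h \<noteq> 0" by blast
  define n where "n = max (degree g) (degree h)"
  have \<delta>: "\<delta> (binary_form n (coeff g) A B) = [:g:]" "\<delta> (binary_form n (coeff h) A B) = [:h:]"
    by (simp_all add: \<delta>_binary_coeff n_def)
  then have "\<not> F dvd binary_form n (coeff h) A B"
    using f_not_dvd_const[OF *(2)] by (simp add: dvd_\<delta>[OF form_binary])
  then have "x = \<rho> (binary_form n (coeff g) A B) (binary_form n (coeff h) A B)"
    using \<rho>_fr[OF form_binary form_binary] * \<delta> by simp
  moreover have "degree h \<le> n" "coeff h (degree h) \<noteq> 0" using *(2) by (simp_all add: n_def)
  ultimately show "x \<in> base_field" unfolding pullback_field_def by blast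
qed

section \<open>Galois automorphisms are linear\<close>

abbreviation "Aut \<equiv> field_automorphisms L base_field"
abbreviation "Z \<equiv> [:0, 1 :: 'a poly:]"

lemma automorphism_props:
  assumes "\<sigma> \<in> Aut"
  shows "\<And>x. x \<in> carrier L \<Longrightarrow> \<sigma> x \<in> carrier L"
    and "\<And>x y. x \<in> carrier L \<Longrightarrow> y \<in> carrier L \<Longrightarrow> \<sigma> (x \<otimes>\<^bsub>L\<^esub> y) = \<sigma> x \<otimes>\<^bsub>L\<^esub> \<sigma> y"
    and "\<And>x y. x \<in> carrier L \<Longrightarrow> y \<in> carrier L \<Longrightarrow> \<sigma> (x \<oplus>\<^bsub>L\<^esub> y) = \<sigma> x \<oplus>\<^bsub>L\<^esub> \<sigma> y"
    and "inj_on \<sigma> (carrier L)"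
    and "\<And>g h. h \<noteq> 0 \<Longrightarrow> \<sigma> (fr [:g:] [:h:]) = fr [:g:] [:h:]"
proof -
  have iso: "\<sigma> \<in> ring_iso L L" and fix_k: "\<And>x. x \<in> base_field \<Longrightarrow> \<sigma> x = x"
    using assms by (auto simp: field_automorphisms_def)
  show "\<And>x. x \<in> carrier L \<Longrightarrow> \<sigma> x \<in> carrier L"
    and "\<And>x y. x \<in> carrier L \<Longrightarrow> y \<in> carrier L \<Longrightarrow> \<sigma> (x \<otimes>\<^bsub>L\<^esub> y) = \<sigma> x \<otimes>\<^bsub>L\<^esub> \<sigma> y"
    and "\<And>x y. x \<in> carrier L \<Longrightarrow> y \<in> carrier L \<Longrightarrow> \<sigma> (x \<oplus>\<^bsub>L\<^esub> y) = \<sigma> x \<oplus>\<^bsub>L\<^esub> \<sigma> y"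
    using ring_iso_memE[OF iso] by blast+
  show "inj_on \<sigma> (carrier L)" using ring_iso_memE(5)[OF iso] by (simp add: bij_betw_def)
  show "\<And>g h. h \<noteq> 0 \<Longrightarrow> \<sigma> (fr [:g:] [:h:]) = fr [:g:] [:h:]"
    using fix_k unfolding pullback_eq by blast
qed

definition homog_to :: "nat \<Rightarrow> 'a poly poly \<Rightarrow> 'a poly poly \<Rightarrow> 'a poly poly \<Rightarrow> 'a poly poly" where
  "homog_to N u g h = (\<Sum>k\<le>N. [:coeff u k:] * g ^ k * h ^ (N - k))"

lemma homog_to_Suc:
  "homog_to (Suc N) (pCons e u) g h = [:e:] * h ^ Suc N + g * homog_to N u g h"
  unfolding homog_to_def sum.atMost_Suc_shift sum_distrib_left
  by (simp add: mult_ac)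

lemma f_not_dvd_power: "\<not> f dvd h \<Longrightarrow> \<not> f dvd h ^ N"
  using f_dvd_power by blast

lemma fr_pCons: "fr (pCons e u) 1 = fr [:e:] 1 \<oplus>\<^bsub>L\<^esub> (fr Z 1 \<otimes>\<^bsub>L\<^esub> fr u 1)"
  by (simp add: fr_mult fr_add)

text \<open>
  An automorphism fixes \<open>K(x)\<close> and is therefore determined by the image \<open>g / h\<close> of \<open>z\<close>. Clearing denominators,
  \<open>h\<^sup>N u(x, g / h)\<close> is a polynomial.
\<close>

lemma aut_subst:
  assumes \<sigma>: "\<sigma> \<in> Aut" and h: "\<not> f dvd h" "\<sigma> (fr Z 1) = fr g h"
  shows "degree u \<le> N \<Longrightarrow> \<sigma> (fr u 1) = fr (homog_to N u g h) (h ^ N)"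
proof (induction N arbitrary: u)
  case 0
  then obtain c where u: "u = [:c:]" using degree_eq_zeroE by blast
  have "\<sigma> (fr [:c:] [:1:]) = fr [:c:] [:1:]" by (rule automorphism_props(5)[OF \<sigma>]) simp
  then show ?case by (simp add: u homog_to_def flip: one_pCons)
next
  case (Suc N)
  obtain c v where u: "u = pCons c v" by (cases u)
  have v: "degree v \<le> N" using Suc.prems u by (auto split: if_splits)
  have "\<sigma> (fr [:c:] [:1:]) = fr [:c:] [:1:]" by (rule automorphism_props(5)[OF \<sigma>]) simp
  then have c: "\<sigma> (fr [:c:] 1) = fr [:c:] 1" by (simp flip: one_pCons)
  interpret L: field L by (rule field_L)
  have carr: "fr x 1 \<in> carrier L" for x by (rule fr_carrier) simp
  have "\<sigma> (fr u 1) = \<sigma> (fr [:c:] 1) \<oplus>\<^bsub>L\<^esub> (\<sigma> (fr Z 1) \<otimes>\<^bsub>L\<^esub> \<sigma> (fr v 1))"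
    unfolding u fr_pCons[of c v] using carr by (simp add: automorphism_props(2,3)[OF \<sigma>])
  also have "\<dots> = fr [:c:] 1 \<oplus>\<^bsub>L\<^esub> (fr g h \<otimes>\<^bsub>L\<^esub> fr (homog_to N v g h) (h ^ N))"
    by (simp only: c h(2) Suc.IH[OF v])
  also have "\<dots> = fr ([:c:] * h ^ Suc N + g * homog_to N v g h) (h ^ Suc N)"
    using h(1) f_not_dvd_power[OF h(1)] by (simp add: fr_mult fr_add f_dvd_mult)
  finally show ?case by (simp only: u homog_to_Suc)
qed

text \<open>
  The image of \<open>z\<close> is again a root of \<open>f(x, T)\<close>, hence integral over \<open>K[x]\<close>. With a denominator in \<open>K[x]\<close>, provided by
  the Bezout identity, normality applies.
\<close>

lemma aut_polynomial:
  assumes \<sigma>: "\<sigma> \<in> Aut"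
  shows "\<exists>w. degree w < d \<and> \<sigma> (fr Z 1) = fr w 1"
proof -
  have "fr Z 1 \<in> carrier L" by (rule fr_carrier) simp
  then obtain g h where gh: "\<not> f dvd h" "\<sigma> (fr Z 1) = fr g h"
    using automorphism_props(1)[OF \<sigma>] carrier_L by blast
  have "fr f 1 = fr [:0:] [:1:]" by (simp add: fr_eq_iff flip: one_pCons)
  then have "\<sigma> (fr f 1) = fr [:0:] [:1:]" using automorphism_props(5)[OF \<sigma>, of 1 0] by simp
  then have "fr (homog f g h) (h ^ degree f) = fr 0 1"
    using aut_subst[OF \<sigma> gh, of f "degree f"] by (simp add: homog_def homog_to_def flip: one_pCons)
  then have hom: "f dvd homog f g h" using f_not_dvd_power[OF gh(1)] by (simp add: fr_eq_iff)
  obtain s t Q where Q: "Q \<noteq> 0" "s * h + t * f = [:Q:]"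
    using bezout_irreducible[OF lead_f kappa irreducible_f gh(1)] by blast
  have "f dvd s ^ degree f * homog f g h" using hom by simp
  then have 1: "f dvd homog f (s * g) (s * h)" by (simp only: homog_scale)
  have "s * h - [:Q:] = f * (- t)" unfolding Q(2)[symmetric] by (simp add: algebra_simps)
  then have "f dvd s * h - [:Q:]" by (metis dvd_triv_left)
  then have "f dvd homog f (s * g) (s * h) - homog f (s * g) [:Q:]" by (intro homog_cong) simp_all
  then have "f dvd homog f (s * g) [:Q:]" using 1 cong_dvd by blast
  then obtain w where w: "f dvd s * g - [:Q:] * w" using normal[OF Q(1)] by blast
  obtain n where "total_degree_le n w" using total_degree_exists by blast
  then obtain w1 v where v: "w = f * w1 + v" "degree v < d"
    using division_with_total_degree[OF lead_f kappa degree_f _ total_degree_f] d2 by fastforce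
  have "[:Q:] * (g - v * h) = f * (t * g + [:Q:] * w1 * h) + (s * g - [:Q:] * w) * h"
    unfolding Q(2)[symmetric] v(1) by (simp add: algebra_simps)
  then have "f dvd [:Q:] * (g - v * h)" using w by (simp only:) (intro dvd_add dvd_triv_left dvd_mult2)
  then have "f dvd g - v * h" using f_dvd_mult f_not_dvd_const[OF Q(1)] by blast
  then have "fr g h = fr v 1" using gh(1) by (simp add: fr_eq_iff)
  then show ?thesis using v(2) gh(2) by auto
qed

lemma not_F_dvd_B: "\<not> F dvd B" and not_F_dvd_B_power: "\<not> F dvd B ^ n"
proof -
  have "\<not> F dvd B ^ n" for n
    using dvd_\<delta>[OF form_power1[OF form_linear_form]] by simp
  from this[of 1] this show "\<not> F dvd B" "\<not> F dvd B ^ n" by simp_all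
qed

lemma \<rho>_C_B: "\<rho> C B = fr Z 1"
  using \<rho>_fr[OF form_linear_form form_linear_form not_F_dvd_B] by simp

lemma aut_polynomial_form:
  assumes "\<sigma> \<in> Aut"
  shows "\<exists>n W. form n W \<and> \<sigma> (\<rho> C B) = \<rho> W (B ^ n)"
proof -
  obtain w where w: "\<sigma> (fr Z 1) = fr w 1" using aut_polynomial[OF assms] by blast
  obtain n where "total_degree_le n w" using total_degree_exists by blast
  then obtain W where W: "form n W" "\<delta> W = w" using \<delta>_surj by blast
  have "\<rho> W (B ^ n) = fr w 1"
    using \<rho>_fr[OF W(1) form_power1[OF form_linear_form] not_F_dvd_B_power] W by simp
  then show ?thesis using W w \<rho>_C_B by metis
qed

lemma swap_chart: "chart F d b a c p r q"
proof (rule chart.intro)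
  show "v = dotp b v *s q + dotp a v *s r + dotp c v *s p" for v
    using expand[of v] by (simp add: add.commute)
qed (rule smooth d2 p_notin dual field_L)+

lemma binary_form_swap: "binary_form n g A' B' = binary_form n (\<lambda>i. g (n - i)) B' A'"
  unfolding binary_form_def
  by (rule sum.reindex_bij_witness[of _ "\<lambda>i. n - i" "\<lambda>i. n - i"]) (auto simp: mult_ac)

lemma pullback_swap: "pullback_field F b a = base_field"
proof -
  have "pullback_field F u v \<subseteq> pullback_field F v u" for u v
  proof
    fix x assume "x \<in> pullback_field F u v"
    then obtain n g h i where *: "i \<le> n" "h i \<noteq> 0"
      "x = \<rho> (binary_form n g (linear_form u) (linear_form v)) (binary_form n h (linear_form u) (linear_form v))"
      unfolding pullback_field_def by blast
    have "\<exists>i\<le>n. h (n - i) \<noteq> 0" using *(1,2) by (intro exI[of _ "n - i"]) simp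
    moreover have "x = \<rho> (binary_form n (\<lambda>i. g (n - i)) (linear_form v) (linear_form u))
        (binary_form n (\<lambda>i. h (n - i)) (linear_form v) (linear_form u))"
      unfolding *(3) by (simp only: binary_form_swap[of n _ "linear_form u"])
    ultimately show "x \<in> pullback_field F v u" unfolding pullback_field_def by blast
  qed
  then show ?thesis by blast
qed

text \<open>
  In the second chart \<open>z / x\<close> has a polynomial image, too: \<open>\<sigma>(z / x) = W / x\<^sup>n\<close> with \<open>W\<close> of total degree at most \<open>n\<close>.
  So the image \<open>w\<close> of \<open>z\<close> satisfies \<open>w x\<^sup>n = W x\<close> on the curve. After reduction modulo \<open>f\<close>, which keeps the
  total degree, this is an identity of polynomials, and \<open>w\<close> has total degree at most \<open>(n + 1) - n\<close>.
\<close>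

lemma aut_linear:
  assumes \<sigma>: "\<sigma> \<in> Aut"
  shows "\<exists>w. total_degree_le 1 w \<and> \<sigma> (fr Z 1) = fr w 1"
proof -
  define \<xi> where "\<xi> = [:[:0, 1 :: 'a:]:]"
  obtain w where w: "degree w < d" "\<sigma> (fr Z 1) = fr w 1" using aut_polynomial[OF \<sigma>] by blast
  have "\<sigma> \<in> field_automorphisms L (pullback_field F b a)" using \<sigma> by (simp only: pullback_swap)
  then obtain n W where W: "form n W" "\<sigma> (\<rho> C A) = \<rho> W (A ^ n)" 
    using chart.aut_polynomial_form[OF swap_chart] by blast
  have A: "\<not> F dvd A" "\<not> F dvd A ^ n" 
    by (rule chart.not_F_dvd_B[OF swap_chart] chart.not_F_dvd_B_power[OF swap_chart])+
  have \<xi>: "\<not> f dvd \<xi>" "\<not> f dvd \<xi> ^ n"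
    using A dvd_\<delta>[OF form_linear_form, of a] dvd_\<delta>[OF form_power1[OF form_linear_form[of a], of n]]
    by (simp_all add: \<xi>_def)
  have CA: "\<rho> C A = fr Z \<xi>" using \<rho>_fr[OF form_linear_form form_linear_form A(1)] by (simp add: \<xi>_def)
  have WA: "\<rho> W (A ^ n) = fr (\<delta> W) (\<xi> ^ n)"
    using \<rho>_fr[OF W(1) form_power1[OF form_linear_form] A(2)] by (simp add: \<xi>_def)
  \<comment> \<open>Here \<open>\<xi>\<close> is x, and this is z = (z / x) x.\<close>
  have "fr Z 1 = fr Z \<xi> \<otimes>\<^bsub>L\<^esub> fr \<xi> 1"
    using \<xi> by (simp add: fr_mult fr_eq_iff)
  then have "\<sigma> (fr Z 1) = \<sigma> (fr Z \<xi>) \<otimes>\<^bsub>L\<^esub> \<sigma> (fr \<xi> 1)"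
    using fr_carrier[OF \<xi>(1)] fr_carrier[of 1] by (simp add: automorphism_props(2)[OF \<sigma>])
  also have "\<sigma> (fr \<xi> 1) = fr \<xi> 1"
    using automorphism_props(5)[OF \<sigma>, of 1 "[:0, 1:]"] by (simp add: \<xi>_def flip: one_pCons)
  also have "\<sigma> (fr Z \<xi>) = fr (\<delta> W) (\<xi> ^ n)" using W CA WA by simp
  also have "fr (\<delta> W) (\<xi> ^ n) \<otimes>\<^bsub>L\<^esub> fr \<xi> 1 = fr (\<delta> W * \<xi>) (\<xi> ^ n)" using \<xi> by (simp add: fr_mult)
  finally have "fr w 1 = fr (\<delta> W * \<xi>) (\<xi> ^ n)" using w by simp
  then have dvd: "f dvd w * \<xi> ^ n - \<delta> W * \<xi>" using \<xi> by (simp add: fr_eq_iff)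
  have "total_degree_le (n + 1) (\<delta> W * \<xi>)"
    by (intro total_degree_le_mult \<delta>_form W) (simp add: \<xi>_def total_degree_le_const)
  then obtain w1 v where v: "\<delta> W * \<xi> = f * w1 + v" "degree v < d" "total_degree_le (n + 1) v"
    using division_with_total_degree[OF lead_f kappa degree_f _ total_degree_f] d2 by fastforce
  have eq: "(w * \<xi> ^ n - \<delta> W * \<xi>) + f * w1 = w * \<xi> ^ n - v" unfolding v(1) by simp
  have "f dvd (w * \<xi> ^ n - \<delta> W * \<xi>) + f * w1" by (rule dvd_add[OF dvd dvd_triv_left])
  then have "f dvd w * \<xi> ^ n - v" by (simp only: eq)
  moreover have "\<xi> ^ n = [:[:0, 1:] ^ n:]" by (simp add: \<xi>_def poly_const_pow)
  then have "degree (w * \<xi> ^ n) \<le> degree w" using degree_mult_le[of w "\<xi> ^ n"] by simp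
  then have "degree (w * \<xi> ^ n - v) < d" using w(1) v(2) by (intro degree_diff_less) simp_all
  ultimately have "w * \<xi> ^ n = v" using f_not_dvd_low_degree[of "w * \<xi> ^ n - v"] degree_f by auto
  then have "total_degree_le (n + 1) ([:[:0, 1:] ^ n:] * w)"
    using v(3) \<open>\<xi> ^ n = [:[:0, 1:] ^ n:]\<close> by (simp add: mult.commute)
  then have "total_degree_le 1 w" by (rule total_degree_divide_x_power)
  then show ?thesis using w by blast
qed

end

section \<open>The Galois group as a group of perspectivities\<close>

lemma total_degree_le_1:
  "total_degree_le 1 w \<longleftrightarrow> (\<exists>\<alpha> \<beta> \<gamma>. w = [:[:\<beta>, \<alpha>:], [:\<gamma>:]:])" for w :: "'a::field poly poly"
proof
  assume w: "total_degree_le 1 w"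
  obtain g u where gu: "w = pCons g u" by (cases w)
  then have g: "degree g \<le> Suc 0" and u: "total_degree_le 0 u"
    using w total_degree_le_pCons[of 0 g u] by simp_all
  have g': "g = [:coeff g 0, coeff g 1:]"
    using g by (intro poly_eqI) (auto simp: coeff_pCons coeff_eq_0 split: nat.splits)
  have u': "u = [:[:coeff (coeff u 0) 0:]:]"
  proof (intro poly_eqI)
    fix k i
    show "coeff (coeff u k) i = coeff (coeff [:[:coeff (coeff u 0) 0:]:] k) i"
      using u unfolding total_degree_le_def by (cases k; cases i) (auto simp: coeff_pCons)
  qed
  have "w = [:[:coeff g 0, coeff g 1:], [:coeff (coeff u 0) 0:]:]"
    unfolding gu by (rule arg_cong2[of _ _ _ _ pCons, OF g' u'])
  then show "\<exists>\<alpha> \<beta> \<gamma>. w = [:[:\<beta>, \<alpha>:], [:\<gamma>:]:]" by (intro exI)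
next
  assume "\<exists>\<alpha> \<beta> \<gamma>. w = [:[:\<beta>, \<alpha>:], [:\<gamma>:]:]"
  then show "total_degree_le 1 w"
    by (auto simp: total_degree_le_pCons[of 0, simplified] total_degree_le_const)
qed

lemma total_degree_pcompose:
  fixes u w :: "'a::field poly poly"
  assumes "total_degree_le 1 w"
  shows "total_degree_le n u \<Longrightarrow> total_degree_le n (pcompose u w)"
proof (induction n arbitrary: u)
  case 0
  then obtain g where "u = [:g:]" using degree_if_total_degree_le[of 0 u] degree_eq_zeroE by blast
  then show ?case using 0 by simp
next
  case (Suc n)
  obtain g v where u: "u = pCons g v" by (cases u)
  have "degree g \<le> Suc n" "total_degree_le n v"
    using Suc.prems by (simp_all only: u total_degree_le_pCons)
  moreover have "total_degree_le (1 + n) (w * pcompose v w)"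
    by (intro total_degree_le_mult assms Suc.IH) fact
  ultimately show ?case
    unfolding u pcompose_pCons by (intro total_degree_le_add total_degree_le_const) simp_all
qed

lemma ring_map_pcompose: "ring_map (\<lambda>u. pcompose u w)" for w :: "'b::comm_ring_1 poly"
  by (simp add: ring_map_def pcompose_add pcompose_mult pcompose_1)

context chart
begin

lemma fr_low_degree_inject:
  assumes "fr w 1 = fr w' 1" "degree w < d" "degree w' < d"
  shows "w = w'"
proof (rule ccontr)
  assume "w \<noteq> w'"
  then have "\<not> f dvd w - w'"
    using assms(2,3) degree_f d2 by (intro f_not_dvd_low_degree degree_diff_less) auto
  then show False using assms(1) by (simp add: fr_eq_iff)
qed

lemma homog_to_1: "degree u \<le> N \<Longrightarrow> homog_to N u w 1 = pcompose u w"
proof (induction N arbitrary: u)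
  case 0
  then obtain g where "u = [:g:]" using degree_eq_zeroE by blast
  then show ?case by (simp add: homog_to_def)
next
  case (Suc N)
  obtain g v where u: "u = pCons g v" by (cases u)
  have "degree v \<le> N" using Suc.prems u by (auto split: if_splits)
  then show ?case by (simp add: u homog_to_Suc pcompose_pCons Suc.IH)
qed

lemma aut_pcompose:
  assumes "\<sigma> \<in> Aut" and "\<sigma> (fr Z 1) = fr w 1"
  shows "\<sigma> (fr u 1) = fr (pcompose u w) 1"
  using aut_subst[OF assms(1) f_not_dvd_1 assms(2), of u "degree u"] by (simp add: homog_to_1)

lemma id_Aut: "id \<in> Aut"
  by (simp add: field_automorphisms_def ring_iso_set_refl)

lemma comp_Aut:
  assumes "\<sigma> \<in> Aut" and "\<tau> \<in> Aut"
  shows "\<sigma> \<circ> \<tau> \<in> Aut"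
  using assms ring_iso_set_trans[of \<tau> L L \<sigma> L] by (simp add: field_automorphisms_def)

definition linear_images :: "'a poly poly set" where
  "linear_images = {w. total_degree_le 1 w \<and> (\<exists>\<sigma>\<in>Aut. \<sigma> (fr Z 1) = fr w 1)}"

lemma linear_imagesI:
  "total_degree_le 1 w \<Longrightarrow> \<sigma> \<in> Aut \<Longrightarrow> \<sigma> (fr Z 1) = fr w 1 \<Longrightarrow> w \<in> linear_images"
  unfolding linear_images_def by blast

lemma linear_imagesE:
  assumes "w \<in> linear_images"
  obtains \<sigma> where "total_degree_le 1 w" "\<sigma> \<in> Aut" "\<sigma> (fr Z 1) = fr w 1"
  using assms unfolding linear_images_def by blast

definition linear_roots :: "'a poly poly set" where
  "linear_roots = {w. total_degree_le 1 w \<and> f dvd pcompose f w}"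

lemma degree_linear: "total_degree_le 1 w \<Longrightarrow> degree w \<le> 1" and degree_linear': "total_degree_le 1 w \<Longrightarrow> degree w < d"
  using degree_if_total_degree_le[of 1 w] d2 by auto

lemma linear_images_subset: "linear_images \<subseteq> linear_roots"
proof
  fix w assume "w \<in> linear_images"
  then obtain \<sigma> where w: "total_degree_le 1 w" "\<sigma> \<in> Aut" "\<sigma> (fr Z 1) = fr w 1"
    by (rule linear_imagesE)
  have "fr f 1 = fr [:0:] [:1:]" by (simp add: fr_eq_iff flip: one_pCons)
  then have "\<sigma> (fr f 1) = fr [:0:] [:1:]" using automorphism_props(5)[OF w(2), of 1 0] by simp
  then have "fr (pcompose f w) 1 = fr 0 1" using aut_pcompose[OF w(2,3)] by (simp flip: one_pCons)
  then show "w \<in> linear_roots" using w(1) by (simp add: fr_eq_iff linear_roots_def)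
qed

lemma finite_linear_roots: "finite linear_roots" and card_linear_roots_le: "card linear_roots \<le> d"
proof -
  have le: "card S \<le> d" if "finite S" "S \<subseteq> linear_roots" for S
    using card_linear_roots[OF that(1)] that(2) degree_linear degree_f by (auto simp: linear_roots_def)
  show fin: "finite linear_roots"
  proof (rule ccontr)
    assume "infinite linear_roots"
    then obtain S where "finite S" "card S = Suc d" "S \<subseteq> linear_roots"
      using infinite_arbitrarily_large by blast
    then show False using le[of S] by simp
  qed
  show "card linear_roots \<le> d" using le[OF fin] by simp
qed

text \<open>
  Let \<open>M(T)\<close> be the product of the \<open>T - s\<close> over the images \<open>s\<close> of \<open>z\<close>. The automorphisms permute its roots, so its
  coefficients lie in the fixed field, which is \<open>K(x)\<close>. After multiplication by a common denominator \<open>H\<close>, the relation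
  \<open>M(z) = 0\<close> becomes \<open>f dvd N\<close> with a polynomial \<open>N\<close> that has at most the degree of \<open>M\<close> in \<open>z\<close>.
\<close>

lemma card_linear_images:
  assumes galois: "galois_extension L base_field"
  shows "card linear_images \<ge> d"
proof -
  let ?S = linear_images
  have finS: "finite ?S" using finite_linear_roots linear_images_subset finite_subset by blast
  define M :: "'a poly poly poly" where "M = (\<Prod>s\<in>?S. [:- s, 1:])"
  have inv: "map_poly (\<lambda>u. pcompose u w) M = M" if w: "w \<in> ?S" for w
  proof -
    obtain \<sigma> where \<sigma>: "total_degree_le 1 w" "\<sigma> \<in> Aut" "\<sigma> (fr Z 1) = fr w 1"
      using w by (rule linear_imagesE)
    have maps: "pcompose s w \<in> ?S" if s: "s \<in> ?S" for s
    proof -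
      obtain \<tau> where \<tau>: "total_degree_le 1 s" "\<tau> \<in> Aut" "\<tau> (fr Z 1) = fr s 1"
        using s by (rule linear_imagesE)
      have "(\<sigma> \<circ> \<tau>) (fr Z 1) = fr (pcompose s w) 1" using \<tau>(3) aut_pcompose[OF \<sigma>(2,3)] by simp
      moreover have "total_degree_le 1 (pcompose s w)" by (rule total_degree_pcompose[OF \<sigma>(1) \<tau>(1)])
      ultimately show ?thesis using linear_imagesI[OF _ comp_Aut[OF \<sigma>(2) \<tau>(2)]] by blast
    qed
    have inj: "inj_on (\<lambda>s. pcompose s w) ?S"
    proof (rule inj_onI)
      fix s s' assume *: "s \<in> ?S" "s' \<in> ?S" "pcompose s w = pcompose s' w"
      then have "\<sigma> (fr s 1) = \<sigma> (fr s' 1)" by (simp add: aut_pcompose[OF \<sigma>(2,3)])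
      then have "fr s 1 = fr s' 1" using inj_onD[OF automorphism_props(4)[OF \<sigma>(2)]] fr_carrier by simp
      then show "s = s'" using * degree_linear' by (intro fr_low_degree_inject) (auto simp: linear_images_def)
    qed
    have "(\<lambda>s. pcompose s w) ` ?S = ?S"
      using maps inj finS by (intro card_subset_eq) (auto simp: card_image)
    then have "M = (\<Prod>s\<in>?S. [:- pcompose s w, 1:])"
      unfolding M_def using prod.reindex[OF inj, of "\<lambda>s. [:- s, 1:]"] by simp
    also have "\<dots> = map_poly (\<lambda>u. pcompose u w) M"
      unfolding M_def ring_map_prod[OF ring_map_map_poly[OF ring_map_pcompose]]
      by (simp add: map_poly_pCons pcompose_uminus pcompose_1)
    finally show ?thesis by simp
  qed
  have "\<exists>g h. h \<noteq> 0 \<and> f dvd coeff M i * [:h:] - [:g:]" for i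
  proof -
    have fixed: "pcompose (coeff M i) w = coeff M i" if "w \<in> ?S" for w
      using arg_cong[OF inv[OF that], of "\<lambda>p. coeff p i"] by (simp add: coeff_map_poly)
    have invariant: "\<sigma> (fr (coeff M i) 1) = fr (coeff M i) 1" if \<sigma>: "\<sigma> \<in> Aut" for \<sigma>
    proof -
      obtain w where w: "total_degree_le 1 w" "\<sigma> (fr Z 1) = fr w 1" using aut_linear[OF \<sigma>] by blast
      show ?thesis
        unfolding aut_pcompose[OF \<sigma> w(2)] fixed[OF linear_imagesI[OF w(1) \<sigma> w(2)]] by (rule refl)
    qed
    have "{x \<in> carrier L. \<forall>\<sigma>\<in>Aut. \<sigma> x = x} = base_field" using galois by (simp only: galois_extension_def)
    moreover have "fr (coeff M i) 1 \<in> {x \<in> carrier L. \<forall>\<sigma>\<in>Aut. \<sigma> x = x}"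
      by (intro CollectI conjI ballI fr_carrier f_not_dvd_1 invariant)
    ultimately have "fr (coeff M i) 1 \<in> {fr [:g:] [:h:] | g h. h \<noteq> 0}" by (simp only: pullback_eq)
    then obtain g h where gh: "h \<noteq> 0" "fr (coeff M i) 1 = fr [:g:] [:h:]" by blast
    have "f dvd coeff M i * [:h:] - [:g:] * 1"
      using gh(2) fr_eq_iff[OF f_not_dvd_1 f_not_dvd_const[OF gh(1)]] by blast
    then show ?thesis using gh(1) by (intro exI[of _ g] exI[of _ h]) (simp only: mult_1_right simp_thms)
  qed
  then obtain g h where gh: "\<And>i. h i \<noteq> 0" "\<And>i. f dvd coeff M i * [:h i:] - [:g i:]" by metis
  define n where "n = card ?S"
  have degM: "degree M = n" unfolding M_def n_def by (subst degree_prod_eq_sum_degree) auto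
  have "lead_coeff M = 1" unfolding M_def by (simp add: lead_coeff_prod)
  then have lead: "coeff M n = 1" by (simp add: degM)
  have "total_degree_le 1 Z" using total_degree_le_1[of Z] by (metis one_pCons pCons_0_0)
  then have "Z \<in> ?S" by (rule linear_imagesI[OF _ id_Aut]) simp
  then have M0: "poly M Z = 0" using finS by (auto simp: M_def poly_prod)
  define H where "H = (\<Prod>i\<le>n. h i)"
  define N where "N = (\<Sum>i\<le>n. monom (g i * (\<Prod>j\<in>{..n} - {i}. h j)) i)"
  have cN: "coeff N i = g i * (\<Prod>j\<in>{..n} - {i}. h j)" if "i \<le> n" for i
    using that by (simp add: N_def coeff_sum)
  have cong: "f dvd coeff M i * [:H:] - [:coeff N i:]" if i: "i \<le> n" for i
  proof -
    have "H = h i * (\<Prod>j\<in>{..n} - {i}. h j)" unfolding H_def using i by (simp add: prod.remove)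
    then have "coeff M i * [:H:] - [:coeff N i:]
        = (coeff M i * [:h i:] - [:g i:]) * [:\<Prod>j\<in>{..n} - {i}. h j:]"
      by (simp add: cN[OF i] algebra_simps)
    then show ?thesis using gh(2)[of i] by (simp only: dvd_mult2)
  qed
  have "N = (\<Sum>i\<le>n. [:coeff N i:] * Z ^ i)"
  proof -
    have "Z ^ i = monom 1 i" for i by (induction i) (simp_all add: monom_Suc monom_0 flip: one_pCons)
    then have "(\<Sum>i\<le>n. [:coeff N i:] * Z ^ i) = (\<Sum>i\<le>n. monom (coeff N i) i)"
      by (simp add: smult_monom)
    also have "\<dots> = N" by (rule poly_as_sum_of_monoms') (auto simp: N_def intro!: degree_sum_le degree_monom_le[THEN order_trans])
    finally show ?thesis by simp
  qed
  moreover have "f dvd (\<Sum>i\<le>n. coeff M i * [:H:] * Z ^ i) - (\<Sum>i\<le>n. [:coeff N i:] * Z ^ i)"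
    by (intro cong_sum cong_mult) (use cong in auto)
  moreover have "(\<Sum>i\<le>n. coeff M i * [:H:] * Z ^ i) = poly M Z * [:H:]"
    unfolding poly_altdef degM sum_distrib_right by (intro sum.cong) (simp_all add: mult_ac)
  ultimately have "f dvd N" using M0 by simp
  have "H \<noteq> 0" using gh(1) by (simp add: H_def)
  have "N \<noteq> 0"
  proof
    assume "N = 0"
    then have "f dvd [:H:]" using cong[of n] lead by simp
    then show False using f_not_dvd_const \<open>H \<noteq> 0\<close> by blast
  qed
  then have "degree f \<le> degree N" using \<open>f dvd N\<close> by (rule dvd_imp_degree_le[rotated])
  also have "degree N \<le> n" unfolding N_def
    by (auto intro!: degree_sum_le degree_monom_le[THEN order_trans])
  finally show ?thesis by (simp add: degree_f n_def)
qed

lemma card_linear_roots_eq: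
  assumes "galois_extension L base_field"
  shows "card linear_roots = d"
  using card_linear_images[OF assms] card_linear_roots_le
    card_mono[OF finite_linear_roots linear_images_subset] by simp

text \<open>
  The \<open>z\<close>-coordinate of the image of \<open>x r + q + z p\<close> under the perspectivity with covector \<open>u\<close>; its other
  coordinates are not changed.
\<close>

definition root_of_covector :: "'a ^ 3 \<Rightarrow> 'a poly poly" where
  "root_of_covector u = [:[:dotp u q, dotp u r:], [:1 + dotp u p:]:]"

lemma eval2_pcompose_root:
  "eval2 (pcompose f (root_of_covector u)) s t
     = eval3 F ((s *s r + q + t *s p) + dotp u (s *s r + q + t *s p) *s p)"
proof -
  have "s *s r + q + (eval2 (root_of_covector u) s t) *s p
      = (s *s r + q + t *s p) + dotp u (s *s r + q + t *s p) *s p"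
    by (simp add: root_of_covector_def vec_eq_iff algebra_simps)
  then show ?thesis by (simp only: eval2_pcompose f_def eval2_\<delta>)
qed

text \<open>
  If \<open>w\<close> does not involve \<open>z\<close>, then \<open>f(x, w) = 0\<close> would make \<open>z - w\<close> a proper factor of \<open>f\<close>.
\<close>

lemma pcompose_nonzero:
  assumes "total_degree_le 1 w"
  shows "pcompose f w \<noteq> 0"
proof
  assume 0: "pcompose f w = 0"
  have "f \<noteq> 0" using kappa lead_f by auto
  show False
  proof (cases "degree w = 0")
    case True
    then obtain g where "w = [:g:]" using degree_eq_zeroE by blast
    then have "poly f g = 0" using 0 by (simp add: pcompose_pCons_0)
    then obtain h where h: "f = [:- g, 1:] * h" by (auto simp: poly_eq_0_iff_dvd dvd_def)
    then have "degree h = 0" using irreducible_f[OF h] by simp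
    moreover have "h \<noteq> 0" using h \<open>f \<noteq> 0\<close> by auto
    then have "degree ([:- g, 1:] * h) = 1 + degree h" by (subst degree_mult_eq) auto
    ultimately show False using degree_f d2 unfolding h[symmetric] by simp
  next
    case False
    then show False using 0 \<open>f \<noteq> 0\<close> pcompose_eq_0[of f w] by simp
  qed
qed

text \<open>
  If \<open>f\<close> divides \<open>f(x, w)\<close>, then the quotient is a constant for degree reasons. The invariance of \<open>F\<close> is
  thus known on the chart; homogeneity extends it to all vectors with \<open>b \<noteq> 0\<close>, and polynomiality along lines to all vectors.
\<close>

lemma perspectivities_iff: "u \<in> perspectivities F p \<longleftrightarrow> root_of_covector u \<in> linear_roots"
proof
  assume "u \<in> perspectivities F p"
  then obtain e where e: "\<And>v. eval3 F (v + dotp u v *s p) = e * eval3 F v"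
    by (auto simp: perspectivities_def)
  have "pcompose f (root_of_covector u) = f * [:[:e:]:]"
  proof (rule eval2_eqI)
    fix s t
    show "eval2 (pcompose f (root_of_covector u)) s t = eval2 (f * [:[:e:]:]) s t"
      by (simp only: eval2_pcompose_root e) (simp add: f_def eval2_\<delta>)
  qed
  then have "f dvd pcompose f (root_of_covector u)" by (metis dvd_triv_left)
  moreover have "total_degree_le 1 (root_of_covector u)"
    unfolding total_degree_le_1 root_of_covector_def by blast
  ultimately show "root_of_covector u \<in> linear_roots" by (simp add: linear_roots_def)
next
  assume "root_of_covector u \<in> linear_roots"
  then have td: "total_degree_le 1 (root_of_covector u)" and "f dvd pcompose f (root_of_covector u)"
    by (auto simp: linear_roots_def)
  then obtain w where w: "pcompose f (root_of_covector u) = f * w" "w = 0 \<or> d \<le> d \<and> total_degree_le (d - d) w"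
    using quotient_total_degree[OF lead_f kappa degree_f _ total_degree_f, of d]
      total_degree_pcompose[OF td total_degree_f] d2 by auto
  have w0: "w \<noteq> 0" using pcompose_nonzero[OF td] w(1) by auto
  then have "total_degree_le 1 w" and "total_degree_le 0 w" using w(2) total_degree_le_mono[of 0 w 1] by auto
  then obtain \<alpha> \<beta> \<gamma> where "w = [:[:\<beta>, \<alpha>:], [:\<gamma>:]:]" using total_degree_le_1 by blast
  then have "coeff (coeff w 0) 1 = \<alpha>" "coeff (coeff w 1) 0 = \<gamma>" by simp_all
  then have "\<alpha> = 0" "\<gamma> = 0" using \<open>total_degree_le 0 w\<close> unfolding total_degree_le_def
    by (metis One_nat_def add.right_neutral add_0 le_zero_eq nat.simps(3))+
  then have we: "w = [:[:\<beta>:]:]" using \<open>w = _\<close> by simp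
  then have \<beta>: "\<beta> \<noteq> 0" using w0 by auto
  have chart: "eval3 F ((s *s r + q + t *s p) + dotp u (s *s r + q + t *s p) *s p)
      = \<beta> * eval3 F (s *s r + q + t *s p)" for s t
    unfolding eval2_pcompose_root[symmetric] w(1) we by (simp add: f_def eval2_\<delta>)
  have off: "eval3 F (v + dotp u v *s p) = \<beta> * eval3 F v" if bv: "dotp b v \<noteq> 0" for v
  proof -
    let ?v = "(dotp a v / dotp b v) *s r + q + (dotp c v / dotp b v) *s p"
    have v: "v = dotp b v *s ?v"
      using bv by (subst (1) expand) (simp add: vec_eq_iff field_simps)
    have "v + dotp u v *s p = dotp b v *s (?v + dotp u ?v *s p)"
    proof -
      have "dotp u v = dotp b v * dotp u ?v" by (subst (1) v) (simp only: dotp_simps)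
      moreover have "dotp b v *s (?v + dotp u ?v *s p) = dotp b v *s ?v + (dotp b v * dotp u ?v) *s p"
        by (simp only: vector_add_ldistrib vector_smult_assoc)
      ultimately show ?thesis using v by metis
    qed
    then have "eval3 F (v + dotp u v *s p) = dotp b v ^ d * eval3 F (?v + dotp u ?v *s p)"
      by (simp only: eval3_scale[OF form_F])
    also have "\<dots> = \<beta> * (dotp b v ^ d * eval3 F ?v)" unfolding chart by (simp only: mult_ac)
    also have "dotp b v ^ d * eval3 F ?v = eval3 F v" using v eval3_scale[OF form_F] by metis
    finally show ?thesis .
  qed
  have "eval3 F (v + dotp u v *s p) = \<beta> * eval3 F v" for v
  proof (cases "dotp b v = 0")
    case True
    define g where "g v = eval3 F (v + dotp u v *s p) - \<beta> * eval3 F v" for v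
    have "poly_on_lines g" unfolding g_def
      by (intro poly_on_lines_diff poly_on_lines_mult poly_on_lines_const poly_on_lines_eval3
          poly_on_lines_perspectivity)
    moreover have "g (v + t *s q) = 0" if "t \<noteq> 0" for t
      unfolding g_def by (subst off) (simp_all add: True that)
    ultimately have "g v = 0" by (rule poly_on_lines_limit)
    then show ?thesis by (simp add: g_def)
  qed (rule off)
  then show "u \<in> perspectivities F p" using \<beta> unfolding perspectivities_def by blast
qed

lemma card_perspectivities:
  assumes "galois_extension L base_field"
  shows "card (perspectivities F p) = d"
proof -
  have "bij_betw root_of_covector (perspectivities F p) linear_roots"
  proof (rule bij_betw_imageI)
    show "inj_on root_of_covector (perspectivities F p)"
    proof (rule inj_onI, rule dotp_eqI)
      fix u u' v assume "root_of_covector u = root_of_covector u'"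
      then have "dotp u r = dotp u' r" "dotp u q = dotp u' q" "dotp u p = dotp u' p"
        by (auto simp: root_of_covector_def)
      then show "dotp u v = dotp u' v" by (subst (1 2) expand[of v]) simp
    qed
    show "root_of_covector ` perspectivities F p = linear_roots"
    proof (intro equalityI subsetI)
      fix w assume "w \<in> root_of_covector ` perspectivities F p"
      then show "w \<in> linear_roots" using perspectivities_iff by blast
    next
      fix w assume w: "w \<in> linear_roots"
      then obtain \<alpha> \<beta> \<gamma> where "w = [:[:\<beta>, \<alpha>:], [:\<gamma>:]:]" 
        unfolding linear_roots_def total_degree_le_1 by blast
      then have "w = root_of_covector (\<alpha> *s a + \<beta> *s b + (\<gamma> - 1) *s c)" by (simp add: root_of_covector_def)
      then show "w \<in> root_of_covector ` perspectivities F p" using w perspectivities_iff by blast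
    qed
  qed
  then show ?thesis using card_linear_roots_eq[OF assms] by (simp add: bij_betw_same_card)
qed

end

section \<open>Outer Galois points\<close>

definition cross :: "'a::comm_ring_1 ^ 3 \<Rightarrow> 'a ^ 3 \<Rightarrow> 'a ^ 3" where
  "cross u v = vector [u $ 2 * v $ 3 - u $ 3 * v $ 2, u $ 3 * v $ 1 - u $ 1 * v $ 3,
     u $ 1 * v $ 2 - u $ 2 * v $ 1]"

lemma cross_nonzero:
  fixes u v :: "'a::field ^ 3"
  assumes "u \<noteq> v" and "vec.independent {u, v}"
  shows "cross u v \<noteq> 0"
proof
  assume "cross u v = 0"
  then have *: "u $ 2 * v $ 3 = u $ 3 * v $ 2" "u $ 3 * v $ 1 = u $ 1 * v $ 3" "u $ 1 * v $ 2 = u $ 2 * v $ 1"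
    by (simp_all add: cross_def vec_eq_iff forall_3)
  have "v \<notin> vec.span {u}" using assms by (simp add: insert_commute[of u] vec.independent_insert)
  moreover have "u \<noteq> 0" using assms(2) vec.dependent_zero by blast
  then have "u $ 1 \<noteq> 0 \<or> u $ 2 \<noteq> 0 \<or> u $ 3 \<noteq> 0" by (auto simp: vec_eq_iff forall_3)
  then have "\<exists>k. v = k *s u"
  proof (elim disjE)
    assume "u $ 1 \<noteq> 0" then show ?thesis
      using * by (intro exI[of _ "v $ 1 / u $ 1"]) (simp add: vec_eq_iff forall_3 field_simps)
  next
    assume "u $ 2 \<noteq> 0" then show ?thesis
      using * by (intro exI[of _ "v $ 2 / u $ 2"]) (simp add: vec_eq_iff forall_3 field_simps)
  next
    assume "u $ 3 \<noteq> 0" then show ?thesis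
      using * by (intro exI[of _ "v $ 3 / u $ 3"]) (simp add: vec_eq_iff forall_3 field_simps)
  qed
  ultimately show False by (auto simp: vec.span_singleton)
qed

text \<open>
  The covectors \<open>a, b\<close> of the pencil are completed by some \<open>c\<close> with determinant one, and the cross products
  form the dual basis.
\<close>

lemma outer_galois_point_perspectivities:
  fixes F :: "'a::alg_closed_field poly3"
  assumes smooth: "smooth_plane_curve d F" and d: "d \<ge> 2" and P: "outer_galois_point F P"
  shows "\<exists>p. P = vec.span {p} \<and> eval3 F p \<noteq> 0 \<and> card (perspectivities F p) = d"
proof -
  obtain a b where ab: "pencil_basis P a b" and galois: "galois_extension (function_field F) (pullback_field F a b)"
    and PP: "P \<in> proj_plane" and PC: "P \<notin> curve F"
    using P by (auto simp: outer_galois_point_def)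
  have abP: "a \<noteq> b" "vec.independent {a, b}" "\<And>v. v \<in> P \<Longrightarrow> dotp a v = 0 \<and> dotp b v = 0"
    using ab by (auto simp: pencil_basis_def)
  define p where "p = cross a b"
  have "p \<noteq> 0" unfolding p_def by (rule cross_nonzero[OF abP(1,2)])
  then obtain i where i: "p $ i \<noteq> 0" by (auto simp: vec_eq_iff)
  define c :: "'a ^ 3" where "c = axis i (inverse (p $ i))"
  have cp: "dotp c p = 1" using i by (cases i rule: exhaust_3[THEN disjE]) (auto simp: c_def dotp_def axis_def)
  define r where "r = cross b c"
  define q where "q = cross c a"
  have det: "dotp c (cross a b) = 1" using cp by (simp add: p_def)
  have cyc: "dotp a (cross b c) = dotp c (cross a b)" "dotp b (cross c a) = dotp c (cross a b)"
    by (simp_all add: dotp_def cross_def algebra_simps)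
  have perp: "dotp u (cross u v) = 0" "dotp v (cross u v) = 0" for u v :: "'a ^ 3"
    by (simp_all add: dotp_def cross_def algebra_simps)
  have expand: "v = dotp a v *s r + dotp b v *s q + dotp c v *s p" for v
  proof -
    have "dotp a v *s r + dotp b v *s q + dotp c v *s p = dotp c (cross a b) *s v"
      by (simp add: vec_eq_iff forall_3 r_def q_def p_def dotp_def cross_def algebra_simps)
    then show ?thesis by (simp add: det)
  qed
  have Psub: "v = dotp c v *s p" if "v \<in> P" for v
    using expand[of v] abP(3)[OF that] by simp
  have sub: "vec.subspace P" and dim: "vec.dim P = 1" using PP by (auto simp: proj_plane_def)
  have "\<exists>v\<in>P. v \<noteq> 0"
  proof (rule ccontr)
    assume "\<not> ?thesis"
    then have "P \<subseteq> vec.span {}" by auto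
    then have "vec.dim P \<le> card ({} :: ('a ^ 3) set)" by (intro vec.dim_le_card) auto
    then show False using dim by simp
  qed
  then obtain v0 where v0: "v0 \<in> P" "v0 \<noteq> 0" by blast
  then have "dotp c v0 \<noteq> 0" using Psub[OF v0(1)] by auto
  moreover have "p = inverse (dotp c v0) *s v0"
    using \<open>dotp c v0 \<noteq> 0\<close> by (subst (2) Psub[OF v0(1)]) (simp add: vec_eq_iff)
  ultimately have "p \<in> P" using v0(1) vec.subspace_scale[OF sub] by metis
  have span: "P = vec.span {p}"
  proof
    show "P \<subseteq> vec.span {p}" using Psub by (auto simp: vec.span_singleton)
    show "vec.span {p} \<subseteq> P" using vec.span_minimal[of "{p}" P] \<open>p \<in> P\<close> sub by simp
  qed
  have form: "form d F" using smooth by (simp add: smooth_plane_curve_def)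
  obtain v1 where v1: "v1 \<in> P" "eval3 F v1 \<noteq> 0" using PP PC by (auto simp: curve_def)
  have Fp: "eval3 F p \<noteq> 0"
  proof
    assume "eval3 F p = 0"
    then have "eval3 F (dotp c v1 *s p) = 0" by (simp add: eval3_scale[OF form])
    then show False using v1 Psub[OF v1(1)] by simp
  qed
  have "chart F d a b c p q r"
  proof (rule chart.intro)
    show "dotp a r = 1" "dotp b q = 1" "dotp c p = 1"
      using det cyc by (simp_all add: p_def q_def r_def)
    show "dotp a q = 0" "dotp a p = 0" "dotp b r = 0" "dotp b p = 0" "dotp c r = 0" "dotp c q = 0"
      by (simp_all add: p_def q_def r_def perp)
    show "\<And>v. v = dotp a v *s r + dotp b v *s q + dotp c v *s p" by (rule expand)
    show "field (function_field F)" using galois by (simp add: galois_extension_def)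
  qed (rule smooth d Fp)+
  then have "card (perspectivities F p) = d" using chart.card_perspectivities galois by blast
  then show ?thesis using span Fp by blast
qed

theorem theorem2:
  fixes F :: "'a::alg_closed_field poly3" and p e l d :: nat
  assumes "CHAR('a) = p" and "p > 0"
    and "e \<ge> 1" and "l \<ge> 1" and "\<not> p dvd l"
    and "d = p ^ e * l" and "d \<ge> 4"
    and "smooth_plane_curve d F"
    and "\<not> (p = 2 \<and> l = 1)"
  shows "outer_galois_number F \<le> 1"
proof -
  have unique: "P = Q" if PQ: "outer_galois_point F P" "outer_galois_point F Q" for P Q
  proof (rule ccontr)
    assume "P \<noteq> Q"
    obtain u where u: "P = vec.span {u}" "eval3 F u \<noteq> 0" "card (perspectivities F u) = d"
      using outer_galois_point_perspectivities[OF assms(8) _ PQ(1)] assms(7) by auto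
    obtain v where v: "Q = vec.span {v}" "eval3 F v \<noteq> 0" "card (perspectivities F v) = d"
      using outer_galois_point_perspectivities[OF assms(8) _ PQ(2)] assms(7) by auto
    have form: "form d F" using assms(8) by (simp add: smooth_plane_curve_def)
    have nz: "w \<noteq> 0" if "eval3 F w \<noteq> 0" for w
    proof
      assume "w = 0"
      then have "w = 0 *s w" by simp
      then have "eval3 F w = 0 ^ d * eval3 F w" using eval3_scale[OF form] by metis
      then show False using that assms(7) by (simp add: power_0_left)
    qed
    have "indep2 u v"
    proof (rule ccontr)
      assume "\<not> indep2 u v"
      then obtain \<alpha> \<beta> where ab: "\<alpha> *s u + \<beta> *s v = 0" "\<alpha> \<noteq> 0 \<or> \<beta> \<noteq> 0" by (auto simp: indep2_def)
      have eq: "\<alpha> *s u = (- \<beta>) *s v" using ab(1) by (simp add: eq_neg_iff_add_eq_0)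
      have \<alpha>: "\<alpha> \<noteq> 0" using eq ab(2) nz[OF v(2)] by auto
      have \<beta>: "\<beta> \<noteq> 0" using eq \<alpha> nz[OF u(2)] by auto
      have "inverse \<alpha> *s (\<alpha> *s u) = inverse \<alpha> *s ((- \<beta>) *s v)" by (simp only: eq)
      then have uv: "u = (inverse \<alpha> * - \<beta>) *s v" using \<alpha> by (simp add: vector_smult_assoc)
      define k where "k = inverse \<alpha> * - \<beta>"
      have k: "k \<noteq> 0" "u = k *s v" using \<alpha> \<beta> uv by (simp_all add: k_def)
      have vu: "v = inverse k *s u" using k by (simp add: vector_smult_assoc)
      have "u \<in> vec.span {v}" unfolding k(2) by (intro vec.span_scale vec.span_base) simp
      moreover have "v \<in> vec.span {u}" by (subst vu) (intro vec.span_scale vec.span_base, simp)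
      ultimately have "vec.span {u} = vec.span {v}" by (simp add: vec.span_eq)
      then have "P = Q" by (simp only: u(1) v(1))
      then show False using \<open>P \<noteq> Q\<close> by contradiction
    qed
    have "p dvd d" using assms(3,6) by (cases e) auto
    have char: "CHAR('a) > 0" "CHAR('a) dvd d" "d = CHAR('a) ^ e * l" "\<not> CHAR('a) dvd l"
      "\<not> (CHAR('a) = 2 \<and> l = 1)"
      unfolding assms(1) by fact+
    have "d > 0" using assms(7) by simp
    interpret two_centres F u v d e l
      by unfold_locales (fact form \<open>d > 0\<close> u v char assms(8) \<open>indep2 u v\<close>)+
    show False by (rule no_two_galois_centres)
  qed
  have "{P. outer_galois_point F P} \<subseteq> {SOME P. outer_galois_point F P}"
    using unique someI[of "outer_galois_point F"] by blast
  then have "finite {P. outer_galois_point F P}" "card {P. outer_galois_point F P} \<le> 1"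
    using finite_subset card_mono[of "{SOME P. outer_galois_point F P}" "{P. outer_galois_point F P}"] by auto
  then show ?thesis by (simp add: outer_galois_number_def one_enat_def)
qed

end
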